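(* Let $\Phi$ be a stationary locally square-integrable random measure on $\mathbb R^d$ and let $Z=\{Z(x):x\in\mathbb R^d\}$ be a stationary random element of $\mathbf F$, independent of $\Phi$. Assume that $$\int\big\|\mathbb P((Z(y),Z(0))\in\cdot)-\mathbb P(Z(0)\in\cdot)^{\otimes2}\big\|\,\alpha_\Phi(\mathrm dy)<\infty .$$ Let $$\Gamma:=\int\mathbf 1\{x+Z(x)\in\cdot\}\,\Phi(\mathrm dx)$$ and let $W\in\mathcal K_0$. If $\Phi$ is hyperuniform with respect to $W$, then so is $\Gamma$. If either $W$ is Fourier smooth or $|\beta_\Phi|(\mathbb R^d)<\infty$, then $\Phi$ and $\Gamma$ have the same asymptotic variance with respect to $W$, provided one of these asymptotic variances exists.
   Context: A random measure on $\mathbb R^d$ is a random locally finite measure; $\Phi$ is stationary if $\Phi(\cdot+x)\overset{d}{=}\Phi$ for all $x\in\mathbb R^d$, and locally square-integrable if $\mathbb E\Phi(B)^2<\infty$ for all bounded Borel $B$. Its intensity $\gamma=\mathbb E\Phi([0,1]^d)$ is positive (and finite). The reduced second moment measure is $\alpha_\Phi(B):=\mathbb E\int\mathbf 1\{x\in[0,1]^d,y-x\in B\}\,\Phi^2(\mathrm d(x,y))$ and the covariance measure is the signed measure $\beta_\Phi:=\alpha_\Phi-\gamma^2\lambda_d$, with total variation measure $|\beta_\Phi|$; $\lambda_d$ is Lebesgue measure. For a finite signed measure $\nu$, $\|\nu\|:=\sup|\int f\,\mathrm d\nu|$ over measurable $f$ with values in $[-1,1]$. $\mathbf F$ is the Skorohod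 space of all càdlàg functions $\mathbf w\colon\mathbb R^d\to\mathbb R^d$: for every $x$ and each of the $2^d$ sets $Q$ obtained by choosing for every coordinate $i$ either $\{y_i\ge x_i\}$ or $\{y_i<x_i\}$, the limit of $\mathbf w(y)$ as $y\to x$, $y\in Q$, exists, and for $Q=\{y:y_i\ge x_i\ \forall i\}$ it equals $\mathbf w(x)$. $\mathbf F$ carries the $\sigma$-field generated by the evaluations. $Z$ is stationary if $Z(\cdot+x)\overset{d}{=}Z$ for all $x\in\mathbb R^d$. $\mathcal K_0$ is the set of convex bounded sets containing $0$ in their interior. A bounded Borel set $B$ is Fourier smooth if there are $c,\vartheta>0$ with $|\widehat{\mathbf 1_B}(k)|\le c(1+\|k\|)^{-(d+\vartheta)/2}$ for all $k\in\mathbb R^d$, where $\hat f(k)=\int f(x)e^{-i\langle k,x\rangle}\mathrm dx$. The asymptotic variance of $\Psi$ w.r.t. $W$ is $\lim_{r\to\infty}\lambda_d(rW)^{-1}\operatorname{Var}[\Psi(rW)]$ (if it exists); $\Psi$ is hyperuniform w.r.t. $W$ if this limit is $0$. *)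

theory Defs
  imports "HOL-Probability.Probability"
begin

section \<open>Random measures\<close>

definition locally_finite_measures :: "(real ^ 'd) measure set" where
  "locally_finite_measures =
     {\<mu>. sets \<mu> = sets borel \<and> (\<forall>B\<in>sets borel. bounded B \<longrightarrow> emeasure \<mu> B < \<infinity>)}"

text \<open>The space of locally finite measures with the \<open>\<sigma>\<close>-field generated by the evaluations
  \<open>\<mu> \<mapsto> \<mu> B\<close> (constructed as \<^const>\<open>subprob_algebra\<close>).\<close>

definition locally_finite_algebra :: "(real ^ 'd) measure measure" where
  "locally_finite_algebra =
     (SUP B\<in>sets borel. vimage_algebra locally_finite_measures (\<lambda>\<mu>. emeasure \<mu> B) borel)"

definition random_measure :: "'w measure \<Rightarrow> ('w \<Rightarrow> (real ^ 'd) measure) \<Rightarrow> bool" where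
  "random_measure M \<Phi> \<longleftrightarrow> \<Phi> \<in> measurable M locally_finite_algebra"

text \<open>\<open>shift_measure x \<mu>\<close> is \<open>\<mu>(\<cdot> + x)\<close>: the set \<open>B + x\<close> is the preimage of \<open>B\<close> under
  \<open>y \<mapsto> y - x\<close>.\<close>

definition shift_measure :: "real ^ 'd \<Rightarrow> (real ^ 'd) measure \<Rightarrow> (real ^ 'd) measure" where
  "shift_measure x \<mu> = distr \<mu> borel (\<lambda>y. y - x)"

definition stationary_measure :: "'w measure \<Rightarrow> ('w \<Rightarrow> (real ^ 'd) measure) \<Rightarrow> bool" where
  "stationary_measure M \<Phi> \<longleftrightarrow>
     (\<forall>x. distr M locally_finite_algebra (\<lambda>\<omega>. shift_measure x (\<Phi> \<omega>)) =
          distr M locally_finite_algebra \<Phi>)"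

definition locally_square_integrable :: "'w measure \<Rightarrow> ('w \<Rightarrow> (real ^ 'd) measure) \<Rightarrow> bool" where
  "locally_square_integrable M \<Phi> \<longleftrightarrow>
     (\<forall>B\<in>sets borel. bounded B \<longrightarrow> (\<integral>\<^sup>+\<omega>. (emeasure (\<Phi> \<omega>) B)\<^sup>2 \<partial>M) < \<infinity>)"

text \<open>Here \<open>cbox 0 1\<close> is the unit cube, \<open>1\<close> being the vector with all coordinates one.\<close>

definition intensity :: "'w measure \<Rightarrow> ('w \<Rightarrow> (real ^ 'd) measure) \<Rightarrow> real" where
  "intensity M \<Phi> = (\<integral>\<omega>. measure (\<Phi> \<omega>) (cbox 0 1) \<partial>M)"

definition reduced_second_moment_measure ::
    "'w measure \<Rightarrow> ('w \<Rightarrow> (real ^ 'd) measure) \<Rightarrow> (real ^ 'd) measure" where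
  "reduced_second_moment_measure M \<Phi> = measure_of UNIV (sets borel)
     (\<lambda>B. \<integral>\<^sup>+\<omega>. (\<integral>\<^sup>+(x, y). indicator (cbox 0 1) x * indicator B (y - x)
                      \<partial>(\<Phi> \<omega> \<Otimes>\<^sub>M \<Phi> \<omega>)) \<partial>M)"

text \<open>The covariance measure is in general only locally finite, so it is a set function on the
  bounded Borel sets; its values on other sets carry no meaning.\<close>

definition covariance_measure ::
    "'w measure \<Rightarrow> ('w \<Rightarrow> (real ^ 'd) measure) \<Rightarrow> (real ^ 'd) set \<Rightarrow> real" where
  "covariance_measure M \<Phi> B =
     measure (reduced_second_moment_measure M \<Phi>) B - (intensity M \<Phi>)\<^sup>2 * measure lborel B"

text \<open>Total variation measure, at \<open>B\<close>, of a signed measure given on the bounded Borel sets: the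
  supremum over finite families of disjoint bounded Borel subsets of \<open>B\<close>.\<close>

definition total_variation :: "((real ^ 'd) set \<Rightarrow> real) \<Rightarrow> (real ^ 'd) set \<Rightarrow> ennreal" where
  "total_variation \<beta> B =
     (SUP P\<in>{P. finite P \<and> disjoint P \<and> (\<forall>A\<in>P. A \<in> sets borel \<and> bounded A \<and> A \<subseteq> B)}.
        \<Sum>A\<in>P. ennreal \<bar>\<beta> A\<bar>)"

text \<open>\<open>norm_difference \<mu> \<nu>\<close> is \<open>\<parallel>\<mu> - \<nu>\<parallel>\<close> for finite measures \<open>\<mu>\<close> and \<open>\<nu>\<close> on the same \<open>\<sigma>\<close>-field.\<close>

definition norm_difference :: "'a measure \<Rightarrow> 'a measure \<Rightarrow> ennreal" where
  "norm_difference \<mu> \<nu> =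
     (SUP f\<in>{f \<in> borel_measurable \<mu>. range f \<subseteq> {-1..1::real}}.
        ennreal \<bar>(\<integral>x. f x \<partial>\<mu>) - (\<integral>x. f x \<partial>\<nu>)\<bar>)"

section \<open>The Skorohod space\<close>

text \<open>The set \<open>Q\<close> at \<open>x\<close> whose coordinates in \<open>I\<close> satisfy \<open>y\<^sub>i \<ge> x\<^sub>i\<close> and the others \<open>y\<^sub>i < x\<^sub>i\<close>.\<close>

definition quadrant :: "real ^ 'd \<Rightarrow> 'd set \<Rightarrow> (real ^ 'd) set" where
  "quadrant x I = {y. \<forall>i. if i \<in> I then y $ i \<ge> x $ i else y $ i < x $ i}"

definition skorohod_space :: "(real ^ 'd \<Rightarrow> real ^ 'd) set" where
  "skorohod_space = {w. \<forall>x. (\<forall>I. \<exists>l. (w \<longlongrightarrow> l) (at x within quadrant x I)) \<and>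
                            (w \<longlongrightarrow> w x) (at x within quadrant x UNIV)}"

text \<open>The trace of the product \<open>\<sigma>\<close>-field, that is, the \<open>\<sigma>\<close>-field generated by the evaluations.\<close>

definition skorohod_algebra :: "(real ^ 'd \<Rightarrow> real ^ 'd) measure" where
  "skorohod_algebra = restrict_space (\<Pi>\<^sub>M x\<in>UNIV. borel) skorohod_space"

definition stationary_field :: "'w measure \<Rightarrow> ('w \<Rightarrow> real ^ 'd \<Rightarrow> real ^ 'd) \<Rightarrow> bool" where
  "stationary_field M Z \<longleftrightarrow>
     (\<forall>x. distr M skorohod_algebra (\<lambda>\<omega> y. Z \<omega> (y + x)) = distr M skorohod_algebra Z)"

text \<open>Independence of random elements of different spaces, as independence of the \<open>\<sigma>\<close>-fields they
  generate; \<^const>\<open>prob_space.indep_var\<close> requires values in a common type.\<close>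

definition independent_elements ::
    "'w measure \<Rightarrow> 'a measure \<Rightarrow> ('w \<Rightarrow> 'a) \<Rightarrow> 'b measure \<Rightarrow> ('w \<Rightarrow> 'b) \<Rightarrow> bool" where
  "independent_elements M S X T Y \<longleftrightarrow>
     prob_space.indep_set M (sets (vimage_algebra (space M) X S)) (sets (vimage_algebra (space M) Y T))"

definition displaced_measure ::
    "('w \<Rightarrow> (real ^ 'd) measure) \<Rightarrow> ('w \<Rightarrow> real ^ 'd \<Rightarrow> real ^ 'd) \<Rightarrow> 'w \<Rightarrow> (real ^ 'd) measure" where
  "displaced_measure \<Phi> Z \<omega> = distr (\<Phi> \<omega>) borel (\<lambda>x. x + Z \<omega> x)"

section \<open>Asymptotic variance and hyperuniformity\<close>

text \<open>Convex sets need not be Borel, so measurability, needed for \<open>\<Phi>(rW)\<close>, is required explicitly.\<close>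

definition convex_windows :: "(real ^ 'd) set set" where
  "convex_windows = {W. convex W \<and> bounded W \<and> 0 \<in> interior W \<and> W \<in> sets borel}"

definition fourier_transform :: "(real ^ 'd \<Rightarrow> complex) \<Rightarrow> real ^ 'd \<Rightarrow> complex" where
  "fourier_transform f k = (\<integral>x. f x * exp (- \<i> * complex_of_real (k \<bullet> x)) \<partial>lborel)"

definition fourier_smooth :: "(real ^ 'd) set \<Rightarrow> bool" where
  "fourier_smooth B \<longleftrightarrow> bounded B \<and> B \<in> sets borel \<and>
     (\<exists>c \<theta>. c > 0 \<and> \<theta> > 0 \<and>
       (\<forall>k. cmod (fourier_transform (indicator B) k)
              \<le> c * (1 + norm k) powr (- (real CARD('d) + \<theta>) / 2)))"

text \<open>The first two conjuncts ensure that \<open>\<Psi>(rW)\<close> is a square-integrable (in particular almost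
  surely finite) random variable; without them \<^const>\<open>prob_space.variance\<close> could take the default
  value 0 of the Bochner integral. The limit is a real number.\<close>

definition has_asymptotic_variance ::
    "'w measure \<Rightarrow> ('w \<Rightarrow> (real ^ 'd) measure) \<Rightarrow> (real ^ 'd) set \<Rightarrow> real \<Rightarrow> bool" where
  "has_asymptotic_variance M \<Psi> W s \<longleftrightarrow>
     (\<forall>r>0. (\<lambda>\<omega>. emeasure (\<Psi> \<omega>) ((*\<^sub>R) r ` W)) \<in> borel_measurable M) \<and>
     (\<forall>r>0. (\<integral>\<^sup>+\<omega>. (emeasure (\<Psi> \<omega>) ((*\<^sub>R) r ` W))\<^sup>2 \<partial>M) < \<infinity>) \<and>
     ((\<lambda>r. prob_space.variance M (\<lambda>\<omega>. measure (\<Psi> \<omega>) ((*\<^sub>R) r ` W)) / measure lborel ((*\<^sub>R) r ` W))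
        \<longlongrightarrow> s) at_top"

definition hyperuniform ::
    "'w measure \<Rightarrow> ('w \<Rightarrow> (real ^ 'd) measure) \<Rightarrow> (real ^ 'd) set \<Rightarrow> bool" where
  "hyperuniform M \<Psi> W \<longleftrightarrow> has_asymptotic_variance M \<Psi> W 0"

end

(* The second moments of the displaced measure and of the smeared window x |-> P(x + Z(0) in rW)
   are integrals of overlap volumes against the reduced second moment measure; they differ by at
   most vol(rW) times the mixing integrand, so by dominated convergence Gamma(rW) and the smeared
   window have the same asymptotic variance. Smearing is averaging of translates, hence decreases
   the variance, which gives the hyperuniform part. If the covariance measure has finite total
   variation, the remaining difference vanishes by dominated convergence once more. If W is Fourier
   smooth, it is controlled by the variances of the increments 1_rW - 1_(rW + z). The latter are
   bounded by variances of the dyadic windows 2^-j rW, because the squared Fourier transform of the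
   increment is dominated by a weighted sum of those of the dyadic windows; such a domination passes
   to variances since the Fourier transform of the Gaussian-windowed covariance measure is
   nonnegative. This replaces the Bartlett spectral measure. *)
theory Submission
  imports Defs
begin

section \<open>Locally finite measures as kernels\<close>

text \<open>The covariance measure is signed and in general infinite, so an inequality between two
  autocorrelations does not pass to \<open>L\<close>; on the space side the increment of a window
  cannot be compared with smaller windows. Positivity appears only in the frequency domain, after a
  Gaussian cut-off of the same scale in space and in frequency, which is removed at the end.

  The exponent (d + \<theta>)/2 in Fourier smoothness is what makes the sum over dyadic windows
  converge: where r |k| is of order 2^j, the squared transform decays like 2^(-(d+\<theta>)j),
  comparison with the low frequencies of the smaller window costs 4^(dj), and its variance, of order
  (2^-j r)^d, gains 2^(-dj). The product is 2^(-\<theta>j).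

  An increment over z is controlled through |z|/r alone, so dominated convergence over the law of
  Z(0) suffices and no moment of Z(0) enters. If only \<Gamma> is known to have an asymptotic
  variance, this bounds the smeared windows, whereas the increments require bounds for the sharp
  windows at all smaller scales; the circle is broken by absorbing a supremum that reappears with a
  factor below 1.\<close>

lemma ball_cball_cbox_borel [measurable]:
  fixes a b :: "'a :: euclidean_space"
  shows "cball a r \<in> sets borel" "ball a r \<in> sets borel" "cbox a b \<in> sets borel"
  by auto

lemma space_locally_finite_algebra:
  "space locally_finite_algebra = (locally_finite_measures :: (real ^ 'd) measure set)"
  by (auto simp: locally_finite_algebra_def space_Sup_eq_UN)

lemma measurable_emeasure_locally_finite_algebra [measurable]:
  "B \<in> sets borel \<Longrightarrow>
    (\<lambda>N. emeasure N B) \<in> borel_measurable (locally_finite_algebra :: (real ^ 'd) measure measure)"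
  by (auto intro!: measurable_Sup1 measurable_vimage_algebra1 simp: locally_finite_algebra_def)

lemma measurable_locally_finite_algebra:
  assumes "\<And>a. a \<in> space M \<Longrightarrow> K a \<in> locally_finite_measures"
    and "\<And>B. B \<in> sets borel \<Longrightarrow> (\<lambda>a. emeasure (K a) B) \<in> borel_measurable M"
  shows "K \<in> measurable M (locally_finite_algebra :: (real ^ 'd) measure measure)"
  using assms
  by (auto intro!: measurable_Sup2 measurable_vimage_algebra2 simp: locally_finite_algebra_def)

lemma locally_finite_measuresD:
  assumes "N \<in> locally_finite_measures"
  shows "sets N = sets borel" "space N = UNIV"
    and "bounded B \<Longrightarrow> B \<in> sets borel \<Longrightarrow> emeasure N B < \<infinity>"
  using assms sets_eq_imp_space_eq[of N borel] by (auto simp: locally_finite_measures_def)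

lemma sigma_finite_locally_finite:
  assumes N: "N \<in> locally_finite_measures"
  shows "sigma_finite_measure (N :: (real ^ 'd) measure)"
proof
  show "\<exists>A. countable A \<and> A \<subseteq> sets N \<and> \<Union> A = space N \<and> (\<forall>a\<in>A. emeasure N a \<noteq> \<infinity>)"
  proof (intro exI[of _ "range (\<lambda>n. cball 0 (real n))"] conjI ballI)
    show "\<Union> (range (\<lambda>n. cball 0 (real n))) = space N"
      using locally_finite_measuresD(2)[OF N] by (auto intro: real_arch_simple)
    fix a :: "(real ^ 'd) set" assume "a \<in> range (\<lambda>n. cball 0 (real n))"
    then obtain n where a: "a = cball 0 (real n)" by blast
    then show "emeasure N a \<noteq> \<infinity>"
      using locally_finite_measuresD(3)[OF N bounded_cball, of 0 "real n"] by simp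
  next
    show "range (\<lambda>n. cball 0 (real n)) \<subseteq> sets N"
      unfolding locally_finite_measuresD(1)[OF N] by auto
  qed simp
qed

text \<open>A strictly positive weight of total mass at most 1 turns a locally finite measure into a
  subprobability measure, so that the measurability results for subprobability kernels apply.\<close>

definition lf_weight :: "(real ^ 'd) measure \<Rightarrow> real ^ 'd \<Rightarrow> real" where
  "lf_weight N x = (\<Sum>n. (1/2) ^ Suc n * indicator (cball 0 (real n)) x / (1 + measure N (cball 0
      (real n))))"

lemma lf_weight_summable:
  "summable (\<lambda>n. (1/2) ^ Suc n * indicator (cball 0 (real n)) x / (1 + measure N (cball 0 (real n)))
      :: real)"
proof (rule summable_comparison_test'[of "\<lambda>n. (1/2) ^ Suc n :: real" 0])
  show "summable (\<lambda>n. (1/2) ^ Suc n :: real)"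
    using summable_geometric[of "1/2::real"] by (simp add: summable_Suc_iff)
  fix n
  have "(1/2) ^ Suc n * indicator (cball 0 (real n)) x / (1 + measure N (cball 0 (real n))) \<le> (1/2)
      ^ Suc n / (1::real)"
    by (intro frac_le) (auto simp: indicator_def)
  moreover have "0 \<le> (1/2) ^ Suc n * indicator (cball 0 (real n)) x / (1 + measure N (cball 0 (real
      n)) :: real)"
    by (intro divide_nonneg_pos) (auto simp: indicator_def add_pos_nonneg)
  ultimately show "norm ((1/2) ^ Suc n * indicator (cball 0 (real n)) x / (1 + measure N (cball 0
      (real n))) :: real) \<le> (1/2) ^ Suc n"
    by simp
qed

lemma lf_weight_pos: "lf_weight N (x :: real ^ 'd) > 0"
  unfolding lf_weight_def
proof (rule suminf_pos_iff[THEN iffD2])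
  show "summable (\<lambda>n. (1/2) ^ Suc n * indicator (cball 0 (real n)) x / (1 + measure N (cball 0 (real
      n))) :: real)"
    by (rule lf_weight_summable)
  show "0 \<le> (1/2) ^ Suc n * indicator (cball 0 (real n)) x / (1 + measure N (cball 0 (real n)) ::
      real)" for n
    by (intro divide_nonneg_pos) (auto simp: indicator_def add_pos_nonneg)
  obtain n where "norm x \<le> real n" using real_arch_simple by blast
  then have "0 < (1/2) ^ Suc n * indicator (cball 0 (real n)) x / (1 + measure N (cball 0 (real n))
      :: real)"
    by (intro divide_pos_pos) (auto simp: indicator_def add_pos_nonneg)
  then show "\<exists>n. 0 < (1/2) ^ Suc n * indicator (cball 0 (real n)) x / (1 + measure N (cball 0 (real
      n)) :: real)" by blast
qed

lemma lf_weight_nonneg: "0 \<le> lf_weight N x"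
  using lf_weight_pos[of N x] by simp

lemma lf_weight_measurable [measurable]:
  "(\<lambda>(N, x). lf_weight N x) \<in> borel_measurable ((locally_finite_algebra :: (real ^ 'd) measure
      measure) \<Otimes>\<^sub>M borel)"
  unfolding lf_weight_def measure_def split_beta' by measurable

lemma lf_weight_measurable' [measurable]:
  "lf_weight (N :: (real ^ 'd) measure) \<in> borel_measurable borel"
  unfolding lf_weight_def by measurable

definition lf_normalise :: "(real ^ 'd) measure \<Rightarrow> (real ^ 'd) measure" where
  "lf_normalise N = density N (\<lambda>x. ennreal (lf_weight N x))"

text \<open>Expanding the weight turns the mass into a series of evaluations of \<open>N\<close> on
  sets cut by balls, so that measurability in \<open>N\<close> can be read off from the generators
  of \<open>locally_finite_algebra\<close>.\<close>

lemma emeasure_lf_normalise: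
  assumes N: "N \<in> locally_finite_measures" and A: "A \<in> sets borel"
  shows "emeasure (lf_normalise N) A =
    (\<Sum>n. ennreal ((1/2) ^ Suc n / (1 + measure N (cball 0 (real n)))) * emeasure N (A \<inter> cball 0
        (real n)))"
proof -
  note [measurable_cong] = locally_finite_measuresD(1)[OF N]
  have [measurable]: "A \<in> sets N" using A locally_finite_measuresD(1)[OF N] by simp
  have nn: "0 \<le> (1/2) ^ Suc n * indicator (cball 0 (real n)) x / (1 + measure N (cball 0 (real n))
      :: real)" for n x
    by (intro divide_nonneg_pos) (auto simp: indicator_def add_pos_nonneg)
  have "emeasure (lf_normalise N) A = (\<integral>\<^sup>+x. ennreal (lf_weight N x) * indicator A x \<partial>N)"
    unfolding lf_normalise_def by (rule emeasure_density) auto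
  also have "\<dots> = (\<integral>\<^sup>+x. (\<Sum>n. ennreal ((1/2) ^ Suc n / (1 + measure N (cball 0 (real n)))) *
      indicator (A \<inter> cball 0 (real n)) x) \<partial>N)"
  proof (rule nn_integral_cong)
    fix x
    have "ennreal (lf_weight N x) = (\<Sum>n. ennreal ((1/2) ^ Suc n * indicator (cball 0 (real n)) x /
        (1 + measure N (cball 0 (real n)))))"
      unfolding lf_weight_def by (rule suminf_ennreal2[symmetric, OF nn lf_weight_summable])
    also have "\<dots> * indicator A x = (\<Sum>n. ennreal ((1/2) ^ Suc n * indicator (cball 0 (real n)) x / (1
        + measure N (cball 0 (real n)))) * indicator A x)"
      by (rule ennreal_suminf_multc[symmetric])
    also have "\<dots> = (\<Sum>n. ennreal ((1/2) ^ Suc n / (1 + measure N (cball 0 (real n)))) * indicator (A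
        \<inter> cball 0 (real n)) x)"
      by (intro suminf_cong) (auto simp: indicator_def)
    finally show "ennreal (lf_weight N x) * indicator A x = (\<Sum>n. ennreal ((1/2) ^ Suc n / (1 +
        measure N (cball 0 (real n)))) * indicator (A \<inter> cball 0 (real n)) x)" .
  qed
  also have "\<dots> = (\<Sum>n. (\<integral>\<^sup>+x. ennreal ((1/2) ^ Suc n / (1 + measure N (cball 0 (real n)))) *
      indicator (A \<inter> cball 0 (real n)) x \<partial>N))"
    by (rule nn_integral_suminf) measurable
  also have "\<dots> = (\<Sum>n. ennreal ((1/2) ^ Suc n / (1 + measure N (cball 0 (real n)))) * emeasure N (A \<inter>
      cball 0 (real n)))"
    by (intro suminf_cong nn_integral_cmult_indicator) measurable
  finally show ?thesis .
qed

lemma lf_normalise_measurable [measurable]: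
  "lf_normalise \<in> measurable locally_finite_algebra (subprob_algebra (borel :: (real ^ 'd) measure))"
proof (rule measurable_subprob_algebra)
  fix N :: "(real ^ 'd) measure" assume "N \<in> space locally_finite_algebra"
  then have N: "N \<in> locally_finite_measures" by (simp add: space_locally_finite_algebra)
  show s: "sets (lf_normalise N) = sets borel"
    using locally_finite_measuresD(1)[OF N] by (simp add: lf_normalise_def)
  show "subprob_space (lf_normalise N)"
  proof
    have "emeasure (lf_normalise N) UNIV \<le> (\<Sum>n. ennreal ((1/2) ^ Suc n))"
      unfolding emeasure_lf_normalise[OF N borel_open[OF open_UNIV]]
    proof (rule suminf_le)
      fix n
      define m where "m = measure N (cball 0 (real n))"
      have "emeasure N (cball 0 (real n)) = ennreal m"
        unfolding m_def using locally_finite_measuresD(3)[OF N, of "cball 0 (real n)"]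
        by (intro emeasure_eq_ennreal_measure) auto
      moreover have "ennreal ((1/2) ^ Suc n / (1 + m)) * ennreal m = ennreal ((1/2) ^ Suc n * (m /
          (1 + m)))"
        by (subst ennreal_mult'[symmetric]) (auto simp: m_def)
      \<comment> \<open>The denominator of the weight is chosen for this bound: m / (1 + m) is at
        most 1 whatever the mass of the ball, so the total is at most the geometric series with sum
        1.\<close>
      moreover have "(1/2) ^ Suc n * (m / (1 + m)) \<le> (1/2) ^ Suc n * 1"
        by (intro mult_left_mono) (auto simp: m_def divide_le_eq_1 add_pos_nonneg)
      ultimately show "ennreal ((1/2) ^ Suc n / (1 + measure N (cball 0 (real n)))) * emeasure N
          (UNIV \<inter> cball 0 (real n)) \<le> ennreal ((1/2) ^ Suc n)"
        by (simp add: m_def[symmetric] ennreal_leI)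
    qed auto
    also have "\<dots> = ennreal (\<Sum>n. (1/2) ^ Suc n)"
      using summable_geometric[of "1/2::real"] by (intro suminf_ennreal2) (auto simp: summable_Suc_iff)
    also have "(\<Sum>n. (1/2) ^ Suc n) = (1::real)"
      using power_half_series by (simp add: sums_iff)
    finally show "emeasure (lf_normalise N) (space (lf_normalise N)) \<le> 1"
      using s sets_eq_imp_space_eq[OF s] by simp
    show "space (lf_normalise N) \<noteq> {}" using sets_eq_imp_space_eq[OF s] by simp
  qed
next
  fix A :: "(real ^ 'd) set" assume [measurable]: "A \<in> sets borel"
  show "(\<lambda>N. emeasure (lf_normalise N) A) \<in> borel_measurable locally_finite_algebra"
    by (subst measurable_cong[OF emeasure_lf_normalise])
       (auto simp: space_locally_finite_algebra measure_def)
qed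

lemma nn_integral_lf_normalise:
  assumes N: "N \<in> locally_finite_measures" and f [measurable]: "f \<in> borel_measurable borel"
  shows "(\<integral>\<^sup>+x. f x \<partial>N) = (\<integral>\<^sup>+x. ennreal (1 / lf_weight N x) * f x \<partial>lf_normalise N)"
proof -
  note [measurable_cong] = locally_finite_measuresD(1)[OF N]
  have "ennreal (lf_weight N x) * (ennreal (1 / lf_weight N x) * f x) = f x" for x
    using lf_weight_pos[of N x] by (simp add: mult.assoc[symmetric] ennreal_mult'[symmetric])
  then show ?thesis
    unfolding lf_normalise_def by (subst nn_integral_density) auto
qed

lemma integral_lf_normalise:
  fixes f :: "real ^ 'd \<Rightarrow> real"
  assumes N: "N \<in> locally_finite_measures" and f [measurable]: "f \<in> borel_measurable borel"
  shows "(\<integral>x. f x \<partial>N) = (\<integral>x. f x / lf_weight N x \<partial>lf_normalise N)"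
proof -
  note [measurable_cong] = locally_finite_measuresD(1)[OF N]
  have "lf_weight N x \<noteq> 0" for x
    using lf_weight_pos[of N x] by simp
  then show ?thesis
    unfolding lf_normalise_def by (subst integral_density) (auto intro: lf_weight_nonneg)
qed

lemma kernel_space:
  "K \<in> measurable M (locally_finite_algebra :: (real ^ 'd) measure measure) \<Longrightarrow> \<omega> \<in> space M \<Longrightarrow> K \<omega> \<in>
      locally_finite_measures"
  by (auto dest: measurable_space simp: space_locally_finite_algebra)

text \<open>The unbounded kernel is traded for the subprobability kernel \<open>lf_normalise\<close>
  at the price of the jointly measurable factor 1 / \<open>lf_weight\<close> in the
  integrand.\<close>

lemma nn_integral_kernel_measurable:
  fixes K :: "'a \<Rightarrow> (real ^ 'd) measure"
  assumes f [measurable]: "(\<lambda>(\<omega>, x). f \<omega> x) \<in> borel_measurable (M \<Otimes>\<^sub>M borel)"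
    and K [measurable]: "K \<in> measurable M locally_finite_algebra"
  shows "(\<lambda>\<omega>. \<integral>\<^sup>+x. f \<omega> x \<partial>K \<omega>) \<in> borel_measurable M"
proof -
  have "(\<lambda>\<omega>. \<integral>\<^sup>+x. ennreal (1 / lf_weight (K \<omega>) x) * f \<omega> x \<partial>lf_normalise (K \<omega>)) \<in> borel_measurable M"
    by (rule nn_integral_measurable_subprob_algebra2[where N = borel]) measurable
  then show ?thesis
    by (rule measurable_cong[THEN iffD1, rotated])
       (auto intro!: nn_integral_lf_normalise[symmetric] kernel_space[OF K])
qed

text \<open>The dependence of the integrand on the parameter is moved into the kernel:
  \<open>L x\<close> is pushed to the slice over \<open>x\<close> in the product, and the integrand
  becomes one fixed function on pairs.\<close>

lemma integral_measurable_subprob_algebra2: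
  fixes f :: "'a \<Rightarrow> 'b \<Rightarrow> real"
  assumes f [measurable]: "(\<lambda>(x, y). f x y) \<in> borel_measurable (M \<Otimes>\<^sub>M N)"
    and L [measurable]: "L \<in> measurable M (subprob_algebra N)"
  shows "(\<lambda>x. \<integral>y. f x y \<partial>L x) \<in> borel_measurable M"
proof -
  note integral_measurable_subprob_algebra [measurable] measurable_distr2 [measurable]
  have "(\<lambda>x. \<integral>p. (\<lambda>(x, y). f x y) p \<partial>distr (L x) (M \<Otimes>\<^sub>M N) (\<lambda>y. (x, y))) \<in> borel_measurable M"
    by measurable
  then show ?thesis
    by (rule measurable_cong[THEN iffD1, rotated])
       (simp add: integral_distr subprob_measurableD(2)[OF L] cong: measurable_cong_sets)
qed

lemma integral_kernel_measurable:
  fixes K :: "'a \<Rightarrow> (real ^ 'd) measure" and f :: "'a \<Rightarrow> real ^ 'd \<Rightarrow> real"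
  assumes f [measurable]: "(\<lambda>(\<omega>, x). f \<omega> x) \<in> borel_measurable (M \<Otimes>\<^sub>M borel)"
    and K [measurable]: "K \<in> measurable M locally_finite_algebra"
  shows "(\<lambda>\<omega>. \<integral>x. f \<omega> x \<partial>K \<omega>) \<in> borel_measurable M"
proof -
  have "(\<lambda>\<omega>. \<integral>x. f \<omega> x / lf_weight (K \<omega>) x \<partial>lf_normalise (K \<omega>)) \<in> borel_measurable M"
    by (rule integral_measurable_subprob_algebra2[where N = borel]) measurable
  then show ?thesis
    by (rule measurable_cong[THEN iffD1, rotated])
       (auto intro!: integral_lf_normalise[symmetric] kernel_space[OF K])
qed

section \<open>Affine substitutions for Lebesgue measure\<close>

lemma nn_integral_lborel_affine:
  fixes t :: "'a :: euclidean_space" and f :: "'a \<Rightarrow> ennreal"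
  assumes c: "c \<noteq> 0" and [measurable]: "f \<in> borel_measurable borel"
  shows "(\<integral>\<^sup>+x. f x \<partial>lborel) = ennreal (\<bar>c\<bar> ^ DIM('a)) * (\<integral>\<^sup>+x. f (t + c *\<^sub>R x) \<partial>lborel)"
  by (subst lborel_affine[OF c, of t])
     (simp add: nn_integral_density nn_integral_distr nn_integral_cmult)

lemma nn_integral_lborel_shift:
  fixes t :: "'a :: euclidean_space" and f :: "'a \<Rightarrow> ennreal"
  assumes [measurable]: "f \<in> borel_measurable borel"
  shows "(\<integral>\<^sup>+x. f (t + x) \<partial>lborel) = (\<integral>\<^sup>+x. f x \<partial>lborel)"
    and "(\<integral>\<^sup>+x. f (x + t) \<partial>lborel) = (\<integral>\<^sup>+x. f x \<partial>lborel)"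
    and "(\<integral>\<^sup>+x. f (t - x) \<partial>lborel) = (\<integral>\<^sup>+x. f x \<partial>lborel)"
    and "(\<integral>\<^sup>+x. f (x - t) \<partial>lborel) = (\<integral>\<^sup>+x. f x \<partial>lborel)"
    and "(\<integral>\<^sup>+x. f (- x) \<partial>lborel) = (\<integral>\<^sup>+x. f x \<partial>lborel)"
  using nn_integral_lborel_affine[of 1 f t] nn_integral_lborel_affine[of "-1" f t]
    nn_integral_lborel_affine[of 1 f "- t"] nn_integral_lborel_affine[of "-1" f 0]
  by (simp_all add: add.commute)

section \<open>Stationary random measures and Campbell formulas\<close>

locale stationary_random_measure = prob_space M for M :: "'w measure" +
  fixes \<Phi> :: "'w \<Rightarrow> (real ^ 'd) measure"
  assumes random [measurable]: "\<Phi> \<in> measurable M locally_finite_algebra"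
    and stationary: "stationary_measure M \<Phi>"
    and square_integrable: "locally_square_integrable M \<Phi>"
begin

abbreviation \<gamma> :: real where "\<gamma> \<equiv> intensity M \<Phi>"

abbreviation \<alpha> :: "(real ^ 'd) measure" where "\<alpha> \<equiv> reduced_second_moment_measure M \<Phi>"

lemma lf: "\<omega> \<in> space M \<Longrightarrow> \<Phi> \<omega> \<in> locally_finite_measures"
  using kernel_space[OF random] .

lemma sets_Phi [measurable_cong]: "\<omega> \<in> space M \<Longrightarrow> sets (\<Phi> \<omega>) = sets borel"
  using locally_finite_measuresD(1)[OF lf] .

lemma nn_integral_Phi_measurable [measurable (raw)]:
  "(\<lambda>(a, x). f a x) \<in> borel_measurable (A \<Otimes>\<^sub>M borel) \<Longrightarrow> g \<in> measurable A M \<Longrightarrow>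
    (\<lambda>a. \<integral>\<^sup>+x. f a x \<partial>\<Phi> (g a)) \<in> borel_measurable A"
  by (rule nn_integral_kernel_measurable) (auto intro: measurable_compose[OF _ random])

lemma integral_Phi_measurable [measurable (raw)]:
  fixes f :: "'a \<Rightarrow> real ^ 'd \<Rightarrow> real"
  shows "(\<lambda>(a, x). f a x) \<in> borel_measurable (A \<Otimes>\<^sub>M borel) \<Longrightarrow> g \<in> measurable A M \<Longrightarrow>
    (\<lambda>a. \<integral>x. f a x \<partial>\<Phi> (g a)) \<in> borel_measurable A"
  by (rule integral_kernel_measurable) (auto intro: measurable_compose[OF _ random])

lemma pair_sigma_finite_Phi:
  "\<omega> \<in> space M \<Longrightarrow> sigma_finite_measure N \<Longrightarrow> pair_sigma_finite (\<Phi> \<omega>) N"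
  using sigma_finite_locally_finite[OF lf] by (simp add: pair_sigma_finite_def)

lemma shift_measure_measurable [measurable]:
  "(\<lambda>\<omega>. shift_measure z (\<Phi> \<omega>)) \<in> measurable M locally_finite_algebra"
proof (rule measurable_locally_finite_algebra)
  fix \<omega> assume w: "\<omega> \<in> space M"
  note [measurable_cong] = sets_Phi[OF w]
  have "emeasure (shift_measure z (\<Phi> \<omega>)) B < \<infinity>" if "B \<in> sets borel" "bounded B" for B
  proof -
    have "(\<lambda>y. y - z) -` B = (\<lambda>y. y + z) ` B"
      by (auto simp: image_iff) (metis diff_add_cancel)
    then have "bounded ((\<lambda>y. y - z) -` B)"
      using that(2) bounded_translation[of B z] by (simp add: add.commute)
    moreover have "(\<lambda>y. y - z) -` B \<in> sets borel"
      using measurable_sets[of "\<lambda>y. y - z" borel borel B] that(1) by simp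
    ultimately show ?thesis
      using that(1) locally_finite_measuresD[OF lf[OF w]] by (simp add: shift_measure_def
          emeasure_distr)
  qed
  then show "shift_measure z (\<Phi> \<omega>) \<in> locally_finite_measures"
    by (simp add: locally_finite_measures_def) (simp add: shift_measure_def)
next
  fix B :: "(real ^ 'd) set" assume B [measurable]: "B \<in> sets borel"
  have "(\<lambda>\<omega>. \<integral>\<^sup>+y. indicator B (y - z) \<partial>\<Phi> \<omega>) \<in> borel_measurable M" by measurable
  moreover have "emeasure (shift_measure z (\<Phi> \<omega>)) B = (\<integral>\<^sup>+y. indicator B (y - z) \<partial>\<Phi> \<omega>)"
    if "\<omega> \<in> space M" for \<omega>
  proof -
    note [measurable_cong] = sets_Phi[OF that]
    have "emeasure (shift_measure z (\<Phi> \<omega>)) B = (\<integral>\<^sup>+y. indicator B y \<partial>shift_measure z (\<Phi> \<omega>))"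
      by (simp add: shift_measure_def)
    also have "\<dots> = (\<integral>\<^sup>+y. indicator B (y - z) \<partial>\<Phi> \<omega>)"
      unfolding shift_measure_def by (rule nn_integral_distr) measurable
    finally show ?thesis .
  qed
  ultimately show "(\<lambda>\<omega>. emeasure (shift_measure z (\<Phi> \<omega>)) B) \<in> borel_measurable M"
    by (simp cong: measurable_cong)
qed

lemma nn_integral_shift_measure:
  assumes "\<omega> \<in> space M" and [measurable]: "f \<in> borel_measurable borel"
  shows "(\<integral>\<^sup>+y. f y \<partial>shift_measure z (\<Phi> \<omega>)) = (\<integral>\<^sup>+y. f (y - z) \<partial>\<Phi> \<omega>)"
proof -
  note [measurable_cong] = sets_Phi[OF assms(1)]
  show ?thesis by (simp add: shift_measure_def nn_integral_distr)
qed

lemma integral_shift_measure: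
  fixes f :: "real ^ 'd \<Rightarrow> real"
  assumes "\<omega> \<in> space M" and [measurable]: "f \<in> borel_measurable borel"
  shows "(\<integral>y. f y \<partial>shift_measure z (\<Phi> \<omega>)) = (\<integral>y. f (y - z) \<partial>\<Phi> \<omega>)"
proof -
  note [measurable_cong] = sets_Phi[OF assms(1)]
  show ?thesis by (simp add: shift_measure_def integral_distr)
qed

lemma stationary_nn_integral:
  assumes [measurable]: "G \<in> borel_measurable locally_finite_algebra"
  shows "(\<integral>\<^sup>+\<omega>. G (shift_measure z (\<Phi> \<omega>)) \<partial>M) = (\<integral>\<^sup>+\<omega>. G (\<Phi> \<omega>) \<partial>M)"
proof -
  have "(\<integral>\<^sup>+\<omega>. G (shift_measure z (\<Phi> \<omega>)) \<partial>M) =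
      (\<integral>\<^sup>+N. G N \<partial>distr M locally_finite_algebra (\<lambda>\<omega>. shift_measure z (\<Phi> \<omega>)))"
    by (simp add: nn_integral_distr)
  also have "\<dots> = (\<integral>\<^sup>+N. G N \<partial>distr M locally_finite_algebra \<Phi>)"
    using stationary by (simp add: stationary_measure_def)
  finally show ?thesis by (simp add: nn_integral_distr)
qed

lemma stationary_first:
  assumes [measurable]: "f \<in> borel_measurable borel"
  shows "(\<integral>\<^sup>+\<omega>. \<integral>\<^sup>+x. f (x - z) \<partial>\<Phi> \<omega> \<partial>M) = (\<integral>\<^sup>+\<omega>. \<integral>\<^sup>+x. f x \<partial>\<Phi> \<omega> \<partial>M)"
proof -
  have "(\<lambda>N. \<integral>\<^sup>+x. f x \<partial>N) \<in> borel_measurable locally_finite_algebra"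
    by (rule nn_integral_kernel_measurable) measurable
  from stationary_nn_integral[OF this, of z] show ?thesis
    by (simp add: nn_integral_shift_measure cong: nn_integral_cong)
qed

lemma stationary_second:
  assumes [measurable]: "g \<in> borel_measurable (borel \<Otimes>\<^sub>M borel)"
  shows "(\<integral>\<^sup>+\<omega>. \<integral>\<^sup>+x. \<integral>\<^sup>+y. g (x - z, y - z) \<partial>\<Phi> \<omega> \<partial>\<Phi> \<omega> \<partial>M) =
         (\<integral>\<^sup>+\<omega>. \<integral>\<^sup>+x. \<integral>\<^sup>+y. g (x, y) \<partial>\<Phi> \<omega> \<partial>\<Phi> \<omega> \<partial>M)"
proof -
  have [measurable]: "(\<lambda>(N, x). \<integral>\<^sup>+y. g (x, y) \<partial>N) \<in> borel_measurable (locally_finite_algebra \<Otimes>\<^sub>M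
      borel)"
    unfolding split_beta' by (rule nn_integral_kernel_measurable) measurable
  have "(\<lambda>N. \<integral>\<^sup>+x. \<integral>\<^sup>+y. g (x, y) \<partial>N \<partial>N) \<in> borel_measurable locally_finite_algebra"
    by (rule nn_integral_kernel_measurable) measurable
  from stationary_nn_integral[OF this, of z]
  have "(\<integral>\<^sup>+\<omega>. \<integral>\<^sup>+x. \<integral>\<^sup>+y. g (x, y) \<partial>\<Phi> \<omega> \<partial>\<Phi> \<omega> \<partial>M) =
     (\<integral>\<^sup>+\<omega>. \<integral>\<^sup>+x. \<integral>\<^sup>+y. g (x, y) \<partial>shift_measure z (\<Phi> \<omega>) \<partial>shift_measure z (\<Phi> \<omega>) \<partial>M)" by simp
  also have "\<dots> = (\<integral>\<^sup>+\<omega>. \<integral>\<^sup>+x. \<integral>\<^sup>+y. g (x - z, y - z) \<partial>\<Phi> \<omega> \<partial>\<Phi> \<omega> \<partial>M)"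
  proof (intro nn_integral_cong)
    fix \<omega> assume w: "\<omega> \<in> space M"
    have [measurable]: "(\<lambda>x. \<integral>\<^sup>+y. g (x, y - z) \<partial>\<Phi> \<omega>) \<in> borel_measurable borel"
      using w by measurable
    show "(\<integral>\<^sup>+x. \<integral>\<^sup>+y. g (x, y) \<partial>shift_measure z (\<Phi> \<omega>) \<partial>shift_measure z (\<Phi> \<omega>)) =
      (\<integral>\<^sup>+x. \<integral>\<^sup>+y. g (x - z, y - z) \<partial>\<Phi> \<omega> \<partial>\<Phi> \<omega>)"
      by (simp add: nn_integral_shift_measure[OF w])
  qed
  finally show ?thesis by simp
qed

lemma finite_second_moment:
  "bounded B \<Longrightarrow> B \<in> sets borel \<Longrightarrow> (\<integral>\<^sup>+\<omega>. (emeasure (\<Phi> \<omega>) B)\<^sup>2 \<partial>M) < \<infinity>"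
  using square_integrable by (simp add: locally_square_integrable_def)

text \<open>\<open>intensity\<close> is a Bochner integral and would silently be 0 for a
  non-integrable mass; the finite second moment rules this out, so that the real and the extended
  expectation agree.\<close>

lemma ennreal_intensity: "(\<integral>\<^sup>+\<omega>. emeasure (\<Phi> \<omega>) (cbox 0 1) \<partial>M) = ennreal \<gamma>"
proof -
  have fin: "emeasure (\<Phi> \<omega>) (cbox 0 1) = ennreal (measure (\<Phi> \<omega>) (cbox 0 1))" if "\<omega> \<in> space M" for \<omega>
    using locally_finite_measuresD(3)[OF lf[OF that], of "cbox 0 1"]
    by (intro emeasure_eq_ennreal_measure) auto
  have [measurable]: "(\<lambda>\<omega>. measure (\<Phi> \<omega>) (cbox 0 1)) \<in> borel_measurable M"
    unfolding measure_def by measurable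
  have "(\<integral>\<^sup>+\<omega>. ennreal ((measure (\<Phi> \<omega>) (cbox 0 1))\<^sup>2) \<partial>M) = (\<integral>\<^sup>+\<omega>. (emeasure (\<Phi> \<omega>) (cbox 0 1))\<^sup>2 \<partial>M)"
    by (intro nn_integral_cong) (simp add: fin ennreal_power)
  then have "integrable M (\<lambda>\<omega>. (measure (\<Phi> \<omega>) (cbox 0 1))\<^sup>2)"
    using finite_second_moment[of "cbox 0 1"]
    by (intro integrableI_nonneg) auto
  then have "integrable M (\<lambda>\<omega>. measure (\<Phi> \<omega>) (cbox 0 1))"
    by (rule square_integrable_imp_integrable[rotated]) measurable
  then have "(\<integral>\<^sup>+\<omega>. ennreal (measure (\<Phi> \<omega>) (cbox 0 1)) \<partial>M) = ennreal \<gamma>"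
    unfolding intensity_def by (rule nn_integral_eq_integral) simp
  then show ?thesis by (simp add: fin cong: nn_integral_cong)
qed

lemma intensity_nonneg: "0 \<le> \<gamma>"
  unfolding intensity_def by simp

text \<open>Inserting the unit cube and applying Fubini and stationarity avoids the uniqueness of Haar
  measure, here and for second moments.\<close>

lemma campbell_first:
  assumes f [measurable]: "f \<in> borel_measurable borel"
  shows "(\<integral>\<^sup>+\<omega>. \<integral>\<^sup>+x. f x \<partial>\<Phi> \<omega> \<partial>M) = ennreal \<gamma> * (\<integral>\<^sup>+x. f x \<partial>lborel)"
proof -
  let ?C = "cbox 0 1 :: (real ^ 'd) set"
  interpret P: pair_sigma_finite M "lborel :: (real ^ 'd) measure" ..
  have unit: "(\<integral>\<^sup>+z. indicator ?C (x + z) \<partial>lborel) = 1" for x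
    using nn_integral_lborel_shift(1)[of "indicator ?C" x]
    by (simp add: emeasure_lborel_cbox_eq) (simp add: one_vec_def Basis_vec_def inner_axis prod.neutral)
  have "ennreal \<gamma> * (\<integral>\<^sup>+x. f x \<partial>lborel) = (\<integral>\<^sup>+\<omega>. \<integral>\<^sup>+x. indicator ?C x * (\<integral>\<^sup>+z. f z \<partial>lborel) \<partial>\<Phi> \<omega> \<partial>M)"
    by (simp add: ennreal_intensity[symmetric] nn_integral_multc sets_Phi cong: nn_integral_cong)
  also have "\<dots> = (\<integral>\<^sup>+\<omega>. \<integral>\<^sup>+x. \<integral>\<^sup>+z. indicator ?C x * f (x - z) \<partial>lborel \<partial>\<Phi> \<omega> \<partial>M)"
    by (simp add: nn_integral_cmult nn_integral_lborel_shift)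
  also have "\<dots> = (\<integral>\<^sup>+\<omega>. \<integral>\<^sup>+z. \<integral>\<^sup>+x. indicator ?C x * f (x - z) \<partial>\<Phi> \<omega> \<partial>lborel \<partial>M)"
    by (intro nn_integral_cong pair_sigma_finite.Fubini'[symmetric] pair_sigma_finite_Phi)
       (auto simp: sets_Phi lborel.sigma_finite_measure_axioms)
  also have "\<dots> = (\<integral>\<^sup>+z. \<integral>\<^sup>+\<omega>. \<integral>\<^sup>+x. indicator ?C x * f (x - z) \<partial>\<Phi> \<omega> \<partial>M \<partial>lborel)"
    by (intro P.Fubini'[symmetric]) measurable
  \<comment> \<open>For each fixed z, stationarity moves the shift from \<open>f\<close> to the
    cube, whose total weight over all z is 1 by \<open>unit\<close>.\<close>
  also have "\<dots> = (\<integral>\<^sup>+z. \<integral>\<^sup>+\<omega>. \<integral>\<^sup>+x. indicator ?C (x + z) * f x \<partial>\<Phi> \<omega> \<partial>M \<partial>lborel)"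
    using stationary_first[of "\<lambda>x. indicator ?C (x + z) * f x" z for z] by simp
  also have "\<dots> = (\<integral>\<^sup>+\<omega>. \<integral>\<^sup>+z. \<integral>\<^sup>+x. indicator ?C (x + z) * f x \<partial>\<Phi> \<omega> \<partial>lborel \<partial>M)"
    by (intro P.Fubini') measurable
  also have "\<dots> = (\<integral>\<^sup>+\<omega>. \<integral>\<^sup>+x. \<integral>\<^sup>+z. indicator ?C (x + z) * f x \<partial>lborel \<partial>\<Phi> \<omega> \<partial>M)"
    by (intro nn_integral_cong pair_sigma_finite.Fubini' pair_sigma_finite_Phi)
       (auto simp: sets_Phi lborel.sigma_finite_measure_axioms)
  also have "\<dots> = (\<integral>\<^sup>+\<omega>. \<integral>\<^sup>+x. f x \<partial>\<Phi> \<omega> \<partial>M)"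
    by (simp add: nn_integral_multc unit)
  finally show ?thesis by simp
qed

section \<open>The reduced second moment measure\<close>

lemma sets_alpha [simp, measurable_cong]: "sets \<alpha> = sets borel"
  using sets.sigma_sets_eq[of "borel :: (real ^ 'd) measure"]
  by (simp add: reduced_second_moment_measure_def)

lemma space_alpha [simp]: "space \<alpha> = UNIV"
  using sets_eq_imp_space_eq[OF sets_alpha] by simp

text \<open>\<open>measure_of\<close> returns the value 0 unless its set function is positive and
  countably additive, so both are verified here. Sigma-finiteness of the realisations turns the
  product integral into the iterated one used from here on.\<close>

lemma emeasure_alpha:
  assumes B [measurable]: "B \<in> sets borel"
  shows "emeasure \<alpha> B = (\<integral>\<^sup>+\<omega>. \<integral>\<^sup>+x. \<integral>\<^sup>+y. indicator (cbox 0 1) x * indicator B (y - x) \<partial>\<Phi> \<omega> \<partial>\<Phi> \<omega> \<partial>M)"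
proof -
  let ?m = "\<lambda>B. \<integral>\<^sup>+\<omega>. (\<integral>\<^sup>+(x, y). indicator (cbox 0 1) x * indicator B (y - x) \<partial>(\<Phi> \<omega> \<Otimes>\<^sub>M \<Phi> \<omega>)) \<partial>M"
  have eq: "?m B = (\<integral>\<^sup>+\<omega>. \<integral>\<^sup>+x. \<integral>\<^sup>+y. indicator (cbox 0 1) x * indicator B (y - x) \<partial>\<Phi> \<omega> \<partial>\<Phi> \<omega> \<partial>M)"
    if [measurable]: "B \<in> sets borel" for B
  proof (rule nn_integral_cong)
    fix \<omega> assume w: "\<omega> \<in> space M"
    note [measurable_cong] = sets_Phi[OF w]
    show "(\<integral>\<^sup>+(x, y). indicator (cbox 0 1) x * indicator B (y - x) \<partial>(\<Phi> \<omega> \<Otimes>\<^sub>M \<Phi> \<omega>)) =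
      (\<integral>\<^sup>+x. \<integral>\<^sup>+y. indicator (cbox 0 1) x * indicator B (y - x) \<partial>\<Phi> \<omega> \<partial>\<Phi> \<omega>)"
      using sigma_finite_locally_finite[OF lf[OF w]]
      by (subst sigma_finite_measure.nn_integral_fst[symmetric]) (auto simp: split_beta')
  qed
  have "emeasure \<alpha> B = ?m B"
  proof (rule emeasure_measure_of[OF reduced_second_moment_measure_def])
    show "positive (sets \<alpha>) ?m" by (simp add: positive_def split_beta')
    show "countably_additive (sets \<alpha>) ?m"
    proof (rule countably_additiveI)
      fix A :: "nat \<Rightarrow> (real ^ 'd) set"
      assume A: "range A \<subseteq> sets \<alpha>" "disjoint_family A" "\<Union> (range A) \<in> sets \<alpha>"
      then have [measurable]: "\<And>i. A i \<in> sets borel" by auto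
      have "(\<Sum>i. ?m (A i)) = (\<Sum>i. \<integral>\<^sup>+\<omega>. \<integral>\<^sup>+x. \<integral>\<^sup>+y. indicator (cbox 0 1) x * indicator (A i) (y - x)
          \<partial>\<Phi> \<omega> \<partial>\<Phi> \<omega> \<partial>M)"
        by (intro suminf_cong eq) measurable
      also have "\<dots> = (\<integral>\<^sup>+\<omega>. (\<Sum>i. \<integral>\<^sup>+x. \<integral>\<^sup>+y. indicator (cbox 0 1) x * indicator (A i) (y - x) \<partial>\<Phi> \<omega>
          \<partial>\<Phi> \<omega>) \<partial>M)"
        by (rule nn_integral_suminf[symmetric]) measurable
      also have "\<dots> = (\<integral>\<^sup>+\<omega>. \<integral>\<^sup>+x. \<integral>\<^sup>+y. (\<Sum>i. indicator (cbox 0 1) x * indicator (A i) (y - x)) \<partial>\<Phi> \<omega>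
          \<partial>\<Phi> \<omega> \<partial>M)"
      proof (rule nn_integral_cong)
        fix \<omega> assume w: "\<omega> \<in> space M"
        note [measurable_cong] = sets_Phi[OF w]
        have [measurable]: "(\<lambda>x. \<integral>\<^sup>+y. indicator (cbox 0 1) x * indicator (A i) (y - x) \<partial>\<Phi> \<omega>) \<in>
            borel_measurable borel" for i
          using w by measurable
        have "(\<Sum>i. \<integral>\<^sup>+x. \<integral>\<^sup>+y. indicator (cbox 0 1) x * indicator (A i) (y - x) \<partial>\<Phi> \<omega> \<partial>\<Phi> \<omega>) =
          (\<integral>\<^sup>+x. (\<Sum>i. \<integral>\<^sup>+y. indicator (cbox 0 1) x * indicator (A i) (y - x) \<partial>\<Phi> \<omega>) \<partial>\<Phi> \<omega>)"
          by (rule nn_integral_suminf[symmetric]) (simp cong: measurable_cong_sets add: sets_Phi[OF w])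
        also have "\<dots> = (\<integral>\<^sup>+x. \<integral>\<^sup>+y. (\<Sum>i. indicator (cbox 0 1) x * indicator (A i) (y - x)) \<partial>\<Phi> \<omega> \<partial>\<Phi> \<omega>)"
          by (intro nn_integral_cong nn_integral_suminf[symmetric]) measurable
        finally show "(\<Sum>i. \<integral>\<^sup>+x. \<integral>\<^sup>+y. indicator (cbox 0 1) x * indicator (A i) (y - x) \<partial>\<Phi> \<omega> \<partial>\<Phi> \<omega>) =
          (\<integral>\<^sup>+x. \<integral>\<^sup>+y. (\<Sum>i. indicator (cbox 0 1) x * indicator (A i) (y - x)) \<partial>\<Phi> \<omega> \<partial>\<Phi> \<omega>)" .
      qed
      also have "\<dots> = (\<integral>\<^sup>+\<omega>. \<integral>\<^sup>+x. \<integral>\<^sup>+y. indicator (cbox 0 1) x * indicator (\<Union> (range A)) (y - x) \<partial>\<Phi>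
          \<omega> \<partial>\<Phi> \<omega> \<partial>M)"
        by (simp add: suminf_indicator[OF A(2)])
      also have "\<dots> = ?m (\<Union> (range A))" by (rule eq[symmetric]) measurable
      finally show "(\<Sum>i. ?m (A i)) = ?m (\<Union> (range A))" .
    qed
  qed (use B in auto)
  then show ?thesis by (simp add: eq[OF B])
qed

text \<open>\<open>emeasure_alpha\<close> is extended from indicators along the generation of
  nonnegative measurable functions; in the last case the monotone limit passes through three nested
  integrals.\<close>

lemma nn_integral_alpha:
  assumes h: "h \<in> borel_measurable borel"
  shows "(\<integral>\<^sup>+u. h u \<partial>\<alpha>) = (\<integral>\<^sup>+\<omega>. \<integral>\<^sup>+x. \<integral>\<^sup>+y. indicator (cbox 0 1) x * h (y - x) \<partial>\<Phi> \<omega> \<partial>\<Phi> \<omega> \<partial>M)"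
  using h
proof (induction rule: borel_measurable_induct)
  case (cong f g) then show ?case by simp
next
  case (set A) then show ?case by (simp add: emeasure_alpha)
next
  case (mult u c)
  note [measurable] = mult(2)
  have "(\<integral>\<^sup>+x. \<integral>\<^sup>+y. indicator (cbox 0 1) x * (c * u (y - x)) \<partial>\<Phi> \<omega> \<partial>\<Phi> \<omega>) =
    c * (\<integral>\<^sup>+x. \<integral>\<^sup>+y. indicator (cbox 0 1) x * u (y - x) \<partial>\<Phi> \<omega> \<partial>\<Phi> \<omega>)" if w: "\<omega> \<in> space M" for \<omega>
  proof -
    note [measurable_cong] = sets_Phi[OF w]
    have [measurable]: "(\<lambda>x. \<integral>\<^sup>+y. u (y - x) \<partial>\<Phi> \<omega>) \<in> borel_measurable borel"
      using w by measurable
    show ?thesis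
      by (simp add: mult.left_commute[of _ c] nn_integral_cmult)
  qed
  then show ?case using mult by (simp add: nn_integral_cmult cong: nn_integral_cong)
next
  case (add u v)
  note [measurable] = add(1,3)
  have "(\<integral>\<^sup>+x. \<integral>\<^sup>+y. indicator (cbox 0 1) x * (v (y - x) + u (y - x)) \<partial>\<Phi> \<omega> \<partial>\<Phi> \<omega>) =
    (\<integral>\<^sup>+x. \<integral>\<^sup>+y. indicator (cbox 0 1) x * v (y - x) \<partial>\<Phi> \<omega> \<partial>\<Phi> \<omega>) + (\<integral>\<^sup>+x. \<integral>\<^sup>+y. indicator (cbox 0 1) x
        * u (y - x) \<partial>\<Phi> \<omega> \<partial>\<Phi> \<omega>)" if w: "\<omega> \<in> space M" for \<omega>
  proof -
    note [measurable_cong] = sets_Phi[OF w]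
    have [measurable]: "(\<lambda>x. \<integral>\<^sup>+y. u (y - x) \<partial>\<Phi> \<omega>) \<in> borel_measurable borel"
      "(\<lambda>x. \<integral>\<^sup>+y. v (y - x) \<partial>\<Phi> \<omega>) \<in> borel_measurable borel"
      using w by measurable
    show ?thesis
      by (simp add: distrib_left nn_integral_add nn_integral_cmult)
  qed
  then show ?case using add by (simp add: nn_integral_add cong: nn_integral_cong)
next
  case (seq U)
  note [measurable] = seq(1)
  have mono: "incseq (\<lambda>i. U i x)" for x using seq(3) by (auto simp: incseq_def le_fun_def)
  have u: "h = (\<lambda>x. SUP i. U i x)" using seq(4) by (simp add: SUP_apply image_image fun_eq_iff)
  have *: "(\<integral>\<^sup>+x. \<integral>\<^sup>+y. indicator (cbox 0 1) x * h (y - x) \<partial>\<Phi> \<omega> \<partial>\<Phi> \<omega>) =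
    (SUP i. \<integral>\<^sup>+x. \<integral>\<^sup>+y. indicator (cbox 0 1) x * U i (y - x) \<partial>\<Phi> \<omega> \<partial>\<Phi> \<omega>)" if w: "\<omega> \<in> space M" for \<omega>
  proof -
    note [measurable_cong] = sets_Phi[OF w]
    have [measurable]: "(\<lambda>x. \<integral>\<^sup>+y. indicator (cbox 0 1) x * U i (y - x) \<partial>\<Phi> \<omega>) \<in> borel_measurable
        borel" for i
      using w by measurable
    have "(\<integral>\<^sup>+y. indicator (cbox 0 1) x * h (y - x) \<partial>\<Phi> \<omega>) =
        (SUP i. \<integral>\<^sup>+y. indicator (cbox 0 1) x * U i (y - x) \<partial>\<Phi> \<omega>)" for x
      unfolding u SUP_mult_left_ennreal
      by (intro nn_integral_monotone_convergence_SUP) (auto simp: incseq_def le_fun_def intro!: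
          mult_left_mono incseqD[OF mono])
    then show ?thesis
      by (simp, intro nn_integral_monotone_convergence_SUP)
         (auto simp: incseq_def le_fun_def intro!: nn_integral_mono mult_left_mono incseqD[OF mono])
  qed
  have "(\<integral>\<^sup>+\<omega>. \<integral>\<^sup>+x. \<integral>\<^sup>+y. indicator (cbox 0 1) x * h (y - x) \<partial>\<Phi> \<omega> \<partial>\<Phi> \<omega> \<partial>M) =
     (\<integral>\<^sup>+\<omega>. (SUP i. \<integral>\<^sup>+x. \<integral>\<^sup>+y. indicator (cbox 0 1) x * U i (y - x) \<partial>\<Phi> \<omega> \<partial>\<Phi> \<omega>) \<partial>M)"
    by (intro nn_integral_cong *)
  also have "\<dots> = (SUP i. \<integral>\<^sup>+\<omega>. \<integral>\<^sup>+x. \<integral>\<^sup>+y. indicator (cbox 0 1) x * U i (y - x) \<partial>\<Phi> \<omega> \<partial>\<Phi> \<omega> \<partial>M)"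
    by (intro nn_integral_monotone_convergence_SUP)
       (auto simp: incseq_def le_fun_def intro!: nn_integral_mono mult_left_mono incseqD[OF mono])
  also have "\<dots> = (SUP i. \<integral>\<^sup>+v. U i v \<partial>\<alpha>)" using seq by simp
  also have "\<dots> = (\<integral>\<^sup>+x. h x \<partial>\<alpha>)"
    unfolding u by (intro nn_integral_monotone_convergence_SUP[symmetric]) (use seq in auto)
  finally show ?case unfolding seq(4)[symmetric] by simp
qed

lemma emeasure_alpha_finite:
  "bounded B \<Longrightarrow> B \<in> sets borel \<Longrightarrow> emeasure \<alpha> B < \<infinity>"
proof -
  assume B: "bounded B" "B \<in> sets borel"
  note [measurable] = B(2)
  let ?C = "cbox 0 1 :: (real ^ 'd) set"
  obtain a where a: "\<And>x. x \<in> ?C \<Longrightarrow> norm x \<le> a" using bounded_cbox[of 0 1] by (auto simp: bounded_iff)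
  obtain b where b: "\<And>x. x \<in> B \<Longrightarrow> norm x \<le> b" using B(1) by (auto simp: bounded_iff)
  \<comment> \<open>The first point lies in the unit cube and the difference in \<open>B\<close>, so
    both points of the pair lie in this ball.\<close>
  let ?D = "cball 0 (\<bar>a\<bar> + \<bar>b\<bar>) :: (real ^ 'd) set"
  have "emeasure \<alpha> B \<le> (\<integral>\<^sup>+\<omega>. (emeasure (\<Phi> \<omega>) ?D)\<^sup>2 \<partial>M)"
    unfolding emeasure_alpha[OF B(2)]
  proof (rule nn_integral_mono)
    fix \<omega> assume w: "\<omega> \<in> space M"
    note [measurable_cong] = sets_Phi[OF w]
    have "(\<integral>\<^sup>+x. \<integral>\<^sup>+y. indicator ?C x * indicator B (y - x) \<partial>\<Phi> \<omega> \<partial>\<Phi> \<omega>) \<le> (\<integral>\<^sup>+x. \<integral>\<^sup>+y. indicator ?D x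
        * indicator ?D y \<partial>\<Phi> \<omega> \<partial>\<Phi> \<omega>)"
    proof (intro nn_integral_mono)
      fix x y :: "real ^ 'd"
      have "x \<in> ?D \<and> y \<in> ?D" if "x \<in> ?C" "y - x \<in> B"
        using a[OF that(1)] b[OF that(2)] norm_triangle_ineq[of x "y - x"] by auto
      then show "indicator ?C x * indicator B (y - x) \<le> (indicator ?D x * indicator ?D y :: ennreal)"
        by (auto simp: indicator_def)
    qed
    also have "\<dots> = (emeasure (\<Phi> \<omega>) ?D)\<^sup>2"
      by (simp add: nn_integral_cmult nn_integral_multc power2_eq_square)
    finally show "(\<integral>\<^sup>+x. \<integral>\<^sup>+y. indicator ?C x * indicator B (y - x) \<partial>\<Phi> \<omega> \<partial>\<Phi> \<omega>) \<le> (emeasure (\<Phi> \<omega>)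
        ?D)\<^sup>2" .
  qed
  also have "\<dots> < \<infinity>" by (rule finite_second_moment) auto
  finally show ?thesis .
qed

lemma alpha_lf: "\<alpha> \<in> locally_finite_measures"
  by (simp add: locally_finite_measures_def) (simp add: emeasure_alpha_finite[simplified])

sublocale alpha: sigma_finite_measure \<alpha>
  by (rule sigma_finite_locally_finite[OF alpha_lf])

text \<open>A common translation of the pair leaves \<open>y - x\<close> unchanged. The cube in
  \<open>\<alpha>\<close> weights only the first point, and integrating that weight over all
  translations gives 1, as in the first-order formula.\<close>

lemma campbell_second:
  assumes g [measurable]: "g \<in> borel_measurable (borel \<Otimes>\<^sub>M borel)"
  shows "(\<integral>\<^sup>+\<omega>. \<integral>\<^sup>+x. \<integral>\<^sup>+y. g (x, y) \<partial>\<Phi> \<omega> \<partial>\<Phi> \<omega> \<partial>M) = (\<integral>\<^sup>+u. \<integral>\<^sup>+x. g (x, x + u) \<partial>lborel \<partial>\<alpha>)"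
proof -
  let ?C = "cbox 0 1 :: (real ^ 'd) set"
  interpret P: pair_sigma_finite M "lborel :: (real ^ 'd) measure" ..
  have unit: "(\<integral>\<^sup>+z. indicator ?C (x + z) \<partial>lborel) = 1" for x
    using nn_integral_lborel_shift(1)[of "indicator ?C" x]
    by (simp add: emeasure_lborel_cbox_eq) (simp add: one_vec_def Basis_vec_def inner_axis prod.neutral)
  \<comment> \<open>The shift variable \<open>z\<close> is moved out of two nested integrals over
    the same realisation, one application of Fubini for each.\<close>
  have sw1: "(\<integral>\<^sup>+x. \<integral>\<^sup>+y. \<integral>\<^sup>+z. F x y z \<partial>lborel \<partial>\<Phi> \<omega> \<partial>\<Phi> \<omega>) = (\<integral>\<^sup>+z. \<integral>\<^sup>+x. \<integral>\<^sup>+y. F x y z \<partial>\<Phi> \<omega> \<partial>\<Phi> \<omega>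
      \<partial>lborel)"
    if w: "\<omega> \<in> space M" and F: "(\<lambda>(x, y, z). F x y z) \<in> borel_measurable (borel \<Otimes>\<^sub>M borel \<Otimes>\<^sub>M borel)"
    for \<omega> and F :: "real ^ 'd \<Rightarrow> real ^ 'd \<Rightarrow> real ^ 'd \<Rightarrow> ennreal"
  proof -
    note [measurable_cong] = sets_Phi[OF w]
    note [measurable (raw)] = measurable_compose[OF _ F, of "\<lambda>a. (f a, g a, h a)" for f g h,
        unfolded prod.case]
    interpret Q: pair_sigma_finite "\<Phi> \<omega>" "lborel :: (real ^ 'd) measure"
      by (rule pair_sigma_finite_Phi[OF w lborel.sigma_finite_measure_axioms])
    have m: "(\<lambda>(x, z). \<integral>\<^sup>+y. F x y z \<partial>\<Phi> \<omega>) \<in> borel_measurable (borel \<Otimes>\<^sub>M borel)"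
      using w by measurable
    have "(\<integral>\<^sup>+x. \<integral>\<^sup>+y. \<integral>\<^sup>+z. F x y z \<partial>lborel \<partial>\<Phi> \<omega> \<partial>\<Phi> \<omega>) = (\<integral>\<^sup>+x. \<integral>\<^sup>+z. \<integral>\<^sup>+y. F x y z \<partial>\<Phi> \<omega> \<partial>lborel \<partial>\<Phi> \<omega>)"
      by (intro nn_integral_cong Q.Fubini'[symmetric]) measurable
    also have "\<dots> = (\<integral>\<^sup>+z. \<integral>\<^sup>+x. \<integral>\<^sup>+y. F x y z \<partial>\<Phi> \<omega> \<partial>\<Phi> \<omega> \<partial>lborel)"
      using m by (intro Q.Fubini'[symmetric]) simp
    finally show ?thesis .
  qed
  have "(\<integral>\<^sup>+u. \<integral>\<^sup>+x. g (x, x + u) \<partial>lborel \<partial>\<alpha>) =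
     (\<integral>\<^sup>+\<omega>. \<integral>\<^sup>+x. \<integral>\<^sup>+y. indicator ?C x * (\<integral>\<^sup>+z. g (z, z + (y - x)) \<partial>lborel) \<partial>\<Phi> \<omega> \<partial>\<Phi> \<omega> \<partial>M)"
    by (intro nn_integral_alpha) measurable
  also have "\<dots> = (\<integral>\<^sup>+\<omega>. \<integral>\<^sup>+x. \<integral>\<^sup>+y. \<integral>\<^sup>+z. indicator ?C x * g (x - z, y - z) \<partial>lborel \<partial>\<Phi> \<omega> \<partial>\<Phi> \<omega> \<partial>M)"
  proof (intro nn_integral_cong)
    fix x y
    have "(\<integral>\<^sup>+z. g (x - z, y - z) \<partial>lborel) = (\<integral>\<^sup>+z. g (z, z + (y - x)) \<partial>lborel)"
      using nn_integral_lborel_shift(3)[of "\<lambda>z. g (z, z + (y - x))" x] by simp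
    then show "indicator ?C x * (\<integral>\<^sup>+z. g (z, z + (y - x)) \<partial>lborel) = (\<integral>\<^sup>+z. indicator ?C x * g (x -
        z, y - z) \<partial>lborel)"
      by (simp add: nn_integral_cmult)
  qed
  also have "\<dots> = (\<integral>\<^sup>+\<omega>. \<integral>\<^sup>+z. \<integral>\<^sup>+x. \<integral>\<^sup>+y. indicator ?C x * g (x - z, y - z) \<partial>\<Phi> \<omega> \<partial>\<Phi> \<omega> \<partial>lborel \<partial>M)"
    by (intro nn_integral_cong sw1) measurable
  also have "\<dots> = (\<integral>\<^sup>+z. \<integral>\<^sup>+\<omega>. \<integral>\<^sup>+x. \<integral>\<^sup>+y. indicator ?C x * g (x - z, y - z) \<partial>\<Phi> \<omega> \<partial>\<Phi> \<omega> \<partial>M \<partial>lborel)"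
    by (intro P.Fubini'[symmetric]) measurable
  also have "\<dots> = (\<integral>\<^sup>+z. \<integral>\<^sup>+\<omega>. \<integral>\<^sup>+x. \<integral>\<^sup>+y. indicator ?C (x + z) * g (x, y) \<partial>\<Phi> \<omega> \<partial>\<Phi> \<omega> \<partial>M \<partial>lborel)"
    using stationary_second[of "\<lambda>(x, y). indicator ?C (x + z) * g (x, y)" z for z] by simp
  also have "\<dots> = (\<integral>\<^sup>+\<omega>. \<integral>\<^sup>+z. \<integral>\<^sup>+x. \<integral>\<^sup>+y. indicator ?C (x + z) * g (x, y) \<partial>\<Phi> \<omega> \<partial>\<Phi> \<omega> \<partial>lborel \<partial>M)"
    by (intro P.Fubini') measurable
  also have "\<dots> = (\<integral>\<^sup>+\<omega>. \<integral>\<^sup>+x. \<integral>\<^sup>+y. \<integral>\<^sup>+z. indicator ?C (x + z) * g (x, y) \<partial>lborel \<partial>\<Phi> \<omega> \<partial>\<Phi> \<omega> \<partial>M)"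
    by (intro nn_integral_cong sw1[symmetric]) measurable
  also have "\<dots> = (\<integral>\<^sup>+\<omega>. \<integral>\<^sup>+x. \<integral>\<^sup>+y. g (x, y) \<partial>\<Phi> \<omega> \<partial>\<Phi> \<omega> \<partial>M)"
    by (simp add: nn_integral_multc unit)
  finally show ?thesis by simp
qed

end

section \<open>The centred linear functionals and their second moments\<close>

lemma iterated_integrable:
  fixes F :: "'a \<Rightarrow> 'b \<Rightarrow> real"
  assumes "sigma_finite_measure B" and [measurable]: "case_prod F \<in> borel_measurable (A \<Otimes>\<^sub>M B)"
    and "(\<integral>\<^sup>+x. \<integral>\<^sup>+y. ennreal \<bar>F x y\<bar> \<partial>B \<partial>A) < \<infinity>"
  shows "integrable (A \<Otimes>\<^sub>M B) (case_prod F)"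
proof (rule integrableI_bounded)
  have "(\<integral>\<^sup>+p. ennreal (norm (case_prod F p)) \<partial>(A \<Otimes>\<^sub>M B)) = (\<integral>\<^sup>+x. \<integral>\<^sup>+y. ennreal \<bar>F x y\<bar> \<partial>B \<partial>A)"
    using sigma_finite_measure.nn_integral_fst[OF assms(1), of "\<lambda>p. ennreal \<bar>case_prod F p\<bar>" A] by simp
  then show "(\<integral>\<^sup>+p. ennreal (norm (case_prod F p)) \<partial>(A \<Otimes>\<^sub>M B)) < \<infinity>"
    using assms(3) by simp
qed measurable

lemma distr_lborel_affine:
  fixes t :: "'a :: euclidean_space"
  assumes "\<bar>c\<bar> = 1"
  shows "distr lborel borel (\<lambda>x. t + c *\<^sub>R x) = lborel"
  using lborel_affine[of c t] assms by (simp add: density_1)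

lemma integral_lborel_shift:
  fixes t :: "'a :: euclidean_space" and f :: "'a \<Rightarrow> real"
  assumes [measurable]: "f \<in> borel_measurable borel"
  shows "(\<integral>x. f (t + x) \<partial>lborel) = (\<integral>x. f x \<partial>lborel)"
    and "(\<integral>x. f (x + t) \<partial>lborel) = (\<integral>x. f x \<partial>lborel)"
    and "(\<integral>x. f (t - x) \<partial>lborel) = (\<integral>x. f x \<partial>lborel)"
    and "(\<integral>x. f (x - t) \<partial>lborel) = (\<integral>x. f x \<partial>lborel)"
    and "(\<integral>x. f (- x) \<partial>lborel) = (\<integral>x. f x \<partial>lborel)"
proof -
  have *: "(\<integral>x. f (t + c *\<^sub>R x) \<partial>lborel) = (\<integral>x. f x \<partial>lborel)" if "\<bar>c\<bar> = 1" for c and t :: 'a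
    by (subst (2) distr_lborel_affine[OF that, of t, symmetric]) (simp add: integral_distr)
  show "(\<integral>x. f (t + x) \<partial>lborel) = (\<integral>x. f x \<partial>lborel)"
    and "(\<integral>x. f (x + t) \<partial>lborel) = (\<integral>x. f x \<partial>lborel)"
    and "(\<integral>x. f (t - x) \<partial>lborel) = (\<integral>x. f x \<partial>lborel)"
    and "(\<integral>x. f (x - t) \<partial>lborel) = (\<integral>x. f x \<partial>lborel)"
    and "(\<integral>x. f (- x) \<partial>lborel) = (\<integral>x. f x \<partial>lborel)"
    using *[of 1 t] *[of "-1" t] *[of 1 "- t"] *[of "-1" 0] by (simp_all add: add.commute)
qed

lemma integrable_lborel_shift:
  fixes t :: "'a :: euclidean_space" and f :: "'a \<Rightarrow> real"
  assumes f: "integrable lborel f"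
  shows "integrable lborel (\<lambda>x. f (x + t))" and "integrable lborel (\<lambda>x. f (x - t))"
proof -
  have *: "integrable lborel (\<lambda>x. f (t + x))" for t
    using f distr_lborel_affine[of 1 t] borel_measurable_integrable[OF f]
    by (subst integrable_distr_eq[where g = "\<lambda>x. t + x" and N = borel, symmetric]) auto
  show "integrable lborel (\<lambda>x. f (x + t))" "integrable lborel (\<lambda>x. f (x - t))"
    using *[of t] *[of "- t"] by (simp_all add: add.commute)
qed

text \<open>For an indicator this is the set covariogram, the volume of the overlap of the set with
  its translate by \<open>- u\<close>. In general it is the convolution of \<open>f\<close> with its
  reflection.\<close>

definition autocorrelation :: "(real ^ 'd \<Rightarrow> real) \<Rightarrow> real ^ 'd \<Rightarrow> real" where
  "autocorrelation f u = (\<integral>x. f x * f (x + u) \<partial>lborel)"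

lemma autocorrelation_measurable [measurable]:
  assumes [measurable]: "f \<in> borel_measurable borel"
  shows "autocorrelation f \<in> borel_measurable borel"
  unfolding autocorrelation_def by measurable

lemma integrable_translate_product:
  assumes f: "integrable lborel f" and g: "integrable lborel (g :: real ^ 'd \<Rightarrow> real)"
  shows "integrable (lborel \<Otimes>\<^sub>M lborel) (\<lambda>(u, x). f x * g (x + u))"
proof -
  note [measurable] = borel_measurable_integrable[OF f, simplified] borel_measurable_integrable[OF
      g, simplified]
  have "(\<integral>\<^sup>+u. \<integral>\<^sup>+x. ennreal \<bar>f x * g (x + u)\<bar> \<partial>lborel \<partial>lborel) = (\<integral>\<^sup>+x. \<integral>\<^sup>+u. ennreal \<bar>f x * g (x +
      u)\<bar> \<partial>lborel \<partial>lborel)"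
    by (rule lborel_pair.Fubini') measurable
  also have "\<dots> = (\<integral>\<^sup>+x. ennreal \<bar>f x\<bar> \<partial>lborel) * (\<integral>\<^sup>+x. ennreal \<bar>g x\<bar> \<partial>lborel)"
    using nn_integral_lborel_shift(1)[of "\<lambda>x. ennreal \<bar>g x\<bar>"]
    by (simp add: abs_mult ennreal_mult nn_integral_cmult nn_integral_multc)
  also have "\<dots> < \<infinity>"
    using f g by (auto simp: integrable_iff_bounded ennreal_mult_less_top)
  finally show ?thesis
    by (intro iterated_integrable) (auto intro: lborel.sigma_finite_measure_axioms)
qed

lemma autocorrelation_lborel:
  assumes f: "integrable lborel (f :: real ^ 'd \<Rightarrow> real)"
  shows "integrable lborel (autocorrelation f)"
    and "(\<integral>u. autocorrelation f u \<partial>lborel) = (\<integral>x. f x \<partial>lborel)\<^sup>2"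
proof -
  note i = integrable_translate_product[OF f f]
  show "integrable lborel (autocorrelation f)"
    unfolding autocorrelation_def using lborel_pair.integrable_fst[OF i] by simp
  have "(\<integral>u. autocorrelation f u \<partial>lborel) = (\<integral>x. \<integral>u. f x * f (x + u) \<partial>lborel \<partial>lborel)"
    unfolding autocorrelation_def by (rule lborel_pair.Fubini_integral[OF i, symmetric])
  also have "\<dots> = (\<integral>x. f x \<partial>lborel)\<^sup>2"
    using f by (simp add: integral_lborel_shift(1)[OF borel_measurable_integrable[OF f, simplified]]
        power2_eq_square)
  finally show "(\<integral>u. autocorrelation f u \<partial>lborel) = (\<integral>x. f x \<partial>lborel)\<^sup>2" .
qed

text \<open>Young's inequality in the form needed for comparing two variances: as \<open>e\<close>
  tends to 0 the factor of the main term tends to 1 and the remainder pays 1 / e.\<close>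

lemma square_sum_le:
  fixes a b e :: real assumes "e > 0"
  shows "(a + b)\<^sup>2 \<le> (1 + e) * a\<^sup>2 + (1 + 1 / e) * b\<^sup>2"
proof -
  have "0 \<le> (e * a - b)\<^sup>2 / e" using assms by simp
  also have "\<dots> = (1 + e) * a\<^sup>2 + (1 + 1 / e) * b\<^sup>2 - (a + b)\<^sup>2"
    using assms by (simp add: field_simps power2_eq_square)
  finally show ?thesis by simp
qed

section \<open>Centred linear functionals, their variances and the covariance functional\<close>

context stationary_random_measure
begin

definition Y :: "(real ^ 'd \<Rightarrow> real) \<Rightarrow> 'w \<Rightarrow> real" where
  "Y f \<omega> = (\<integral>x. f x \<partial>\<Phi> \<omega>) - \<gamma> * (\<integral>x. f x \<partial>lborel)"

text \<open>Extended-valued, so that inequalities between variances can be stated before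
  integrability is known and an infinite expectation is not replaced by the default 0.\<close>

definition V :: "(real ^ 'd \<Rightarrow> real) \<Rightarrow> ennreal" where
  "V f = (\<integral>\<^sup>+\<omega>. ennreal ((Y f \<omega>)\<^sup>2) \<partial>M)"

text \<open>Integration against the covariance measure. Both of its parts may be infinite, so the
  signed integral is encoded as a difference, meaningful for functions that are integrable with
  respect to each part.\<close>

definition L :: "(real ^ 'd \<Rightarrow> real) \<Rightarrow> real" where
  "L F = (\<integral>u. F u \<partial>\<alpha>) - \<gamma>\<^sup>2 * (\<integral>u. F u \<partial>lborel)"

text \<open>The condition on the absolute value makes the linear functional square-integrable
  together with its positive and negative part, which lets the second moment be expanded by
  Campbell's formula.\<close>

definition admissible :: "(real ^ 'd \<Rightarrow> real) \<Rightarrow> bool" where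
  "admissible f \<longleftrightarrow> f \<in> borel_measurable borel \<and> integrable lborel f \<and>
     (\<integral>\<^sup>+\<omega>. (\<integral>\<^sup>+x. ennreal \<bar>f x\<bar> \<partial>\<Phi> \<omega>)\<^sup>2 \<partial>M) < \<infinity>"

lemma Y_measurable [measurable (raw)]:
  assumes [measurable]: "(\<lambda>(a, x). f a x) \<in> borel_measurable (A \<Otimes>\<^sub>M borel)" "g \<in> measurable A M"
  shows "(\<lambda>a. Y (f a) (g a)) \<in> borel_measurable A"
  unfolding Y_def by measurable

text \<open>Campbell's formula makes the expected integral of the absolute value finite. Off the
  exceptional null set the Bochner integral is linear in \<open>f\<close> and not subject to its
  default 0.\<close>

lemma AE_integrable_Phi:
  fixes f :: "real ^ 'd \<Rightarrow> real"
  assumes f: "integrable lborel f" and [measurable]: "f \<in> borel_measurable borel"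
  shows "AE \<omega> in M. integrable (\<Phi> \<omega>) f"
proof -
  have "(\<integral>\<^sup>+\<omega>. \<integral>\<^sup>+x. ennreal \<bar>f x\<bar> \<partial>\<Phi> \<omega> \<partial>M) = ennreal \<gamma> * (\<integral>\<^sup>+x. ennreal \<bar>f x\<bar> \<partial>lborel)"
    by (rule campbell_first) measurable
  also have "\<dots> < \<infinity>" using f by (auto simp: integrable_iff_bounded ennreal_mult_less_top)
  finally have "AE \<omega> in M. (\<integral>\<^sup>+x. ennreal \<bar>f x\<bar> \<partial>\<Phi> \<omega>) \<noteq> \<infinity>"
    by (intro nn_integral_PInf_AE) auto
  with AE_space show ?thesis
  proof eventually_elim
    case (elim \<omega>)
    note [measurable_cong] = sets_Phi[OF elim(1)]
    from elim(2) show ?case by (intro integrableI_bounded) (auto simp: less_top)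
  qed
qed

lemma mean_nonneg:
  fixes f :: "real ^ 'd \<Rightarrow> real"
  assumes f: "integrable lborel f" and [measurable]: "f \<in> borel_measurable borel" and nn: "\<And>x. 0 \<le> f x"
  shows "integrable M (\<lambda>\<omega>. \<integral>x. f x \<partial>\<Phi> \<omega>)" and "(\<integral>\<omega>. \<integral>x. f x \<partial>\<Phi> \<omega> \<partial>M) = \<gamma> * (\<integral>x. f x \<partial>lborel)"
proof -
  have "(\<integral>\<^sup>+\<omega>. ennreal (\<integral>x. f x \<partial>\<Phi> \<omega>) \<partial>M) = (\<integral>\<^sup>+\<omega>. \<integral>\<^sup>+x. ennreal (f x) \<partial>\<Phi> \<omega> \<partial>M)"
    using AE_integrable_Phi[OF f] by (intro nn_integral_cong_AE) (auto simp: nn_integral_eq_integral nn)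
  also have "\<dots> = ennreal \<gamma> * (\<integral>\<^sup>+x. ennreal (f x) \<partial>lborel)"
    by (rule campbell_first) measurable
  also have "\<dots> = ennreal (\<gamma> * (\<integral>x. f x \<partial>lborel))"
    using nn by (simp add: nn_integral_eq_integral[OF f] ennreal_mult' intensity_nonneg)
  finally have "has_bochner_integral M (\<lambda>\<omega>. \<integral>x. f x \<partial>\<Phi> \<omega>) (\<gamma> * (\<integral>x. f x \<partial>lborel))"
    by (intro has_bochner_integral_nn_integral) (auto simp: nn intensity_nonneg)
  then show "integrable M (\<lambda>\<omega>. \<integral>x. f x \<partial>\<Phi> \<omega>)" and "(\<integral>\<omega>. \<integral>x. f x \<partial>\<Phi> \<omega> \<partial>M) = \<gamma> * (\<integral>x. f x \<partial>lborel)"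
    by (auto simp: has_bochner_integral_iff)
qed

lemma AE_integral_split:
  fixes f :: "real ^ 'd \<Rightarrow> real"
  assumes f: "integrable lborel f" and [measurable]: "f \<in> borel_measurable borel"
  shows "AE \<omega> in M. (\<integral>x. f x \<partial>\<Phi> \<omega>) = (\<integral>x. max 0 (f x) \<partial>\<Phi> \<omega>) - (\<integral>x. max 0 (- f x) \<partial>\<Phi> \<omega>)"
proof -
  from AE_integrable_Phi[OF f assms(2)] show ?thesis
  proof eventually_elim
    case (elim \<omega>)
    have "(\<integral>x. f x \<partial>\<Phi> \<omega>) = (\<integral>x. max 0 (f x) - max 0 (- f x) \<partial>\<Phi> \<omega>)"
      by (intro Bochner_Integration.integral_cong) auto
    also have "\<dots> = (\<integral>x. max 0 (f x) \<partial>\<Phi> \<omega>) - (\<integral>x. max 0 (- f x) \<partial>\<Phi> \<omega>)"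
      using elim by (intro Bochner_Integration.integral_diff) auto
    finally show ?case .
  qed
qed

lemma mean:
  fixes f :: "real ^ 'd \<Rightarrow> real"
  assumes f: "integrable lborel f" and [measurable]: "f \<in> borel_measurable borel"
  shows "integrable M (\<lambda>\<omega>. \<integral>x. f x \<partial>\<Phi> \<omega>)" and "(\<integral>\<omega>. \<integral>x. f x \<partial>\<Phi> \<omega> \<partial>M) = \<gamma> * (\<integral>x. f x \<partial>lborel)"
proof -
  have i: "integrable lborel (\<lambda>x. max 0 (f x))" "integrable lborel (\<lambda>x. max 0 (- f x))" using f by auto
  note 1 = mean_nonneg[OF i(1)] and 2 = mean_nonneg[OF i(2)]
  have d: "integrable M (\<lambda>\<omega>. (\<integral>x. max 0 (f x) \<partial>\<Phi> \<omega>) - (\<integral>x. max 0 (- f x) \<partial>\<Phi> \<omega>))"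
    using 1(1) 2(1) by simp
  then show "integrable M (\<lambda>\<omega>. \<integral>x. f x \<partial>\<Phi> \<omega>)"
    by (rule integrable_cong_AE_imp) (use AE_integral_split[OF f] in \<open>auto elim: eventually_mono\<close>)
  have "(\<integral>\<omega>. \<integral>x. f x \<partial>\<Phi> \<omega> \<partial>M) = (\<integral>\<omega>. (\<integral>x. max 0 (f x) \<partial>\<Phi> \<omega>) - (\<integral>x. max 0 (- f x) \<partial>\<Phi> \<omega>) \<partial>M)"
    by (intro integral_cong_AE AE_integral_split[OF f]) auto
  also have "\<dots> = \<gamma> * (\<integral>x. max 0 (f x) \<partial>lborel) - \<gamma> * (\<integral>x. max 0 (- f x) \<partial>lborel)"
    using 1 2 by simp
  also have "\<dots> = \<gamma> * ((\<integral>x. max 0 (f x) - max 0 (- f x) \<partial>lborel))"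
    using i by (simp add: right_diff_distrib)
  also have "(\<lambda>x. max 0 (f x) - max 0 (- f x)) = f" by auto
  finally show "(\<integral>\<omega>. \<integral>x. f x \<partial>\<Phi> \<omega> \<partial>M) = \<gamma> * (\<integral>x. f x \<partial>lborel)" .
qed

lemma admissible_mono:
  assumes "admissible g" and [measurable]: "f \<in> borel_measurable borel" and le: "\<And>x. \<bar>f x\<bar> \<le> \<bar>g x\<bar>"
  shows "admissible f"
  unfolding admissible_def
proof (intro conjI)
  show "integrable lborel f"
    by (rule Bochner_Integration.integrable_bound[of _ g]) (use assms in \<open>auto simp: admissible_def\<close>)
  have "(\<integral>\<^sup>+\<omega>. (\<integral>\<^sup>+x. ennreal \<bar>f x\<bar> \<partial>\<Phi> \<omega>)\<^sup>2 \<partial>M) \<le> (\<integral>\<^sup>+\<omega>. (\<integral>\<^sup>+x. ennreal \<bar>g x\<bar> \<partial>\<Phi> \<omega>)\<^sup>2 \<partial>M)"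
    by (intro nn_integral_mono power_mono ennreal_leI le) auto
  also have "\<dots> < \<infinity>" using assms by (simp add: admissible_def)
  finally show "(\<integral>\<^sup>+\<omega>. (\<integral>\<^sup>+x. ennreal \<bar>f x\<bar> \<partial>\<Phi> \<omega>)\<^sup>2 \<partial>M) < \<infinity>" .
qed fact

lemma ennreal_square_add_le: "(a + b)\<^sup>2 \<le> 2 * (a\<^sup>2 + b\<^sup>2 :: ennreal)"
proof (cases a; cases b)
  fix r s :: real assume *: "a = ennreal r" "0 \<le> r" "b = ennreal s" "0 \<le> s"
  have "(r + s)\<^sup>2 \<le> 2 * (r\<^sup>2 + s\<^sup>2)" using square_sum_le[of 1 r s] by simp
  then have "ennreal ((r + s)\<^sup>2) \<le> ennreal (2 * (r\<^sup>2 + s\<^sup>2))" by (rule ennreal_leI)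
  also have "\<dots> = 2 * (ennreal (r\<^sup>2) + ennreal (s\<^sup>2))" by (subst ennreal_mult) auto
  finally show ?thesis using * by (simp add: ennreal_power flip: ennreal_plus)
qed (auto simp: power2_eq_square ennreal_mult_top ennreal_top_mult)

lemma admissible_add:
  assumes f: "admissible f" and g: "admissible g"
  shows "admissible (\<lambda>x. f x + g x)"
  unfolding admissible_def
proof (intro conjI)
  have [measurable]: "f \<in> borel_measurable borel" "g \<in> borel_measurable borel"
    using f g by (auto simp: admissible_def)
  show "(\<lambda>x. f x + g x) \<in> borel_measurable borel" by measurable
  show "integrable lborel (\<lambda>x. f x + g x)" using f g by (simp add: admissible_def)
  have "(\<integral>\<^sup>+\<omega>. (\<integral>\<^sup>+x. ennreal \<bar>f x + g x\<bar> \<partial>\<Phi> \<omega>)\<^sup>2 \<partial>M) \<le>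
     (\<integral>\<^sup>+\<omega>. 2 * ((\<integral>\<^sup>+x. ennreal \<bar>f x\<bar> \<partial>\<Phi> \<omega>)\<^sup>2 + (\<integral>\<^sup>+x. ennreal \<bar>g x\<bar> \<partial>\<Phi> \<omega>)\<^sup>2) \<partial>M)"
  proof (rule nn_integral_mono)
    fix \<omega> assume w: "\<omega> \<in> space M"
    note [measurable_cong] = sets_Phi[OF w]
    have "(\<integral>\<^sup>+x. ennreal \<bar>f x + g x\<bar> \<partial>\<Phi> \<omega>) \<le> (\<integral>\<^sup>+x. ennreal \<bar>f x\<bar> + ennreal \<bar>g x\<bar> \<partial>\<Phi> \<omega>)"
      by (intro nn_integral_mono) (auto simp flip: ennreal_plus intro!: ennreal_leI)
    also have "\<dots> = (\<integral>\<^sup>+x. ennreal \<bar>f x\<bar> \<partial>\<Phi> \<omega>) + (\<integral>\<^sup>+x. ennreal \<bar>g x\<bar> \<partial>\<Phi> \<omega>)"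
      by (rule nn_integral_add) measurable
    finally show "(\<integral>\<^sup>+x. ennreal \<bar>f x + g x\<bar> \<partial>\<Phi> \<omega>)\<^sup>2 \<le> 2 * ((\<integral>\<^sup>+x. ennreal \<bar>f x\<bar> \<partial>\<Phi> \<omega>)\<^sup>2 + (\<integral>\<^sup>+x.
        ennreal \<bar>g x\<bar> \<partial>\<Phi> \<omega>)\<^sup>2)"
      by (intro order_trans[OF power_mono ennreal_square_add_le]) auto
  qed
  also have "\<dots> = 2 * ((\<integral>\<^sup>+\<omega>. (\<integral>\<^sup>+x. ennreal \<bar>f x\<bar> \<partial>\<Phi> \<omega>)\<^sup>2 \<partial>M) + (\<integral>\<^sup>+\<omega>. (\<integral>\<^sup>+x. ennreal \<bar>g x\<bar> \<partial>\<Phi> \<omega>)\<^sup>2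
      \<partial>M))"
    by (simp add: nn_integral_cmult nn_integral_add)
  also have "\<dots> < \<infinity>" using f g by (simp add: admissible_def ennreal_mult_less_top)
  finally show "(\<integral>\<^sup>+\<omega>. (\<integral>\<^sup>+x. ennreal \<bar>f x + g x\<bar> \<partial>\<Phi> \<omega>)\<^sup>2 \<partial>M) < \<infinity>" .
qed

lemma admissible_diff:
  assumes f: "admissible f" and g: "admissible g"
  shows "admissible (\<lambda>x. f x - g x)"
proof -
  have "admissible (\<lambda>x. - g x)" by (rule admissible_mono[OF g]) (use g in \<open>auto simp: admissible_def\<close>)
  from admissible_add[OF f this] show ?thesis by simp
qed

lemma admissible_indicator:
  assumes "bounded B" and [measurable]: "B \<in> sets borel"
  shows "admissible (indicator B)"
  unfolding admissible_def
proof (intro conjI)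
  show "integrable lborel (indicator B :: _ \<Rightarrow> real)"
    using assms emeasure_bounded_finite[OF assms(1)] by (simp add: integrable_indicator_iff)
  have "(\<integral>\<^sup>+\<omega>. (\<integral>\<^sup>+x. ennreal \<bar>indicator B x\<bar> \<partial>\<Phi> \<omega>)\<^sup>2 \<partial>M) = (\<integral>\<^sup>+\<omega>. (emeasure (\<Phi> \<omega>) B)\<^sup>2 \<partial>M)"
    by (intro nn_integral_cong) (simp add: ennreal_indicator sets_Phi)
  also have "\<dots> < \<infinity>" by (rule finite_second_moment) fact+
  finally show "(\<integral>\<^sup>+\<omega>. (\<integral>\<^sup>+x. ennreal \<bar>indicator B x :: real\<bar> \<partial>\<Phi> \<omega>)\<^sup>2 \<partial>M) < \<infinity>" .
qed measurable

lemma admissible_shift: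
  assumes f: "admissible f" shows "admissible (\<lambda>x. f (x - z))"
  unfolding admissible_def
proof (intro conjI)
  have [measurable]: "f \<in> borel_measurable borel" using f by (auto simp: admissible_def)
  show "(\<lambda>x. f (x - z)) \<in> borel_measurable borel" by measurable
  show "integrable lborel (\<lambda>x. f (x - z))" using f by (simp add: admissible_def integrable_lborel_shift)
  have "(\<lambda>N. (\<integral>\<^sup>+x. ennreal \<bar>f x\<bar> \<partial>N)\<^sup>2) \<in> borel_measurable (locally_finite_algebra :: (real ^ 'd)
      measure measure)"
    unfolding power2_eq_square by (intro borel_measurable_times_ennreal
        nn_integral_kernel_measurable) measurable
  from stationary_nn_integral[OF this, of z]
  show "(\<integral>\<^sup>+\<omega>. (\<integral>\<^sup>+x. ennreal \<bar>f (x - z)\<bar> \<partial>\<Phi> \<omega>)\<^sup>2 \<partial>M) < \<infinity>"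
    using f by (simp add: nn_integral_shift_measure admissible_def cong: nn_integral_cong)
qed

lemma V_shift:
  assumes [measurable]: "f \<in> borel_measurable borel"
  shows "V (\<lambda>x. f (x - z)) = V f"
proof -
  have "(\<lambda>N. ennreal (((\<integral>x. f x \<partial>N) - \<gamma> * (\<integral>x. f x \<partial>lborel))\<^sup>2)) \<in> borel_measurable
      (locally_finite_algebra :: (real ^ 'd) measure measure)"
    by (intro measurable_compose[OF _ measurable_ennreal] borel_measurable_power borel_measurable_diff
        borel_measurable_const integral_kernel_measurable) measurable
  from stationary_nn_integral[OF this, of z] show ?thesis
    by (simp add: V_def Y_def integral_shift_measure integral_lborel_shift cong: nn_integral_cong)
qed

text \<open>Young's inequality applied to each realisation. \<open>Y\<close> splits additively only
  where both functions are integrable, hence the almost sure formulation inside.\<close>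

lemma V_le_add:
  assumes e: "e > 0" and f: "integrable lborel f" and h: "integrable lborel h"
    and [measurable]: "f \<in> borel_measurable borel" "h \<in> borel_measurable borel"
  shows "V f \<le> ennreal (1 + e) * V h + ennreal (1 + 1 / e) * V (\<lambda>x. f x - h x)"
proof -
  have "V f \<le> (\<integral>\<^sup>+\<omega>. ennreal (1 + e) * ennreal ((Y h \<omega>)\<^sup>2) + ennreal (1 + 1 / e) * ennreal ((Y (\<lambda>x.
      f x - h x) \<omega>)\<^sup>2) \<partial>M)"
    unfolding V_def
  proof (rule nn_integral_mono_AE)
    from AE_integrable_Phi[OF f] AE_integrable_Phi[OF h]
    have "AE \<omega> in M. integrable (\<Phi> \<omega>) f" "AE \<omega> in M. integrable (\<Phi> \<omega>) h" by auto
    then show "AE \<omega> in M. ennreal ((Y f \<omega>)\<^sup>2) \<le> ennreal (1 + e) * ennreal ((Y h \<omega>)\<^sup>2) + ennreal (1 +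
        1 / e) * ennreal ((Y (\<lambda>x. f x - h x) \<omega>)\<^sup>2)"
    proof eventually_elim
      case (elim \<omega>)
      have "Y f \<omega> = Y h \<omega> + Y (\<lambda>x. f x - h x) \<omega>"
        using elim f h by (simp add: Y_def algebra_simps)
      then have "(Y f \<omega>)\<^sup>2 \<le> (1 + e) * (Y h \<omega>)\<^sup>2 + (1 + 1 / e) * (Y (\<lambda>x. f x - h x) \<omega>)\<^sup>2"
        using square_sum_le[OF e] by simp
      then have "ennreal ((Y f \<omega>)\<^sup>2) \<le> ennreal ((1 + e) * (Y h \<omega>)\<^sup>2 + (1 + 1 / e) * (Y (\<lambda>x. f x - h
          x) \<omega>)\<^sup>2)"
        by (rule ennreal_leI)
      also have "\<dots> = ennreal (1 + e) * ennreal ((Y h \<omega>)\<^sup>2) + ennreal (1 + 1 / e) * ennreal ((Y (\<lambda>x.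
          f x - h x) \<omega>)\<^sup>2)"
        using e by (subst ennreal_plus) (auto simp: ennreal_mult)
      finally show ?case .
    qed
  qed
  also have "\<dots> = ennreal (1 + e) * V h + ennreal (1 + 1 / e) * V (\<lambda>x. f x - h x)"
    unfolding V_def by (subst nn_integral_add) (auto simp: nn_integral_cmult)
  finally show ?thesis .
qed

text \<open>\<open>Y\<close> of a mixture is the mixture of the \<open>Y\<close> by Fubini, and
  squaring is convex. The family \<open>F\<close> is left general because the lemma is applied both
  to translates of a window and to increments.\<close>

lemma V_mixture:
  fixes F :: "'q \<Rightarrow> real ^ 'd \<Rightarrow> real"
  assumes Q: "prob_space Q" and [measurable]: "(\<lambda>(z, x). F z x) \<in> borel_measurable (Q \<Otimes>\<^sub>M borel)"
    and fin: "(\<integral>\<^sup>+z. \<integral>\<^sup>+x. ennreal \<bar>F z x\<bar> \<partial>lborel \<partial>Q) < \<infinity>"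
  shows "V (\<lambda>x. \<integral>z. F z x \<partial>Q) \<le> (\<integral>\<^sup>+z. V (F z) \<partial>Q)"
proof -
  interpret Q: prob_space Q by fact
  interpret QM: pair_sigma_finite Q M ..
  interpret QL: pair_sigma_finite Q "lborel :: (real ^ 'd) measure" ..
  have fin': "(\<integral>\<^sup>+x. \<integral>\<^sup>+z. ennreal \<bar>F z x\<bar> \<partial>Q \<partial>lborel) < \<infinity>"
    using fin by (subst QL.Fubini') auto
  have "(\<integral>\<^sup>+\<omega>. \<integral>\<^sup>+x. \<integral>\<^sup>+z. ennreal \<bar>F z x\<bar> \<partial>Q \<partial>\<Phi> \<omega> \<partial>M) = ennreal \<gamma> * (\<integral>\<^sup>+x. \<integral>\<^sup>+z. ennreal \<bar>F z x\<bar> \<partial>Q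
      \<partial>lborel)"
    by (rule campbell_first) measurable
  also have "\<dots> < \<infinity>" using fin' by (simp add: ennreal_mult_less_top)
  finally have "AE \<omega> in M. (\<integral>\<^sup>+x. \<integral>\<^sup>+z. ennreal \<bar>F z x\<bar> \<partial>Q \<partial>\<Phi> \<omega>) \<noteq> \<infinity>"
    by (intro nn_integral_PInf_AE) auto
  with AE_space have "AE \<omega> in M. ennreal ((Y (\<lambda>x. \<integral>z. F z x \<partial>Q) \<omega>)\<^sup>2) \<le> (\<integral>\<^sup>+z. ennreal ((Y (F z)
      \<omega>)\<^sup>2) \<partial>Q)"
  proof eventually_elim
    case (elim \<omega>)
    note w = elim(1)
    note [measurable_cong] = sets_Phi[OF w]
    interpret PQ: pair_sigma_finite "\<Phi> \<omega>" Q
      by (rule pair_sigma_finite_Phi[OF w Q.sigma_finite_measure_axioms])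
    interpret LQ: pair_sigma_finite "lborel :: (real ^ 'd) measure" Q ..
    have i1: "integrable (\<Phi> \<omega> \<Otimes>\<^sub>M Q) (\<lambda>(x, z). F z x)"
      using elim by (intro iterated_integrable Q.sigma_finite_measure_axioms) (auto simp: less_top)
    have i2: "integrable (lborel \<Otimes>\<^sub>M Q) (\<lambda>(x, z). F z x)"
      using fin' by (intro iterated_integrable Q.sigma_finite_measure_axioms) auto
    have iY: "integrable Q (\<lambda>z. Y (F z) \<omega>)"
      unfolding Y_def using PQ.integrable_snd[OF i1] LQ.integrable_snd[OF i2] by simp
    have "Y (\<lambda>x. \<integral>z. F z x \<partial>Q) \<omega> = (\<integral>z. Y (F z) \<omega> \<partial>Q)"
      unfolding Y_def using PQ.integrable_snd[OF i1] LQ.integrable_snd[OF i2]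
        PQ.Fubini_integral[OF i1] LQ.Fubini_integral[OF i2] by simp
    moreover have [measurable]: "(\<lambda>z. Y (F z) \<omega>) \<in> borel_measurable Q" using iY by simp
    have "ennreal ((\<integral>z. Y (F z) \<omega> \<partial>Q)\<^sup>2) \<le> (\<integral>\<^sup>+z. ennreal ((Y (F z) \<omega>)\<^sup>2) \<partial>Q)"
    proof (cases "integrable Q (\<lambda>z. (Y (F z) \<omega>)\<^sup>2)")
      case True
      \<comment> \<open>Jensen's inequality for the square is the nonnegativity of this
        variance.\<close>
      have "0 \<le> Q.variance (\<lambda>z. Y (F z) \<omega>)" by simp
      also have "\<dots> = (\<integral>z. (Y (F z) \<omega>)\<^sup>2 \<partial>Q) - (\<integral>z. Y (F z) \<omega> \<partial>Q)\<^sup>2"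
        by (rule Q.variance_eq[OF iY True])
      finally have le: "(\<integral>z. Y (F z) \<omega> \<partial>Q)\<^sup>2 \<le> (\<integral>z. (Y (F z) \<omega>)\<^sup>2 \<partial>Q)" by linarith
      have "(\<integral>\<^sup>+z. ennreal ((Y (F z) \<omega>)\<^sup>2) \<partial>Q) = ennreal (\<integral>z. (Y (F z) \<omega>)\<^sup>2 \<partial>Q)"
        by (rule nn_integral_eq_integral[OF True]) simp
      then show ?thesis using ennreal_leI[OF le] by (simp only:)
    next
      \<comment> \<open>Without square integrability the right side is infinite and nothing is to be
        shown.\<close>
      case False
      moreover have "integrable Q (\<lambda>z. (Y (F z) \<omega>)\<^sup>2)" if "(\<integral>\<^sup>+z. ennreal ((Y (F z) \<omega>)\<^sup>2) \<partial>Q) < \<infinity>"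
        by (rule integrableI_nonneg[OF _ _ that]) auto
      ultimately show ?thesis by (metis infinity_ennreal_def less_top top_greatest)
    qed
    ultimately show ?case by simp
  qed
  then have "V (\<lambda>x. \<integral>z. F z x \<partial>Q) \<le> (\<integral>\<^sup>+\<omega>. \<integral>\<^sup>+z. ennreal ((Y (F z) \<omega>)\<^sup>2) \<partial>Q \<partial>M)"
    unfolding V_def by (rule nn_integral_mono_AE)
  also have "\<dots> = (\<integral>\<^sup>+z. V (F z) \<partial>Q)"
    unfolding V_def by (rule QM.Fubini') measurable
  finally show ?thesis .
qed

text \<open>For nonnegative functions everything is computed with extended values by the second
  Campbell formula, and integrability is read off from finiteness.\<close>

lemma cross_moment:
  assumes a: "admissible a" "\<And>x. 0 \<le> a x" and b: "admissible b" "\<And>x. 0 \<le> b x"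
  shows "integrable M (\<lambda>\<omega>. (\<integral>x. a x \<partial>\<Phi> \<omega>) * (\<integral>x. b x \<partial>\<Phi> \<omega>))" (is ?A)
    and "integrable (\<alpha> \<Otimes>\<^sub>M lborel) (\<lambda>(u, x). a x * b (x + u))" (is ?B)
    and "(\<integral>\<omega>. (\<integral>x. a x \<partial>\<Phi> \<omega>) * (\<integral>x. b x \<partial>\<Phi> \<omega>) \<partial>M) = (\<integral>(u, x). a x * b (x + u) \<partial>(\<alpha> \<Otimes>\<^sub>M lborel))" (is ?C)
proof -
  have [measurable]: "a \<in> borel_measurable borel" "b \<in> borel_measurable borel"
    using a b by (auto simp: admissible_def)
  have i: "integrable lborel a" "integrable lborel b"
    using a b by (auto simp: admissible_def)
  let ?T = "\<integral>\<^sup>+\<omega>. (\<integral>\<^sup>+x. ennreal (a x) \<partial>\<Phi> \<omega>) * (\<integral>\<^sup>+x. ennreal (b x) \<partial>\<Phi> \<omega>) \<partial>M"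
  \<comment> \<open>The maximum replaces the usual argument through the square of a difference, as
    subtraction in \<open>ennreal\<close> is truncated.\<close>
  have mult_le: "c * d \<le> c\<^sup>2 + d\<^sup>2" for c d :: ennreal
  proof -
    have "c * d \<le> max c d * max c d" by (intro mult_mono) auto
    also have "\<dots> \<le> c\<^sup>2 + d\<^sup>2" by (auto simp: max_def power2_eq_square)
    finally show ?thesis .
  qed
  have "?T \<le> (\<integral>\<^sup>+\<omega>. (\<integral>\<^sup>+x. ennreal (a x) \<partial>\<Phi> \<omega>)\<^sup>2 + (\<integral>\<^sup>+x. ennreal (b x) \<partial>\<Phi> \<omega>)\<^sup>2 \<partial>M)"
    by (intro nn_integral_mono mult_le)
  also have "\<dots> = (\<integral>\<^sup>+\<omega>. (\<integral>\<^sup>+x. ennreal (a x) \<partial>\<Phi> \<omega>)\<^sup>2 \<partial>M) + (\<integral>\<^sup>+\<omega>. (\<integral>\<^sup>+x. ennreal (b x) \<partial>\<Phi> \<omega>)\<^sup>2 \<partial>M)"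
    by (rule nn_integral_add) measurable
  also have "\<dots> < \<infinity>" using a b by (simp add: admissible_def)
  finally have T: "?T < \<infinity>" .
  have "(\<integral>\<^sup>+u. \<integral>\<^sup>+x. ennreal (a x) * ennreal (b (x + u)) \<partial>lborel \<partial>\<alpha>) =
    (\<integral>\<^sup>+\<omega>. \<integral>\<^sup>+x. \<integral>\<^sup>+y. ennreal (a x) * ennreal (b y) \<partial>\<Phi> \<omega> \<partial>\<Phi> \<omega> \<partial>M)"
    using campbell_second[of "\<lambda>(x, y). ennreal (a x) * ennreal (b y)"] by simp
  also have "\<dots> = ?T"
  proof (rule nn_integral_cong)
    fix \<omega> assume w: "\<omega> \<in> space M"
    note [measurable_cong] = sets_Phi[OF w]
    show "(\<integral>\<^sup>+x. \<integral>\<^sup>+y. ennreal (a x) * ennreal (b y) \<partial>\<Phi> \<omega> \<partial>\<Phi> \<omega>) = (\<integral>\<^sup>+x. ennreal (a x) \<partial>\<Phi> \<omega>) *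
        (\<integral>\<^sup>+x. ennreal (b x) \<partial>\<Phi> \<omega>)"
      by (simp add: nn_integral_cmult nn_integral_multc)
  qed
  finally have eq: "(\<integral>\<^sup>+u. \<integral>\<^sup>+x. ennreal (a x) * ennreal (b (x + u)) \<partial>lborel \<partial>\<alpha>) = ?T" .
  have eq1: "(\<integral>\<^sup>+u. \<integral>\<^sup>+x. ennreal \<bar>a x * b (x + u)\<bar> \<partial>lborel \<partial>\<alpha>) = ?T"
    using a b by (subst eq[symmetric]) (simp add: ennreal_mult)
  show B: ?B
    using T eq1 by (intro iterated_integrable lborel.sigma_finite_measure_axioms) auto
  have "(\<integral>\<^sup>+(u, x). ennreal (a x * b (x + u)) \<partial>(\<alpha> \<Otimes>\<^sub>M lborel)) = ?T"
    using a b by (subst eq1[symmetric]) (simp add: lborel.nn_integral_fst[symmetric] split_beta'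
        abs_mult)
  moreover have "(\<integral>\<^sup>+(u, x). ennreal (a x * b (x + u)) \<partial>(\<alpha> \<Otimes>\<^sub>M lborel)) = ennreal (\<integral>(u, x). a x * b
      (x + u) \<partial>(\<alpha> \<Otimes>\<^sub>M lborel))"
    using nn_integral_eq_integral[OF B] a b by (simp add: split_beta')
  moreover have "?T = (\<integral>\<^sup>+\<omega>. ennreal ((\<integral>x. a x \<partial>\<Phi> \<omega>) * (\<integral>x. b x \<partial>\<Phi> \<omega>)) \<partial>M)"
  proof (rule nn_integral_cong_AE)
    from AE_integrable_Phi[OF i(1)] AE_integrable_Phi[OF i(2)]
    have "AE \<omega> in M. integrable (\<Phi> \<omega>) a" "AE \<omega> in M. integrable (\<Phi> \<omega>) b" by auto
    then show "AE \<omega> in M. (\<integral>\<^sup>+x. ennreal (a x) \<partial>\<Phi> \<omega>) * (\<integral>\<^sup>+x. ennreal (b x) \<partial>\<Phi> \<omega>) = ennreal ((\<integral>x. a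
        x \<partial>\<Phi> \<omega>) * (\<integral>x. b x \<partial>\<Phi> \<omega>))"
    proof eventually_elim
      case (elim \<omega>) then show ?case
        using a b by (simp add: nn_integral_eq_integral ennreal_mult)
    qed
  qed
  ultimately have "(\<integral>\<^sup>+\<omega>. ennreal ((\<integral>x. a x \<partial>\<Phi> \<omega>) * (\<integral>x. b x \<partial>\<Phi> \<omega>)) \<partial>M) = ennreal (\<integral>(u, x). a x * b
      (x + u) \<partial>(\<alpha> \<Otimes>\<^sub>M lborel))"
    by simp
  then have "has_bochner_integral M (\<lambda>\<omega>. (\<integral>x. a x \<partial>\<Phi> \<omega>) * (\<integral>x. b x \<partial>\<Phi> \<omega>)) (\<integral>(u, x). a x * b (x + u)
      \<partial>(\<alpha> \<Otimes>\<^sub>M lborel))"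
    by (intro has_bochner_integral_nn_integral) (auto simp: a b intro!:
        Bochner_Integration.integral_nonneg)
  then show ?A ?C by (auto simp: has_bochner_integral_iff)
qed

text \<open>Splitting \<open>f\<close> into positive and negative part yields four cross moments;
  they reassemble on the side of \<open>\<alpha>\<close> because the product is bilinear.\<close>

lemma second_moment:
  assumes f: "admissible f"
  shows "integrable M (\<lambda>\<omega>. (\<integral>x. f x \<partial>\<Phi> \<omega>)\<^sup>2)" (is ?A)
    and "integrable (\<alpha> \<Otimes>\<^sub>M lborel) (\<lambda>(u, x). f x * f (x + u))" (is ?B)
    and "(\<integral>\<omega>. (\<integral>x. f x \<partial>\<Phi> \<omega>)\<^sup>2 \<partial>M) = (\<integral>(u, x). f x * f (x + u) \<partial>(\<alpha> \<Otimes>\<^sub>M lborel))" (is ?C)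
proof -
  have [measurable]: "f \<in> borel_measurable borel" and i: "integrable lborel f"
    using f by (simp_all add: admissible_def)
  define p n where "p = (\<lambda>x. max 0 (f x))" and "n = (\<lambda>x. max 0 (- f x))"
  have [measurable]: "p \<in> borel_measurable borel" "n \<in> borel_measurable borel" unfolding p_def n_def
      by auto
  have p: "admissible p" "\<And>x. 0 \<le> p x" and n: "admissible n" "\<And>x. 0 \<le> n x"
    by (auto simp: p_def n_def intro!: admissible_mono[OF f])
  have fpn: "f x = p x - n x" for x by (simp add: p_def n_def)
  note pp = cross_moment[OF p p] and pn = cross_moment[OF p n] and np = cross_moment[OF n p] and nn
      = cross_moment[OF n n]
  let ?P = "\<lambda>\<omega>. \<integral>x. p x \<partial>\<Phi> \<omega>" and ?N = "\<lambda>\<omega>. \<integral>x. n x \<partial>\<Phi> \<omega>"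
  have sq: "AE \<omega> in M. (\<integral>x. f x \<partial>\<Phi> \<omega>)\<^sup>2 = ?P \<omega> * ?P \<omega> - ?P \<omega> * ?N \<omega> - ?N \<omega> * ?P \<omega> + ?N \<omega> * ?N \<omega>"
    using AE_integral_split[OF i \<open>f \<in> borel_measurable borel\<close>] unfolding p_def n_def
  proof eventually_elim
    case (elim \<omega>)
    show ?case unfolding elim by (simp add: power2_eq_square algebra_simps)
  qed
  have int: "integrable M (\<lambda>\<omega>. ?P \<omega> * ?P \<omega> - ?P \<omega> * ?N \<omega> - ?N \<omega> * ?P \<omega> + ?N \<omega> * ?N \<omega>)"
    using pp(1) pn(1) np(1) nn(1) by simp
  show ?A
    by (rule integrable_cong_AE_imp[OF int]) (use sq in \<open>auto elim: eventually_mono\<close>)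
  have ff: "(\<lambda>(u, x). f x * f (x + u)) = (\<lambda>w. (\<lambda>(u, x). p x * p (x + u)) w - (\<lambda>(u, x). p x * n (x +
      u)) w
      - (\<lambda>(u, x). n x * p (x + u)) w + (\<lambda>(u, x). n x * n (x + u)) w)"
    by (auto simp: fpn algebra_simps)
  show ?B
    unfolding ff using pp(2) pn(2) np(2) nn(2) by (intro Bochner_Integration.integrable_add
        Bochner_Integration.integrable_diff)
  have lin: "(\<integral>w. a w - b w - c w + d w \<partial>N) = (\<integral>w. a w \<partial>N) - (\<integral>w. b w \<partial>N) - (\<integral>w. c w \<partial>N) + (\<integral>w. d w \<partial>N)"
    if "integrable N a" "integrable N b" "integrable N c" "integrable N d" for N and a b c d ::
        "(real ^ 'd) \<times> (real ^ 'd) \<Rightarrow> real"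
    using that by simp
  have "(\<integral>\<omega>. (\<integral>x. f x \<partial>\<Phi> \<omega>)\<^sup>2 \<partial>M) = (\<integral>\<omega>. ?P \<omega> * ?P \<omega> - ?P \<omega> * ?N \<omega> - ?N \<omega> * ?P \<omega> + ?N \<omega> * ?N \<omega> \<partial>M)"
    by (rule integral_cong_AE) (use sq in auto)
  also have "\<dots> = (\<integral>w. (\<lambda>(u, x). p x * p (x + u)) w \<partial>(\<alpha> \<Otimes>\<^sub>M lborel)) - (\<integral>w. (\<lambda>(u, x). p x * n (x +
      u)) w \<partial>(\<alpha> \<Otimes>\<^sub>M lborel))
     - (\<integral>w. (\<lambda>(u, x). n x * p (x + u)) w \<partial>(\<alpha> \<Otimes>\<^sub>M lborel)) + (\<integral>w. (\<lambda>(u, x). n x * n (x + u)) w \<partial>(\<alpha>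
         \<Otimes>\<^sub>M lborel))"
    unfolding pp(3)[symmetric] pn(3)[symmetric] np(3)[symmetric] nn(3)[symmetric]
    using pp(1) pn(1) np(1) nn(1) by (simp add: mult.commute)
  also have "\<dots> = (\<integral>w. (\<lambda>(u, x). f x * f (x + u)) w \<partial>(\<alpha> \<Otimes>\<^sub>M lborel))"
    unfolding ff by (rule lin[symmetric, OF pp(2) pn(2) np(2) nn(2)])
  finally show ?C .
qed

text \<open>Bridge between probability and analysis: expanding the square of \<open>Y\<close> leaves
  the integral of the autocorrelation against the covariance measure. The nonnegativity of
  \<open>L\<close> on autocorrelations is the positive definiteness of the covariance measure and
  the source of the positivity in the frequency domain.\<close>

lemma V_eq:
  assumes f: "admissible f"
  shows "integrable \<alpha> (autocorrelation f)" (is ?A)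
    and "integrable M (\<lambda>\<omega>. (Y f \<omega>)\<^sup>2)" (is ?B)
    and "(\<integral>\<omega>. (Y f \<omega>)\<^sup>2 \<partial>M) = L (autocorrelation f)" (is ?C)
    and "V f = ennreal (L (autocorrelation f))" (is ?D)
    and "0 \<le> L (autocorrelation f)" (is ?E)
proof -
  have [measurable]: "f \<in> borel_measurable borel" and i: "integrable lborel f"
    using f by (auto simp: admissible_def)
  interpret AL: pair_sigma_finite \<alpha> "lborel :: (real ^ 'd) measure" ..
  note sm = second_moment[OF f]
  show ?A
    unfolding autocorrelation_def using AL.integrable_fst[OF sm(2)] by simp
  let ?I = "\<lambda>\<omega>. \<integral>x. f x \<partial>\<Phi> \<omega>" and ?c = "\<gamma> * (\<integral>x. f x \<partial>lborel)"
  have Y2: "(Y f \<omega>)\<^sup>2 = (?I \<omega>)\<^sup>2 - 2 * ?c * ?I \<omega> + ?c\<^sup>2" for \<omega>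
    by (simp add: Y_def power2_eq_square algebra_simps)
  show B: ?B
    unfolding Y2 using sm(1) mean[OF i] by simp
  have "(\<integral>\<omega>. (Y f \<omega>)\<^sup>2 \<partial>M) = (\<integral>\<omega>. (?I \<omega>)\<^sup>2 \<partial>M) - 2 * ?c * ?c + ?c\<^sup>2"
    unfolding Y2 using sm(1) mean[OF i] by (simp add: prob_space)
  also have "(\<integral>\<omega>. (?I \<omega>)\<^sup>2 \<partial>M) = (\<integral>u. autocorrelation f u \<partial>\<alpha>)"
    unfolding autocorrelation_def sm(3) using AL.integral_fst[OF sm(2)] by simp
  finally show C: ?C
    using autocorrelation_lborel[OF i] by (simp add: L_def power2_eq_square algebra_simps)
  show ?D unfolding V_def C[symmetric] by (rule nn_integral_eq_integral[OF B]) simp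
  show ?E unfolding C[symmetric] by simp
qed

lemma variance_indicator:
  assumes B: "bounded B" and [measurable]: "B \<in> sets borel"
  shows "variance (\<lambda>\<omega>. measure (\<Phi> \<omega>) B) = enn2real (V (indicator B))"
proof -
  note adm = admissible_indicator[OF assms]
  then have i: "integrable lborel (indicator B :: _ \<Rightarrow> real)" by (simp add: admissible_def)
  have m: "measure (\<Phi> \<omega>) B = (\<integral>x. indicator B x \<partial>\<Phi> \<omega>)" if "\<omega> \<in> space M" for \<omega>
    using that by (simp add: sets_Phi)
  have "expectation (\<lambda>\<omega>. measure (\<Phi> \<omega>) B) = (\<integral>\<omega>. (\<integral>x. indicator B x \<partial>\<Phi> \<omega>) \<partial>M)"
    by (intro Bochner_Integration.integral_cong m refl)
  then have e: "expectation (\<lambda>\<omega>. measure (\<Phi> \<omega>) B) = \<gamma> * (\<integral>x. indicator B x \<partial>lborel)"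
    using mean(2)[OF i borel_measurable_indicator[OF assms(2)]] by (rule trans)
  have "variance (\<lambda>\<omega>. measure (\<Phi> \<omega>) B) = (\<integral>\<omega>. (Y (indicator B) \<omega>)\<^sup>2 \<partial>M)"
    unfolding e Y_def by (intro Bochner_Integration.integral_cong refl) (simp only: m)
  then show ?thesis using V_eq(3-5)[OF adm] by (simp only: enn2real_ennreal)
qed

end

section \<open>Gaussian smoothing and positivity in the frequency domain\<close>

lemma integrable_product:
  fixes f :: "'a \<Rightarrow> real" and g :: "'b \<Rightarrow> real"
  assumes B: "sigma_finite_measure B" and f: "integrable A f" and g: "integrable B g"
  shows "integrable (A \<Otimes>\<^sub>M B) (\<lambda>(x, y). f x * g y)"
proof -
  note [measurable] = borel_measurable_integrable[OF f] borel_measurable_integrable[OF g]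
  have "(\<integral>\<^sup>+x. \<integral>\<^sup>+y. ennreal \<bar>f x * g y\<bar> \<partial>B \<partial>A) = (\<integral>\<^sup>+x. ennreal \<bar>f x\<bar> \<partial>A) * (\<integral>\<^sup>+y. ennreal \<bar>g y\<bar> \<partial>B)"
    by (simp add: abs_mult ennreal_mult nn_integral_cmult nn_integral_multc)
  also have "\<dots> < \<infinity>" using f g by (auto simp: integrable_iff_bounded ennreal_mult_less_top)
  finally show ?thesis by (intro iterated_integrable B) auto
qed

lemma integral_lborel_affine:
  fixes t :: "'a :: euclidean_space" and f :: "'a \<Rightarrow> real"
  assumes c: "c \<noteq> 0" and [measurable]: "f \<in> borel_measurable borel"
  shows "(\<integral>x. f x \<partial>lborel) = \<bar>c\<bar> ^ DIM('a) * (\<integral>x. f (t + c *\<^sub>R x) \<partial>lborel)"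
  by (subst lborel_affine[OF c, of t]) (simp add: integral_density integral_distr)

lemma integrable_lborel_affine:
  fixes t :: "'a :: euclidean_space" and f :: "'a \<Rightarrow> real"
  assumes c: "c \<noteq> 0" and f: "integrable lborel f"
  shows "integrable lborel (\<lambda>x. f (t + c *\<^sub>R x))"
proof (rule integrableI_bounded)
  have [measurable]: "f \<in> borel_measurable borel" using f by simp
  show "(\<lambda>x. f (t + c *\<^sub>R x)) \<in> borel_measurable lborel" by simp
  have "ennreal (\<bar>c\<bar> ^ DIM('a)) * (\<integral>\<^sup>+x. ennreal (norm (f (t + c *\<^sub>R x))) \<partial>lborel) < \<infinity>"
    using f nn_integral_lborel_affine[OF c, of "\<lambda>x. ennreal (norm (f x))" t] by (simp add:
        integrable_iff_bounded)
  then show "(\<integral>\<^sup>+x. ennreal (norm (f (t + c *\<^sub>R x))) \<partial>lborel) < \<infinity>"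
    using c by (auto simp: ennreal_mult_less_top)
qed

text \<open>\<open>lborel\<close> is the image of the product measure over \<open>Basis\<close>,
  which reduces transforms of product functions to one dimension.\<close>

lemma lborel_integral_prod:
  fixes f :: "'a :: euclidean_space \<Rightarrow> real \<Rightarrow> complex"
  assumes int: "\<And>b. b \<in> Basis \<Longrightarrow> integrable lborel (f b)"
  shows "integrable lborel (\<lambda>x. \<Prod>b\<in>Basis. f b (x \<bullet> b))"
    and "(\<integral>x. (\<Prod>b\<in>Basis. f b (x \<bullet> b)) \<partial>lborel) = (\<Prod>b\<in>Basis. \<integral>t. f b t \<partial>lborel)"
proof -
  interpret product_sigma_finite "\<lambda>_ :: 'a. lborel :: real measure" ..
  have [measurable]: "f b \<in> borel_measurable borel" if "b \<in> Basis" for b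
    using int[OF that] by simp
  have m: "(\<lambda>x. \<Prod>b\<in>Basis. f b (x \<bullet> b)) \<in> borel_measurable borel" by measurable
  have s: "(\<lambda>f. \<Sum>b\<in>Basis. f b *\<^sub>R b) \<in> measurable (\<Pi>\<^sub>M b\<in>Basis. lborel) (borel :: 'a measure)"
    by measurable
  have e: "(\<Prod>b\<in>Basis. f b ((\<Sum>b\<in>Basis. g b *\<^sub>R b) \<bullet> b)) = (\<Prod>b\<in>Basis. f b (g b))" for g
    by (intro prod.cong) (simp_all add: inner_sum_left inner_Basis if_distrib cong: if_cong)
  show "integrable lborel (\<lambda>x. \<Prod>b\<in>Basis. f b (x \<bullet> b))"
    by (subst lborel_eq, subst integrable_distr_eq[OF s m], subst e, rule product_integrable_prod)
        (auto intro: int)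
  show "(\<integral>x. (\<Prod>b\<in>Basis. f b (x \<bullet> b)) \<partial>lborel) = (\<Prod>b\<in>Basis. \<integral>t. f b t \<partial>lborel)"
    by (subst lborel_eq, subst integral_distr[OF s m], subst e, rule product_integral_prod) (auto
        intro: int)
qed

text \<open>Normalised to have the value 1 at 0 and not mass 1: as a window it tends to 1 when its
  argument is scaled to 0, and it is its own Fourier transform up to the factor
  \<open>gauss_mass\<close>.\<close>

definition gauss :: "real ^ 'd \<Rightarrow> real" where
  "gauss x = exp (- (x \<bullet> x) / 2)"

lemma gauss_measurable [measurable]: "gauss \<in> borel_measurable borel"
  unfolding gauss_def by measurable

lemma gauss_pos: "0 < gauss x" and gauss_le_1: "gauss x \<le> 1" and gauss_minus [simp]: "gauss (- x) =
    gauss x"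
  by (auto simp: gauss_def)

text \<open>Up to normalisation this is the characteristic function of the standard normal
  law.\<close>

lemma gauss_char_1d:
  fixes \<kappa> :: real
  shows "integrable lborel (\<lambda>t. exp (complex_of_real (- (t\<^sup>2) / 2) + \<i> * complex_of_real (\<kappa> * t)))"
      (is ?A)
    and "(\<integral>t. exp (complex_of_real (- (t\<^sup>2) / 2) + \<i> * complex_of_real (\<kappa> * t)) \<partial>lborel) =
      complex_of_real (sqrt (2 * pi) * exp (- (\<kappa>\<^sup>2) / 2))" (is ?B)
proof -
  have eq: "exp (complex_of_real (- (t\<^sup>2) / 2) + \<i> * complex_of_real (\<kappa> * t)) =
      complex_of_real (sqrt (2 * pi)) * (std_normal_density t *\<^sub>R iexp (\<kappa> * t))" for t
  proof -
    have "exp (complex_of_real (- (t\<^sup>2) / 2) + \<i> * complex_of_real (\<kappa> * t)) = complex_of_real (exp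
        (- (t\<^sup>2) / 2)) * iexp (\<kappa> * t)"
      unfolding exp_add exp_of_real ..
    moreover have "exp (- (t\<^sup>2) / 2) = sqrt (2 * pi) * std_normal_density t" by (simp add:
        std_normal_density_def)
    ultimately show ?thesis by (simp add: scaleR_conv_of_real del: of_real_exp)
  qed
  have i: "integrable lborel (\<lambda>t. std_normal_density t *\<^sub>R iexp (\<kappa> * t))"
  proof (rule Bochner_Integration.integrable_bound)
    show "integrable lborel std_normal_density"
      using integrable_normal_density[of 1 0] by simp
  qed (auto simp: norm_mult)
  show ?A unfolding eq by (rule integrable_mult_right) (use i in simp)
  have "(\<integral>t. std_normal_density t *\<^sub>R iexp (\<kappa> * t) \<partial>lborel) = char std_normal_distribution \<kappa>"
    unfolding char_def by (subst integral_density) auto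
  also have "\<dots> = complex_of_real (exp (- (\<kappa>\<^sup>2) / 2))"
    by (simp add: char_std_normal_distribution)
  finally show ?B unfolding eq integral_mult_right_zero by simp
qed

lemma gauss_char_complex:
  fixes k :: "real ^ 'd"
  shows "integrable lborel (\<lambda>x. complex_of_real (gauss x) * iexp (k \<bullet> x))" (is ?A)
    and "(\<integral>x. complex_of_real (gauss x) * iexp (k \<bullet> x) \<partial>lborel) = complex_of_real (sqrt (2 * pi) ^
        CARD('d) * gauss k)" (is ?B)
proof -
  let ?f = "\<lambda>b t. exp (complex_of_real (- (t\<^sup>2) / 2) + \<i> * complex_of_real ((k \<bullet> b) * t))"
  have eq: "complex_of_real (gauss x) * iexp (k \<bullet> x) = (\<Prod>b\<in>Basis. ?f b (x \<bullet> b))" for x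
  proof -
    have "complex_of_real (gauss x) * iexp (k \<bullet> x) = exp (complex_of_real (- (x \<bullet> x) / 2) + \<i> *
        complex_of_real (k \<bullet> x))"
      unfolding gauss_def exp_add exp_of_real ..
    also have "complex_of_real (- (x \<bullet> x) / 2) + \<i> * complex_of_real (k \<bullet> x) =
       (\<Sum>b\<in>Basis. complex_of_real (- ((x \<bullet> b)\<^sup>2) / 2) + \<i> * complex_of_real ((k \<bullet> b) * (x \<bullet> b)))"
      by (subst euclidean_inner[of x x], subst euclidean_inner[of k x])
         (simp add: sum.distrib sum_distrib_left sum_divide_distrib power2_eq_square sum_negf
             sum_subtractf)
    finally show ?thesis by (simp add: exp_sum)
  qed
  show ?A unfolding eq by (rule lborel_integral_prod(1)) (rule gauss_char_1d)
  have "(\<integral>x. complex_of_real (gauss x) * iexp (k \<bullet> x) \<partial>lborel) = (\<Prod>b\<in>Basis. complex_of_real (sqrt (2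
      * pi) * exp (- ((k \<bullet> b)\<^sup>2) / 2)))"
    unfolding eq by (subst lborel_integral_prod(2)) (simp_all only: gauss_char_1d)
  also have "\<dots> = complex_of_real (sqrt (2 * pi) ^ CARD('d) * exp (\<Sum>b\<in>Basis. - ((k \<bullet> b)\<^sup>2) / 2))"
    by (simp add: prod.distrib exp_sum flip: of_real_prod)
  also have "(\<Sum>b\<in>Basis. - ((k \<bullet> b)\<^sup>2) / 2) = - (k \<bullet> k) / 2"
    by (subst euclidean_inner[of k k]) (simp add: power2_eq_square sum_divide_distrib sum_negf)
  finally show ?B by (simp add: gauss_def)
qed

text \<open>The total mass of \<open>gauss\<close>; only the dimension enters, passed as a type
  argument.\<close>

definition gauss_mass :: "'d itself \<Rightarrow> real" where
  "gauss_mass _ = sqrt (2 * pi) ^ CARD('d)"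

lemma gauss_mass_pos: "0 < gauss_mass TYPE('d)"
  by (simp add: gauss_mass_def)

lemma integrable_gauss: "integrable lborel (gauss :: real ^ 'd \<Rightarrow> real)"
  using integrable_Re[OF gauss_char_complex(1)[of "0 :: real ^ 'd"]] by simp

lemma integral_gauss_cos:
  fixes k :: "real ^ 'd"
  shows "(\<integral>x. gauss x * cos (k \<bullet> x) \<partial>lborel) = gauss_mass TYPE('d) * gauss k"
proof -
  have "(\<integral>x. gauss x * cos (k \<bullet> x) \<partial>lborel) = (\<integral>x. Re (complex_of_real (gauss x) * iexp (k \<bullet> x))
      \<partial>lborel)"
    by (simp add: cis_conv_exp[symmetric])
  also have "\<dots> = Re (\<integral>x. complex_of_real (gauss x) * iexp (k \<bullet> x) \<partial>lborel)"
    by (rule integral_Re[OF gauss_char_complex(1)])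
  finally show ?thesis by (simp add: gauss_char_complex gauss_mass_def)
qed

lemma integral_gauss: "(\<integral>x. gauss (x :: real ^ 'd) \<partial>lborel) = gauss_mass TYPE('d)"
  using integral_gauss_cos[of "0 :: real ^ 'd"] by (simp add: gauss_def)

lemma integrable_gauss_scale:
  assumes "s \<noteq> 0" shows "integrable lborel (\<lambda>x. gauss (s *\<^sub>R x :: real ^ 'd))"
  using integrable_lborel_affine[OF assms integrable_gauss, of 0] by simp

lemma integral_gauss_cos_scale:
  fixes v :: "real ^ 'd"
  assumes s: "s > 0"
  shows "(\<integral>k. gauss (s *\<^sub>R k) * cos (k \<bullet> v) \<partial>lborel) = gauss_mass TYPE('d) / s ^ CARD('d) * gauss
      ((1 / s) *\<^sub>R v)"
proof -
  have "(\<integral>k. gauss (s *\<^sub>R k) * cos (k \<bullet> v) \<partial>lborel) = \<bar>1 / s\<bar> ^ CARD('d) * (\<integral>x. gauss x * cos (((1 /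
      s) *\<^sub>R v) \<bullet> x) \<partial>lborel)"
    using s by (subst integral_lborel_affine[of "1 / s" _ 0]) (auto simp: inner_commute)
  then show ?thesis using s unfolding integral_gauss_cos by (simp add: power_one_over field_simps)
qed

text \<open>Fourier inversion with Gaussian summation. The transform of \<open>F\<close> need not be
  integrable; damped by \<open>gauss (s *\<^sub>R k)\<close>, its inverse transform is
  \<open>F\<close> convolved with a Gaussian of width \<open>s\<close>. Evenness lets cosines alone
  suffice.\<close>

lemma gauss_inversion:
  fixes F :: "real ^ 'd \<Rightarrow> real"
  assumes s: "s > 0" and F: "integrable lborel F" and even: "\<And>v. F (- v) = F v"
  shows "(\<integral>k. gauss (s *\<^sub>R k) * cos (k \<bullet> u) * (\<integral>v. F v * cos (k \<bullet> v) \<partial>lborel) \<partial>lborel) =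
    gauss_mass TYPE('d) * (\<integral>w. F (u + s *\<^sub>R w) * gauss w \<partial>lborel)"
proof -
  let ?c = "gauss_mass TYPE('d)"
  have [measurable]: "F \<in> borel_measurable borel" using F by simp
  have g: "integrable lborel (\<lambda>x. gauss (s *\<^sub>R x :: real ^ 'd))" using s by (intro
      integrable_gauss_scale) simp
  have gc: "integrable lborel (\<lambda>k. gauss (s *\<^sub>R k) * cos (k \<bullet> v))" for v :: "real ^ 'd"
    by (rule Bochner_Integration.integrable_bound[OF g])
       (auto simp: abs_mult gauss_pos less_imp_le mult_left_le)
  have "integrable (lborel \<Otimes>\<^sub>M lborel) (\<lambda>(k, v). gauss (s *\<^sub>R k) * cos (k \<bullet> u) * (F v * cos (k \<bullet> v)))"
  proof (rule Bochner_Integration.integrable_bound[OF integrable_product[OF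
      lborel.sigma_finite_measure_axioms g F]])
    show "AE x in lborel \<Otimes>\<^sub>M lborel. norm (case x of (k, v) \<Rightarrow> gauss (s *\<^sub>R k) * cos (k \<bullet> u) * (F v *
        cos (k \<bullet> v))) \<le> norm (case x of (k, v) \<Rightarrow> gauss (s *\<^sub>R k) * F v)"
    proof (rule AE_I2, clarsimp simp: abs_mult)
      fix k v
      have "\<bar>gauss (s *\<^sub>R k)\<bar> * \<bar>cos (k \<bullet> u)\<bar> * (\<bar>F v\<bar> * \<bar>cos (k \<bullet> v)\<bar>) \<le> \<bar>gauss (s *\<^sub>R k)\<bar> * 1 *
          (\<bar>F v\<bar> * 1)"
        by (intro mult_mono) auto
      then show "\<bar>gauss (s *\<^sub>R k)\<bar> * \<bar>cos (k \<bullet> u)\<bar> * (\<bar>F v\<bar> * \<bar>cos (k \<bullet> v)\<bar>) \<le> \<bar>gauss (s *\<^sub>R k)\<bar> *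
          \<bar>F v\<bar>" by simp
    qed
  qed measurable
  note fub = lborel_pair.Fubini_integral[OF this]
  let ?H = "\<lambda>v. ?c / s ^ CARD('d) * gauss ((1 / s) *\<^sub>R v)"
  have iH: "integrable lborel (\<lambda>v. F v * ?H (u - v))" "integrable lborel (\<lambda>v. F v * ?H (u + v))"
    by (rule Bochner_Integration.integrable_bound[of _ "\<lambda>v. (?c / s ^ CARD('d)) * F v"],
        use F s gauss_mass_pos[where 'd='d] in \<open>auto simp: abs_mult gauss_pos less_imp_le gauss_le_1
            mult_left_le mult_ac intro!: divide_right_mono\<close>)+
  have "(\<integral>k. gauss (s *\<^sub>R k) * cos (k \<bullet> u) * (\<integral>v. F v * cos (k \<bullet> v) \<partial>lborel) \<partial>lborel) =
      (\<integral>k. \<integral>v. gauss (s *\<^sub>R k) * cos (k \<bullet> u) * (F v * cos (k \<bullet> v)) \<partial>lborel \<partial>lborel)"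
    by simp
  also have "\<dots> = (\<integral>v. \<integral>k. gauss (s *\<^sub>R k) * cos (k \<bullet> u) * (F v * cos (k \<bullet> v)) \<partial>lborel \<partial>lborel)"
    using fub by simp
  also have "\<dots> = (\<integral>v. (F v * ?H (u - v) + F v * ?H (u + v)) / 2 \<partial>lborel)"
  proof (intro Bochner_Integration.integral_cong refl)
    fix v
    \<comment> \<open>Product-to-sum formula; each of the two terms is the transform of a scaled
      Gaussian.\<close>
    have e: "gauss (s *\<^sub>R k) * cos (k \<bullet> u) * (F v * cos (k \<bullet> v)) =
      F v / 2 * (gauss (s *\<^sub>R k) * cos (k \<bullet> (u - v)) + gauss (s *\<^sub>R k) * cos (k \<bullet> (u + v)))" for k
      by (simp add: inner_diff_right inner_add_right cos_diff cos_add algebra_simps)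
    have "(\<integral>k. gauss (s *\<^sub>R k) * cos (k \<bullet> u) * (F v * cos (k \<bullet> v)) \<partial>lborel) =
      F v / 2 * (\<integral>k. gauss (s *\<^sub>R k) * cos (k \<bullet> (u - v)) + gauss (s *\<^sub>R k) * cos (k \<bullet> (u + v)) \<partial>lborel)"
      unfolding e by (rule integral_mult_right_zero)
    also have "\<dots> = F v / 2 * (?H (u - v) + ?H (u + v))"
      by (subst Bochner_Integration.integral_add[OF gc gc]) (simp only: integral_gauss_cos_scale[OF s])
    finally show "(\<integral>k. gauss (s *\<^sub>R k) * cos (k \<bullet> u) * (F v * cos (k \<bullet> v)) \<partial>lborel) = (F v * ?H (u -
        v) + F v * ?H (u + v)) / 2"
      by (simp add: field_simps)
  qed
  also have "\<dots> = ((\<integral>v. F v * ?H (u - v) \<partial>lborel) + (\<integral>v. F v * ?H (u + v) \<partial>lborel)) / 2"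
    by (simp only: integral_divide_zero Bochner_Integration.integral_add[OF iH])
  also have "(\<integral>v. F v * ?H (u + v) \<partial>lborel) = (\<integral>v. F v * ?H (u - v) \<partial>lborel)"
    using integral_lborel_shift(5)[of "\<lambda>v. F v * ?H (u + v)", symmetric] by (simp add: even)
  \<comment> \<open>Substituting v = u + s w, the Jacobian s^d cancels the normalisation of
    \<open>?H\<close>.\<close>
  also have "(\<integral>v. F v * ?H (u - v) \<partial>lborel) = \<bar>s\<bar> ^ CARD('d) * (\<integral>w. F (u + s *\<^sub>R w) * ?H (u - (u + s
      *\<^sub>R w)) \<partial>lborel)"
    using s by (subst integral_lborel_affine[of s _ u]) auto
  also have "\<dots> = ?c * (\<integral>w. F (u + s *\<^sub>R w) * gauss w \<partial>lborel)"
  proof -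
    have e: "F (u + s *\<^sub>R w) * ?H (u - (u + s *\<^sub>R w)) = ?c / s ^ CARD('d) * (F (u + s *\<^sub>R w) * gauss
        w)" for w
      using s by simp
    show ?thesis unfolding e integral_mult_right_zero using s by simp
  qed
  finally show ?thesis by simp
qed

text \<open>Two cut-offs are at work: the one in \<open>u\<close> makes the transform of a possibly
  infinite measure exist, the one in \<open>k\<close> makes the outer integral converge, so that
  Fubini and \<open>gauss_inversion\<close> apply. \<open>\<rho>\<close> is left general since both
  parts of the covariance measure are inserted.\<close>

lemma spectral_identity:
  fixes F :: "real ^ 'd \<Rightarrow> real" and \<rho> :: "(real ^ 'd) measure"
  assumes \<rho>: "sigma_finite_measure \<rho>" "sets \<rho> = sets borel" "integrable \<rho> (\<lambda>u. gauss (s *\<^sub>R u))"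
    and s: "s > 0" and F: "integrable lborel F" and even: "\<And>v. F (- v) = F v"
  shows "integrable lborel (\<lambda>k. gauss (s *\<^sub>R k) * (\<integral>u. cos (k \<bullet> u) * gauss (s *\<^sub>R u) \<partial>\<rho>) * (\<integral>v. F v
      * cos (k \<bullet> v) \<partial>lborel))" (is ?A)
    and "(\<integral>k. gauss (s *\<^sub>R k) * (\<integral>u. cos (k \<bullet> u) * gauss (s *\<^sub>R u) \<partial>\<rho>) * (\<integral>v. F v * cos (k \<bullet> v)
        \<partial>lborel) \<partial>lborel) =
     gauss_mass TYPE('d) * (\<integral>u. gauss (s *\<^sub>R u) * (\<integral>w. F (u + s *\<^sub>R w) * gauss w \<partial>lborel) \<partial>\<rho>)" (is ?B)
proof -
  interpret R: sigma_finite_measure \<rho> by fact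
  interpret P: pair_sigma_finite "lborel :: (real ^ 'd) measure" \<rho> ..
  note [measurable_cong] = \<rho>(2)
  have [measurable]: "F \<in> borel_measurable borel" using F by simp
  let ?F = "\<lambda>k. \<integral>v. F v * cos (k \<bullet> v) \<partial>lborel"
  define C where "C = (\<integral>v. \<bar>F v\<bar> \<partial>lborel)"
  have C0: "0 \<le> C" by (simp add: C_def)
  have FC: "\<bar>?F k\<bar> \<le> C" for k
  proof -
    have i: "integrable lborel (\<lambda>v. F v * cos (k \<bullet> v))"
      by (rule Bochner_Integration.integrable_bound[OF F]) (auto simp: abs_mult mult_left_le)
    have "\<bar>?F k\<bar> \<le> (\<integral>v. \<bar>F v * cos (k \<bullet> v)\<bar> \<partial>lborel)" by (rule integral_abs_bound)
    also have "\<dots> \<le> C" unfolding C_def using F i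
      by (intro integral_mono integrable_abs i) (auto simp: abs_mult mult_left_le)
    finally show ?thesis .
  qed
  have g: "integrable lborel (\<lambda>x. C * gauss (s *\<^sub>R x :: real ^ 'd))" using s by (intro
      integrable_mult_right integrable_gauss_scale) simp
  have i: "integrable (lborel \<Otimes>\<^sub>M \<rho>) (\<lambda>(k, u). gauss (s *\<^sub>R k) * (cos (k \<bullet> u) * gauss (s *\<^sub>R u)) *
      ?F k)"
  proof (rule Bochner_Integration.integrable_bound[OF integrable_product[OF \<rho>(1) g \<rho>(3)]])
    show "AE x in lborel \<Otimes>\<^sub>M \<rho>. norm (case x of (k, u) \<Rightarrow> gauss (s *\<^sub>R k) * (cos (k \<bullet> u) * gauss (s
        *\<^sub>R u)) * ?F k) \<le> norm (case x of (k, u) \<Rightarrow> C * gauss (s *\<^sub>R k) * gauss (s *\<^sub>R u))"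
    proof (rule AE_I2, clarsimp simp: abs_mult)
      fix k u :: "real ^ 'd"
      have "\<bar>gauss (s *\<^sub>R k)\<bar> * (\<bar>cos (k \<bullet> u)\<bar> * \<bar>gauss (s *\<^sub>R u)\<bar>) * \<bar>?F k\<bar> \<le> \<bar>gauss (s *\<^sub>R k)\<bar> *
          (1 * \<bar>gauss (s *\<^sub>R u)\<bar>) * C"
        using FC C0 by (intro mult_mono) auto
      then show "\<bar>gauss (s *\<^sub>R k)\<bar> * (\<bar>cos (k \<bullet> u)\<bar> * \<bar>gauss (s *\<^sub>R u)\<bar>) * \<bar>?F k\<bar> \<le> \<bar>C\<bar> * \<bar>gauss (s
          *\<^sub>R k)\<bar> * \<bar>gauss (s *\<^sub>R u)\<bar>"
        using C0 by (simp add: mult_ac)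
    qed
  qed measurable
  have eq: "(\<integral>u. gauss (s *\<^sub>R k) * (cos (k \<bullet> u) * gauss (s *\<^sub>R u)) * ?F k \<partial>\<rho>) =
      gauss (s *\<^sub>R k) * (\<integral>u. cos (k \<bullet> u) * gauss (s *\<^sub>R u) \<partial>\<rho>) * ?F k" for k
    by simp
  show ?A using P.integrable_fst[OF i] by (simp only: eq)
  have "(\<integral>k. gauss (s *\<^sub>R k) * (\<integral>u. cos (k \<bullet> u) * gauss (s *\<^sub>R u) \<partial>\<rho>) * ?F k \<partial>lborel) =
    (\<integral>u. \<integral>k. gauss (s *\<^sub>R k) * (cos (k \<bullet> u) * gauss (s *\<^sub>R u)) * ?F k \<partial>lborel \<partial>\<rho>)"
    using P.Fubini_integral[OF i] by (simp only: eq)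
  also have "\<dots> = (\<integral>u. gauss (s *\<^sub>R u) * (\<integral>k. gauss (s *\<^sub>R k) * cos (k \<bullet> u) * ?F k \<partial>lborel) \<partial>\<rho>)"
  proof (intro Bochner_Integration.integral_cong refl)
    fix u :: "real ^ 'd"
    have "gauss (s *\<^sub>R k) * (cos (k \<bullet> u) * gauss (s *\<^sub>R u)) * ?F k = gauss (s *\<^sub>R u) * (gauss (s *\<^sub>R
        k) * cos (k \<bullet> u) * ?F k)" for k
      by (simp only: mult_ac)
    then show "(\<integral>k. gauss (s *\<^sub>R k) * (cos (k \<bullet> u) * gauss (s *\<^sub>R u)) * ?F k \<partial>lborel) = gauss (s *\<^sub>R
        u) * (\<integral>k. gauss (s *\<^sub>R k) * cos (k \<bullet> u) * ?F k \<partial>lborel)"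
      by (simp only: integral_mult_right_zero)
  qed
  also have "\<dots> = (\<integral>u. gauss_mass TYPE('d) * (gauss (s *\<^sub>R u) * (\<integral>w. F (u + s *\<^sub>R w) * gauss w
      \<partial>lborel)) \<partial>\<rho>)"
    by (simp only: gauss_inversion[OF s F even] mult.left_commute)
  also have "\<dots> = gauss_mass TYPE('d) * (\<integral>u. gauss (s *\<^sub>R u) * (\<integral>w. F (u + s *\<^sub>R w) * gauss w
      \<partial>lborel) \<partial>\<rho>)"
    by (rule integral_mult_right_zero)
  finally show ?B .
qed

section \<open>Gaussian bounds and Gaussian smoothing of compactly supported functions\<close>

lemma gauss_norm: "gauss x = exp (- (norm x)\<^sup>2 / 2)"
  by (simp add: gauss_def power2_norm_eq_inner)

lemma gauss_nonneg [simp]: "0 \<le> gauss x"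
  by (simp add: gauss_def)

text \<open>From |z|^2 \<le> 2 |x|^2 + 2 for |x - z| < 1. It serves to bound a Gaussian by a
  superposition of unit balls weighted with a wider Gaussian.\<close>

lemma gauss_ball_bound:
  fixes x z :: "real ^ 'd"
  assumes "dist x z < 1"
  shows "gauss (t *\<^sub>R x) \<le> exp (t\<^sup>2 / 2) * gauss ((t / sqrt 2) *\<^sub>R z)"
proof -
  have "norm z \<le> norm x + 1"
    using assms norm_triangle_ineq2[of z x] by (simp add: dist_norm norm_minus_commute)
  then have "(norm z)\<^sup>2 \<le> (norm x + 1)\<^sup>2" by (intro power_mono) auto
  also have "\<dots> \<le> 2 * (norm x)\<^sup>2 + 2" using square_sum_le[of 1 "norm x" 1] by simp
  finally have "(norm z)\<^sup>2 \<le> 2 * (norm x)\<^sup>2 + 2" .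
  then have "t\<^sup>2 * (norm z)\<^sup>2 \<le> t\<^sup>2 * (2 * (norm x)\<^sup>2 + 2)" by (intro mult_left_mono) auto
  then have "- (t\<^sup>2 * (norm x)\<^sup>2) / 2 \<le> t\<^sup>2 / 2 + - ((t / sqrt 2)\<^sup>2 * (norm z)\<^sup>2) / 2"
    by (simp add: power_divide algebra_simps)
  then show ?thesis
    unfolding gauss_norm exp_add[symmetric] by (simp add: power_mult_distrib power_divide)
qed

text \<open>Parallelogram identity in the exponent. It isolates the dependence on the lag
  \<open>u\<close>, so the autocorrelation of a Gaussian is Gaussian; the factor sqrt 2 makes its
  scale exactly \<open>s\<close>.\<close>

lemma gauss_translate_product:
  fixes x u :: "real ^ 'd"
  shows "gauss ((sqrt 2 * s) *\<^sub>R x) * gauss ((sqrt 2 * s) *\<^sub>R (x + u)) = gauss (s *\<^sub>R u) * gauss (s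
      *\<^sub>R u + (2 * s) *\<^sub>R x)"
  unfolding gauss_def exp_add[symmetric]
  by (intro arg_cong[where f = exp]) (simp add: inner_add_left inner_add_right inner_commute
      field_simps)

text \<open>If \<open>u + s *\<^sub>R w\<close> stays in a fixed ball and s \<le> 1, a large
  \<open>u\<close> forces a large \<open>w\<close>; half of the Gaussian exponent in
  \<open>w\<close> is therefore spent on decay in \<open>u\<close>, uniformly in
  \<open>s\<close>.\<close>

lemma gauss_smoothing_bound:
  fixes u w :: "real ^ 'd"
  assumes "norm (u + s *\<^sub>R w) \<le> R" "0 < s" "s \<le> 1"
  shows "gauss w \<le> exp (R\<^sup>2 / 4) * gauss ((1 / 2) *\<^sub>R u) * gauss ((1 / sqrt 2) *\<^sub>R w)"
proof -
  have "norm u \<le> norm (u + s *\<^sub>R w) + norm (s *\<^sub>R w)" using norm_triangle_ineq4[of "u + s *\<^sub>R w" "s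
      *\<^sub>R w"] by simp
  also have "norm (s *\<^sub>R w) \<le> norm w" using assms by (simp add: mult_left_le_one_le)
  finally have "norm u \<le> R + norm w" using assms by simp
  then have "(norm u)\<^sup>2 \<le> (R + norm w)\<^sup>2" by (intro power_mono) auto
  also have "\<dots> \<le> 2 * R\<^sup>2 + 2 * (norm w)\<^sup>2" using square_sum_le[of 1 R "norm w"] by simp
  finally have "(norm u)\<^sup>2 \<le> 2 * R\<^sup>2 + 2 * (norm w)\<^sup>2" .
  then have "- (norm w)\<^sup>2 / 2 \<le> R\<^sup>2 / 4 + (- ((norm u)\<^sup>2 / 4) / 2) + (- ((norm w)\<^sup>2 / 2) / 2)" by simp
  then show ?thesis
    unfolding gauss_norm exp_add[symmetric] by (simp add: power_mult_distrib power_divide)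
qed

text \<open>The space side of \<open>spectral_identity\<close>: \<open>F\<close> convolved with a
  Gaussian of width \<open>s\<close> and cut off by a Gaussian of width 1 / s. It recovers
  \<open>F\<close> up to \<open>gauss_mass\<close> as \<open>s\<close> tends to 0.\<close>

definition gauss_smooth :: "(real ^ 'd \<Rightarrow> real) \<Rightarrow> real \<Rightarrow> real ^ 'd \<Rightarrow> real" where
  "gauss_smooth F s u = gauss (s *\<^sub>R u) * (\<integral>w. F (u + s *\<^sub>R w) * gauss w \<partial>lborel)"

lemma gauss_smooth_measurable [measurable]:
  assumes [measurable]: "F \<in> borel_measurable borel"
  shows "gauss_smooth F s \<in> borel_measurable borel"
  unfolding gauss_smooth_def by measurable

text \<open>For an even function this is the whole Fourier transform, as the sine part
  vanishes.\<close>

definition cos_transform :: "(real ^ 'd \<Rightarrow> real) \<Rightarrow> real ^ 'd \<Rightarrow> real" where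
  "cos_transform F k = (\<integral>v. F v * cos (k \<bullet> v) \<partial>lborel)"

lemma cos_transform_measurable [measurable]:
  assumes [measurable]: "F \<in> borel_measurable borel"
  shows "cos_transform F \<in> borel_measurable borel"
  unfolding cos_transform_def by measurable

text \<open>The class of autocorrelations to which the spectral argument is applied. Height
  \<open>c\<close> and radius \<open>R\<close> are recorded explicitly because countable families
  share one \<open>R\<close> while their heights enter a summability condition.\<close>

definition even_bump :: "real \<Rightarrow> real \<Rightarrow> (real ^ 'd \<Rightarrow> real) \<Rightarrow> bool" where
  "even_bump c R F \<longleftrightarrow> 0 \<le> c \<and> continuous_on UNIV F \<and> (\<forall>v. F (- v) = F v) \<and> (\<forall>v. \<bar>F v\<bar> \<le> c * indicator
      (cball 0 R) v)"

lemma even_bumpD: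
  assumes "even_bump c R F"
  shows "F \<in> borel_measurable borel" "F (- v) = F v" "\<bar>F v\<bar> \<le> c * indicator (cball 0 R) v" "\<bar>F v\<bar> \<le>
      c" "0 \<le> c"
    "isCont F v" "integrable lborel F"
proof -
  show m: "F \<in> borel_measurable borel" using assms by (auto simp: even_bump_def intro:
      borel_measurable_continuous_onI)
  show "isCont F v" using assms by (auto simp: even_bump_def continuous_on_eq_continuous_at)
  show b: "\<bar>F v\<bar> \<le> c * indicator (cball 0 R) v" and "F (- v) = F v" for v
    using assms by (auto simp: even_bump_def)
  show c: "0 \<le> c" using assms by (simp add: even_bump_def)
  show "\<bar>F v\<bar> \<le> c" using b[of v] c by (cases "v \<in> cball 0 R") auto
  have "integrable lborel (\<lambda>v. c * indicator (cball 0 R) v :: real)"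
    by (intro integrable_mult_right) (simp add: integrable_indicator_iff
        emeasure_bounded_finite[unfolded infinity_ennreal_def])
  then show "integrable lborel F"
    by (rule Bochner_Integration.integrable_bound) (use m b c in \<open>auto simp: abs_mult\<close>)
qed

definition smoothing_constant :: "('d :: finite) itself \<Rightarrow> real \<Rightarrow> real" where
  "smoothing_constant _ R = exp (R\<^sup>2 / 4) * (\<integral>w. gauss ((1 / sqrt 2) *\<^sub>R w :: real ^ 'd) \<partial>lborel)"

text \<open>The bound does not depend on \<open>s\<close> and is a Gaussian of fixed width, hence a
  majorant integrable against both \<open>\<alpha>\<close> and Lebesgue measure when
  \<open>s\<close> tends to 0.\<close>

lemma gauss_smooth_bound:
  fixes F :: "real ^ 'd \<Rightarrow> real"
  assumes F: "even_bump c R F" and s: "0 < s" "s \<le> 1"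
  shows "\<bar>gauss_smooth F s u\<bar> \<le> c * smoothing_constant TYPE('d) R * gauss ((1 / 2) *\<^sub>R u)"
proof -
  note D = even_bumpD[OF F]
  note [measurable] = D(1)
  let ?b = "\<lambda>w :: real ^ 'd. c * (exp (R\<^sup>2 / 4) * gauss ((1 / 2) *\<^sub>R u)) * gauss ((1 / sqrt 2) *\<^sub>R w)"
  have pt: "\<bar>F (u + s *\<^sub>R w) * gauss w\<bar> \<le> ?b w" for w
  proof (cases "norm (u + s *\<^sub>R w) \<le> R")
    case True
    then have "gauss w \<le> exp (R\<^sup>2 / 4) * gauss ((1 / 2) *\<^sub>R u) * gauss ((1 / sqrt 2) *\<^sub>R w)"
      by (intro gauss_smoothing_bound[OF _ s])
    then have "\<bar>F (u + s *\<^sub>R w)\<bar> * \<bar>gauss w\<bar> \<le> c * (exp (R\<^sup>2 / 4) * gauss ((1 / 2) *\<^sub>R u) * gauss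
        ((1 / sqrt 2) *\<^sub>R w))"
      using D(4,5) gauss_pos[of w] by (intro mult_mono) auto
    then show ?thesis by (simp add: abs_mult mult_ac)
  next
    case False
    then have "F (u + s *\<^sub>R w) = 0" using D(3)[of "u + s *\<^sub>R w"] by simp
    moreover have "0 \<le> ?b w" using D(5) gauss_pos by (intro mult_nonneg_nonneg) (auto simp: less_imp_le)
    ultimately show ?thesis by simp
  qed
  have ib: "integrable lborel ?b" by (intro integrable_mult_right integrable_gauss_scale) simp
  have iF: "integrable lborel (\<lambda>w. F (u + s *\<^sub>R w) * gauss w)"
    by (rule Bochner_Integration.integrable_bound[OF ib])
       (use pt in \<open>auto simp del: abs_mult intro: order_trans[OF _ abs_ge_self]\<close>)
  have "\<bar>\<integral>w. F (u + s *\<^sub>R w) * gauss w \<partial>lborel\<bar> \<le> (\<integral>w. \<bar>F (u + s *\<^sub>R w) * gauss w\<bar> \<partial>lborel)"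
    by (rule integral_abs_bound)
  also have "\<dots> \<le> (\<integral>w. ?b w \<partial>lborel)"
    by (intro integral_mono integrable_abs iF ib pt)
  also have "\<dots> = c * smoothing_constant TYPE('d) R * gauss ((1 / 2) *\<^sub>R u)"
    by (simp only: integral_mult_right_zero) (simp add: smoothing_constant_def mult_ac)
  finally have "\<bar>\<integral>w. F (u + s *\<^sub>R w) * gauss w \<partial>lborel\<bar> \<le> c * smoothing_constant TYPE('d) R * gauss
      ((1 / 2) *\<^sub>R u)" .
  then have "gauss (s *\<^sub>R u) * \<bar>\<integral>w. F (u + s *\<^sub>R w) * gauss w \<partial>lborel\<bar> \<le> 1 * (c * smoothing_constant
      TYPE('d) R * gauss ((1 / 2) *\<^sub>R u))"
    by (intro mult_mono) (auto simp: gauss_le_1)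
  then show ?thesis by (simp add: gauss_smooth_def abs_mult gauss_pos less_imp_le)
qed

lemma gauss_smooth_tendsto:
  fixes F :: "real ^ 'd \<Rightarrow> real"
  assumes F: "even_bump c R F" and S: "S \<longlonglongrightarrow> 0" 
  shows "(\<lambda>n. gauss_smooth F (S n) u) \<longlonglongrightarrow> gauss_mass TYPE('d) * F u"
proof -
  note D = even_bumpD[OF F]
  note [measurable] = D(1)
  have "(\<lambda>n. \<integral>w. F (u + S n *\<^sub>R w) * gauss w \<partial>lborel) \<longlonglongrightarrow> (\<integral>w. F u * gauss (w :: real ^ 'd) \<partial>lborel)"
  proof (rule integral_dominated_convergence[where w = "\<lambda>w :: real ^ 'd. c * gauss w"])
    show "integrable lborel (\<lambda>w :: real ^ 'd. c * gauss w)" by (intro integrable_mult_right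
        integrable_gauss)
    show "AE w in lborel. (\<lambda>n. F (u + S n *\<^sub>R w) * gauss w) \<longlonglongrightarrow> F u * gauss w"
    proof (rule AE_I2)
      fix w :: "real ^ 'd"
      have "(\<lambda>n. u + S n *\<^sub>R w) \<longlonglongrightarrow> u + 0 *\<^sub>R w" by (intro tendsto_intros S)
      then have "(\<lambda>n. F (u + S n *\<^sub>R w)) \<longlonglongrightarrow> F u"
        using D(6) by (intro isCont_tendsto_compose[of u F]) auto
      then show "(\<lambda>n. F (u + S n *\<^sub>R w) * gauss w) \<longlonglongrightarrow> F u * gauss w" by (intro tendsto_intros)
    qed
    show "AE w in lborel. norm (F (u + S n *\<^sub>R w) * gauss w) \<le> c * gauss w" for n
      using D(4) by (auto simp: abs_mult gauss_pos less_imp_le intro!: mult_right_mono)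
  qed measurable
  moreover have "(\<lambda>n. gauss (S n *\<^sub>R u)) \<longlonglongrightarrow> gauss (0 *\<^sub>R u)"
    unfolding gauss_def by (intro tendsto_intros S) simp
  ultimately have "(\<lambda>n. gauss_smooth F (S n) u) \<longlonglongrightarrow> gauss (0 *\<^sub>R u) * (\<integral>w. F u * gauss (w :: real ^
      'd) \<partial>lborel)"
    unfolding gauss_smooth_def by (intro tendsto_mult)
  then show ?thesis by (simp add: integral_gauss) (simp add: gauss_def mult.commute)
qed

section \<open>Positivity of the windowed spectral density and domination of variances\<close>

context stationary_random_measure
begin

lemma L_add:
  assumes "integrable \<alpha> F" "integrable \<alpha> G" "integrable lborel F" "integrable lborel G"
  shows "L (\<lambda>u. F u + G u) = L F + L G"
  using assms by (simp add: L_def algebra_simps)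

lemma L_cmult: "L (\<lambda>u. c * F u) = c * L F"
  by (simp add: L_def algebra_simps)

text \<open>Local square integrability says nothing directly about unbounded supports. The Gaussian
  is dominated by a superposition of unit balls under a finite measure, all balls have the same
  second moment by stationarity, and Cauchy-Schwarz passes the square through the
  superposition.\<close>

lemma admissible_gauss:
  assumes t: "t > 0"
  shows "admissible (\<lambda>x. gauss (t *\<^sub>R x))"
  unfolding admissible_def
proof (intro conjI)
  show "integrable lborel (\<lambda>x. gauss (t *\<^sub>R x :: real ^ 'd))" using t by (intro
      integrable_gauss_scale) simp
  define v where "v = measure lborel (ball (0 :: real ^ 'd) 1)"
  have v: "v > 0" unfolding v_def using content_ball_pos[of 1 "0 :: real ^ 'd"] by simp
  have ev: "emeasure lborel (ball x 1) = ennreal v" for x :: "real ^ 'd"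
  proof -
    have "emeasure lborel (ball x 1) = (\<integral>\<^sup>+z. indicator (ball x 1) z \<partial>lborel)" by simp
    also have "\<dots> = (\<integral>\<^sup>+z. indicator (ball 0 1) (z - x) \<partial>lborel)"
      by (intro nn_integral_cong) (simp add: indicator_def dist_norm norm_minus_commute)
    also have "\<dots> = emeasure lborel (ball (0 :: real ^ 'd) 1)"
      by (subst nn_integral_lborel_shift(4)) auto
    also have "\<dots> = ennreal v"
      unfolding v_def using emeasure_bounded_finite[OF bounded_ball, of "0 :: real ^ 'd" 1] by
          (intro emeasure_eq_ennreal_measure) auto
    finally show ?thesis .
  qed
  \<comment> \<open>Weight of the ball centred at z in the superposition, taken from
    \<open>gauss_ball_bound\<close>.\<close>
  define h where "h = (\<lambda>z :: real ^ 'd. ennreal (exp (t\<^sup>2 / 2) * gauss ((t / sqrt 2) *\<^sub>R z)))"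
  have [measurable]: "h \<in> borel_measurable borel" by (simp add: h_def)
  define \<mu> where "\<mu> = density lborel h"
  have sets_mu [measurable_cong]: "sets \<mu> = sets borel" by (simp add: \<mu>_def)
  have mu1: "(\<integral>\<^sup>+z. 1 \<partial>\<mu>) < \<infinity>"
  proof -
    have "integrable lborel (\<lambda>z :: real ^ 'd. exp (t\<^sup>2 / 2) * gauss ((t / sqrt 2) *\<^sub>R z))"
      using t by (intro integrable_mult_right integrable_gauss_scale) simp
    then have "(\<integral>\<^sup>+z. h z \<partial>lborel) < \<infinity>" unfolding h_def by (subst nn_integral_eq_integral) auto
    moreover have "(\<integral>\<^sup>+z. 1 \<partial>\<mu>) = (\<integral>\<^sup>+z. h z \<partial>lborel)" by (simp add: \<mu>_def emeasure_density)
    ultimately show ?thesis by simp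
  qed
  have sf: "sigma_finite_measure \<mu>"
  proof (rule finite_measure.axioms(1), rule finite_measureI)
    show "emeasure \<mu> (space \<mu>) \<noteq> \<infinity>" using mu1 by simp
  qed
  interpret M\<mu>: pair_sigma_finite M \<mu> using sf by (simp add: pair_sigma_finite_def
      sigma_finite_measure_axioms)
  define K where "K = (\<integral>\<^sup>+\<omega>. (emeasure (\<Phi> \<omega>) (ball 0 1))\<^sup>2 \<partial>M)"
  have K: "K < \<infinity>" unfolding K_def by (rule finite_second_moment) auto
  have Kz: "(\<integral>\<^sup>+\<omega>. (\<integral>\<^sup>+x. indicator (ball 0 1) (x - z) \<partial>\<Phi> \<omega>)\<^sup>2 \<partial>M) = K" for z
  proof -
    have "(\<lambda>N. (\<integral>\<^sup>+x. indicator (ball 0 1) x \<partial>N)\<^sup>2) \<in> borel_measurable (locally_finite_algebra ::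
        (real ^ 'd) measure measure)"
      unfolding power2_eq_square by (intro borel_measurable_times_ennreal
          nn_integral_kernel_measurable) measurable
    from stationary_nn_integral[OF this, of z] show ?thesis
      unfolding K_def by (simp add: nn_integral_shift_measure sets_Phi cong: nn_integral_cong)
  qed
  have le: "ennreal v * (\<integral>\<^sup>+x. ennreal \<bar>gauss (t *\<^sub>R x)\<bar> \<partial>\<Phi> \<omega>) \<le> (\<integral>\<^sup>+z. 1 * (\<integral>\<^sup>+x. indicator (ball 0
      1) (x - z) \<partial>\<Phi> \<omega>) \<partial>\<mu>)"
    if w: "\<omega> \<in> space M" for \<omega>
  proof -
    note [measurable_cong] = sets_Phi[OF w]
    interpret PL: pair_sigma_finite "\<Phi> \<omega>" "lborel :: (real ^ 'd) measure" by (rule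
        pair_sigma_finite_Phi[OF w lborel.sigma_finite_measure_axioms])
    have [measurable]: "(\<lambda>z. \<integral>\<^sup>+x. indicator (ball 0 1) (x - z) \<partial>\<Phi> \<omega>) \<in> borel_measurable borel"
      using w by measurable
    have "ennreal v * ennreal \<bar>gauss (t *\<^sub>R x)\<bar> \<le> (\<integral>\<^sup>+z. h z * indicator (ball 0 1) (x - z)
        \<partial>lborel)" for x
    proof -
      have "ennreal v * ennreal \<bar>gauss (t *\<^sub>R x)\<bar> = (\<integral>\<^sup>+z. ennreal \<bar>gauss (t *\<^sub>R x)\<bar> * indicator
          (ball x 1) z \<partial>lborel)"
        by (simp add: nn_integral_cmult ev mult.commute)
      also have "\<dots> \<le> (\<integral>\<^sup>+z. h z * indicator (ball 0 1) (x - z) \<partial>lborel)"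
      proof (rule nn_integral_mono)
        fix z
        show "ennreal \<bar>gauss (t *\<^sub>R x)\<bar> * indicator (ball x 1) z \<le> h z * indicator (ball 0 1) (x - z)"
          using gauss_ball_bound[of x z t] gauss_pos[of "t *\<^sub>R x"]
          by (auto simp: indicator_def h_def dist_norm norm_minus_commute intro!: ennreal_leI)
      qed
      finally show ?thesis .
    qed
    then have "(\<integral>\<^sup>+x. ennreal v * ennreal \<bar>gauss (t *\<^sub>R x)\<bar> \<partial>\<Phi> \<omega>) \<le> (\<integral>\<^sup>+x. \<integral>\<^sup>+z. h z * indicator
        (ball 0 1) (x - z) \<partial>lborel \<partial>\<Phi> \<omega>)"
      by (intro nn_integral_mono)
    also have "\<dots> = (\<integral>\<^sup>+z. \<integral>\<^sup>+x. h z * indicator (ball 0 1) (x - z) \<partial>\<Phi> \<omega> \<partial>lborel)"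
      by (rule PL.Fubini'[symmetric]) measurable
    also have "\<dots> = (\<integral>\<^sup>+z. h z * (\<integral>\<^sup>+x. indicator (ball 0 1) (x - z) \<partial>\<Phi> \<omega>) \<partial>lborel)"
      by (intro nn_integral_cong nn_integral_cmult) measurable
    also have "\<dots> = (\<integral>\<^sup>+z. 1 * (\<integral>\<^sup>+x. indicator (ball 0 1) (x - z) \<partial>\<Phi> \<omega>) \<partial>\<mu>)"
      unfolding \<mu>_def by (subst nn_integral_density) auto
    finally show ?thesis by (subst (asm) nn_integral_cmult) auto
  qed
  have "(ennreal v)\<^sup>2 * (\<integral>\<^sup>+\<omega>. (\<integral>\<^sup>+x. ennreal \<bar>gauss (t *\<^sub>R x)\<bar> \<partial>\<Phi> \<omega>)\<^sup>2 \<partial>M) =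
      (\<integral>\<^sup>+\<omega>. (ennreal v * (\<integral>\<^sup>+x. ennreal \<bar>gauss (t *\<^sub>R x)\<bar> \<partial>\<Phi> \<omega>))\<^sup>2 \<partial>M)"
    by (subst nn_integral_cmult[symmetric]) (auto simp: power_mult_distrib)
  also have "\<dots> \<le> (\<integral>\<^sup>+\<omega>. (\<integral>\<^sup>+z. 1 \<partial>\<mu>) * (\<integral>\<^sup>+z. (\<integral>\<^sup>+x. indicator (ball 0 1) (x - z) \<partial>\<Phi> \<omega>)\<^sup>2 \<partial>\<mu>) \<partial>M)"
  proof (rule nn_integral_mono)
    fix \<omega> assume w: "\<omega> \<in> space M"
    have [measurable]: "(\<lambda>z. \<integral>\<^sup>+x. indicator (ball 0 1) (x - z) \<partial>\<Phi> \<omega>) \<in> borel_measurable borel"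
      using w by measurable
    have "(ennreal v * (\<integral>\<^sup>+x. ennreal \<bar>gauss (t *\<^sub>R x)\<bar> \<partial>\<Phi> \<omega>))\<^sup>2 \<le> (\<integral>\<^sup>+z. 1 * (\<integral>\<^sup>+x. indicator (ball
        0 1) (x - z) \<partial>\<Phi> \<omega>) \<partial>\<mu>)\<^sup>2"
      by (intro power_mono le w) auto
    \<comment> \<open>Cauchy-Schwarz against the constant 1; the resulting total mass of
      \<open>\<mu>\<close> is finite by \<open>mu1\<close>.\<close>
    also have "\<dots> \<le> (\<integral>\<^sup>+z. 1\<^sup>2 \<partial>\<mu>) * (\<integral>\<^sup>+z. (\<integral>\<^sup>+x. indicator (ball 0 1) (x - z) \<partial>\<Phi> \<omega>)\<^sup>2 \<partial>\<mu>)"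
      by (rule Cauchy_Schwarz_nn_integral) measurable
    finally show "(ennreal v * (\<integral>\<^sup>+x. ennreal \<bar>gauss (t *\<^sub>R x)\<bar> \<partial>\<Phi> \<omega>))\<^sup>2 \<le> (\<integral>\<^sup>+z. 1 \<partial>\<mu>) * (\<integral>\<^sup>+z.
        (\<integral>\<^sup>+x. indicator (ball 0 1) (x - z) \<partial>\<Phi> \<omega>)\<^sup>2 \<partial>\<mu>)"
      by simp
  qed
  also have "\<dots> = (\<integral>\<^sup>+z. 1 \<partial>\<mu>) * (\<integral>\<^sup>+\<omega>. (\<integral>\<^sup>+z. (\<integral>\<^sup>+x. indicator (ball 0 1) (x - z) \<partial>\<Phi> \<omega>)\<^sup>2 \<partial>\<mu>) \<partial>M)"
    by (rule nn_integral_cmult) (use sf in \<open>auto intro!: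
        sigma_finite_measure.borel_measurable_nn_integral\<close>)
  also have "(\<integral>\<^sup>+\<omega>. (\<integral>\<^sup>+z. (\<integral>\<^sup>+x. indicator (ball 0 1) (x - z) \<partial>\<Phi> \<omega>)\<^sup>2 \<partial>\<mu>) \<partial>M) = (\<integral>\<^sup>+z. (\<integral>\<^sup>+\<omega>.
      (\<integral>\<^sup>+x. indicator (ball 0 1) (x - z) \<partial>\<Phi> \<omega>)\<^sup>2 \<partial>M) \<partial>\<mu>)"
    by (rule M\<mu>.Fubini'[symmetric]) measurable
  also have "\<dots> = K * (\<integral>\<^sup>+z. 1 \<partial>\<mu>)"
    unfolding Kz by simp
  finally have "(ennreal v)\<^sup>2 * (\<integral>\<^sup>+\<omega>. (\<integral>\<^sup>+x. ennreal \<bar>gauss (t *\<^sub>R x)\<bar> \<partial>\<Phi> \<omega>)\<^sup>2 \<partial>M) \<le> (\<integral>\<^sup>+z. 1 \<partial>\<mu>) *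
      (K * (\<integral>\<^sup>+z. 1 \<partial>\<mu>))" .
  also have "\<dots> < \<infinity>" using K mu1 by (simp add: ennreal_mult_less_top)
  finally show "(\<integral>\<^sup>+\<omega>. (\<integral>\<^sup>+x. ennreal \<bar>gauss (t *\<^sub>R x)\<bar> \<partial>\<Phi> \<omega>)\<^sup>2 \<partial>M) < \<infinity>"
    using v by (auto simp: ennreal_mult_less_top)
qed measurable

lemma autocorrelation_gauss:
  fixes s :: real
  shows "autocorrelation (\<lambda>x. gauss ((sqrt 2 * s) *\<^sub>R x :: real ^ 'd)) u = gauss (s *\<^sub>R u) * (\<integral>x.
      gauss (s *\<^sub>R u + (2 * s) *\<^sub>R x) \<partial>lborel)"
  unfolding autocorrelation_def gauss_translate_product by simp

lemma gauss_shift_mass: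
  assumes s: "s > 0"
  shows "(2 * s) ^ CARD('d) * (\<integral>x. gauss (t + (2 * s) *\<^sub>R x :: real ^ 'd) \<partial>lborel) = gauss_mass
      TYPE('d)"
  using integral_lborel_affine[of "2 * s" gauss t] s by (simp add: integral_gauss)

text \<open>Up to a constant \<open>gauss (s *\<^sub>R u)\<close> is the autocorrelation of an
  admissible Gaussian, so its integrability against \<open>\<alpha>\<close> is part of the variance
  formula.\<close>

lemma integrable_alpha_gauss:
  assumes s: "s > 0"
  shows "integrable \<alpha> (\<lambda>u. gauss (s *\<^sub>R u))"
proof -
  have "integrable \<alpha> (\<lambda>u. (2 * s) ^ CARD('d) / gauss_mass TYPE('d) * autocorrelation (\<lambda>x. gauss
      ((sqrt 2 * s) *\<^sub>R x)) u)"
    using s by (intro integrable_mult_right V_eq(1) admissible_gauss) simp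
  also have "(\<lambda>u. (2 * s) ^ CARD('d) / gauss_mass TYPE('d) * autocorrelation (\<lambda>x. gauss ((sqrt 2 *
      s) *\<^sub>R x)) u) = (\<lambda>u :: real ^ 'd. gauss (s *\<^sub>R u))"
  proof
    fix u :: "real ^ 'd"
    have "(2 * s) ^ CARD('d) / gauss_mass TYPE('d) * autocorrelation (\<lambda>x. gauss ((sqrt 2 * s) *\<^sub>R
        x)) u =
       gauss (s *\<^sub>R u) * ((2 * s) ^ CARD('d) * (\<integral>x. gauss (s *\<^sub>R u + (2 * s) *\<^sub>R x :: real ^ 'd)
           \<partial>lborel)) / gauss_mass TYPE('d)"
      unfolding autocorrelation_gauss by simp
    then show "(2 * s) ^ CARD('d) / gauss_mass TYPE('d) * autocorrelation (\<lambda>x. gauss ((sqrt 2 * s)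
        *\<^sub>R x)) u = gauss (s *\<^sub>R u)"
      unfolding gauss_shift_mass[OF s] using gauss_mass_pos[where 'd='d] by simp
  qed
  finally show ?thesis .
qed

text \<open>The windowed spectral density of the covariance measure is a sum of two variances.\<close>

lemma L_cos_gauss_nonneg:
  assumes s: "s > 0"
  shows "0 \<le> L (\<lambda>u. cos (k \<bullet> u) * gauss (s *\<^sub>R u))"
proof -
  let ?g = "\<lambda>x :: real ^ 'd. gauss ((sqrt 2 * s) *\<^sub>R x)"
  \<comment> \<open>Real and imaginary part of a Gaussian modulated with frequency \<open>k\<close>;
    the addition theorem for the cosine makes the sum of their autocorrelations depend on
    \<open>k\<close> only through cos (k \<bullet> u).\<close>
  let ?f1 = "\<lambda>x. cos (k \<bullet> x) * ?g x" and ?f2 = "\<lambda>x. sin (k \<bullet> x) * ?g x"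
  have g: "admissible ?g" using s by (intro admissible_gauss) simp
  have 1: "admissible ?f1" and 2: "admissible ?f2"
    by (rule admissible_mono[OF g]; simp add: abs_mult mult_left_le_one_le)+
  have int: "integrable lborel (\<lambda>x. ?f1 x * ?f1 (x + u))" "integrable lborel (\<lambda>x. ?f2 x * ?f2 (x +
      u))" for u
  proof -
    have ig: "integrable lborel ?g" using g by (simp add: admissible_def)
    have *: "\<bar>a * b * (c * d)\<bar> \<le> b" if "\<bar>a\<bar> \<le> 1" "\<bar>c\<bar> \<le> 1" "\<bar>d\<bar> \<le> 1" "0 \<le> b" for a b c d :: real
    proof -
      have "\<bar>a\<bar> * \<bar>b\<bar> * (\<bar>c\<bar> * \<bar>d\<bar>) \<le> 1 * \<bar>b\<bar> * (1 * 1)" using that by (intro mult_mono) auto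
      then show ?thesis using that by (simp add: abs_mult)
    qed
    show "integrable lborel (\<lambda>x. ?f1 x * ?f1 (x + u))"
      by (rule Bochner_Integration.integrable_bound[OF ig]) (auto intro!: * simp: gauss_le_1)
    show "integrable lborel (\<lambda>x. ?f2 x * ?f2 (x + u))"
      by (rule Bochner_Integration.integrable_bound[OF ig]) (auto intro!: * simp: gauss_le_1)
  qed
  have eq: "autocorrelation ?f1 u + autocorrelation ?f2 u = gauss_mass TYPE('d) / (2 * s) ^ CARD('d)
      * (cos (k \<bullet> u) * gauss (s *\<^sub>R u))" for u
  proof -
    have "autocorrelation ?f1 u + autocorrelation ?f2 u = (\<integral>x. ?f1 x * ?f1 (x + u) + ?f2 x * ?f2 (x
        + u) \<partial>lborel)"
      unfolding autocorrelation_def by (rule Bochner_Integration.integral_add[symmetric, OF int])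
    also have "\<dots> = (\<integral>x. cos (k \<bullet> u) * (?g x * ?g (x + u)) \<partial>lborel)"
    proof (intro Bochner_Integration.integral_cong refl)
      fix x
      have "cos (k \<bullet> u) = cos (k \<bullet> (x + u) - k \<bullet> x)" by (simp add: inner_add_right)
      then have c: "cos (k \<bullet> u) = cos (k \<bullet> (x + u)) * cos (k \<bullet> x) + sin (k \<bullet> (x + u)) * sin (k \<bullet> x)"
          by (simp only: cos_diff)
      show "?f1 x * ?f1 (x + u) + ?f2 x * ?f2 (x + u) = cos (k \<bullet> u) * (?g x * ?g (x + u))"
        unfolding c by (simp add: algebra_simps)
    qed
    also have "\<dots> = cos (k \<bullet> u) * autocorrelation ?g u"
      by (simp add: autocorrelation_def)
    also have "autocorrelation ?g u = gauss_mass TYPE('d) / (2 * s) ^ CARD('d) * gauss (s *\<^sub>R u)"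
      unfolding autocorrelation_gauss using gauss_shift_mass[OF s, of "s *\<^sub>R u"] s by (simp add:
          field_simps)
    finally show ?thesis by simp
  qed
  have "0 \<le> L (autocorrelation ?f1) + L (autocorrelation ?f2)"
    using V_eq(5)[OF 1] V_eq(5)[OF 2] by simp
  also have "\<dots> = L (\<lambda>u. autocorrelation ?f1 u + autocorrelation ?f2 u)"
    using 1 2 by (intro L_add[symmetric] V_eq(1) autocorrelation_lborel(1)) (auto simp: admissible_def)
  also have "\<dots> = gauss_mass TYPE('d) / (2 * s) ^ CARD('d) * L (\<lambda>u. cos (k \<bullet> u) * gauss (s *\<^sub>R u))"
    unfolding eq by (rule L_cmult)
  finally have "0 \<le> gauss_mass TYPE('d) / (2 * s) ^ CARD('d) * L (\<lambda>u. cos (k \<bullet> u) * gauss (s *\<^sub>R u))" .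
  moreover have "0 < gauss_mass TYPE('d) / (2 * s) ^ CARD('d)" using s gauss_mass_pos[where 'd='d]
      by simp
  ultimately show ?thesis by (meson mult_pos_neg not_le)
qed

text \<open>The bound is linear in the height \<open>c\<close> and uniform in \<open>s\<close>; this
  is the majorant needed to exchange the limit with a sum over infinitely many functions.\<close>

lemma L_gauss_smooth_bound:
  assumes F: "even_bump c R F" and s: "0 < s" "s \<le> 1"
  shows "integrable \<alpha> (gauss_smooth F s)" "integrable lborel (gauss_smooth F s)"
    and "\<bar>L (gauss_smooth F s)\<bar> \<le> c * (smoothing_constant TYPE('d) R *
      ((\<integral>u. gauss ((1 / 2) *\<^sub>R u) \<partial>\<alpha>) + \<gamma>\<^sup>2 * (\<integral>u. gauss ((1 / 2) *\<^sub>R u :: real ^ 'd) \<partial>lborel)))"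
proof -
  let ?b = "\<lambda>u :: real ^ 'd. c * smoothing_constant TYPE('d) R * gauss ((1 / 2) *\<^sub>R u)"
  note [measurable] = even_bumpD(1)[OF F]
  have ab: "integrable \<alpha> ?b" by (intro integrable_mult_right integrable_alpha_gauss) simp
  have lb: "integrable lborel ?b" by (intro integrable_mult_right integrable_gauss_scale) simp
  note bd = gauss_smooth_bound[OF F s]
  show a: "integrable \<alpha> (gauss_smooth F s)"
    by (rule Bochner_Integration.integrable_bound[OF ab]) (use bd in \<open>auto intro: order_trans[OF _
        abs_ge_self]\<close>)
  show l: "integrable lborel (gauss_smooth F s)"
    by (rule Bochner_Integration.integrable_bound[OF lb]) (use bd in \<open>auto intro: order_trans[OF _
        abs_ge_self]\<close>)
  have 1: "\<bar>\<integral>u. gauss_smooth F s u \<partial>\<alpha>\<bar> \<le> (\<integral>u. ?b u \<partial>\<alpha>)"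
    by (rule order_trans[OF integral_abs_bound integral_mono]) (use a ab bd in auto)
  have 2: "\<bar>\<integral>u. gauss_smooth F s u \<partial>lborel\<bar> \<le> (\<integral>u. ?b u \<partial>lborel)"
    by (rule order_trans[OF integral_abs_bound integral_mono]) (use l lb bd in auto)
  have "\<bar>L (gauss_smooth F s)\<bar> \<le> \<bar>\<integral>u. gauss_smooth F s u \<partial>\<alpha>\<bar> + \<gamma>\<^sup>2 * \<bar>\<integral>u. gauss_smooth F s u \<partial>lborel\<bar>"
    unfolding L_def by (rule order_trans[OF abs_triangle_ineq4]) (simp add: abs_mult)
  also have "\<dots> \<le> (\<integral>u. ?b u \<partial>\<alpha>) + \<gamma>\<^sup>2 * (\<integral>u. ?b u \<partial>lborel)"
    by (intro add_mono 1 mult_left_mono 2) auto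
  also have "\<dots> = c * (smoothing_constant TYPE('d) R * ((\<integral>u. gauss ((1 / 2) *\<^sub>R u) \<partial>\<alpha>) + \<gamma>\<^sup>2 * (\<integral>u.
      gauss ((1 / 2) *\<^sub>R u :: real ^ 'd) \<partial>lborel)))"
    by (simp only: integral_mult_right_zero) (simp add: algebra_simps)
  finally show "\<bar>L (gauss_smooth F s)\<bar> \<le> c * (smoothing_constant TYPE('d) R *
      ((\<integral>u. gauss ((1 / 2) *\<^sub>R u) \<partial>\<alpha>) + \<gamma>\<^sup>2 * (\<integral>u. gauss ((1 / 2) *\<^sub>R u :: real ^ 'd) \<partial>lborel)))" .
qed

lemma L_gauss_smooth_tendsto:
  assumes F: "even_bump c R F" and S: "S \<longlonglongrightarrow> 0" "\<And>n. 0 < S n" "\<And>n. S n \<le> 1"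
  shows "(\<lambda>n. L (gauss_smooth F (S n))) \<longlonglongrightarrow> gauss_mass TYPE('d) * L F"
proof -
  let ?b = "\<lambda>u :: real ^ 'd. c * smoothing_constant TYPE('d) R * gauss ((1 / 2) *\<^sub>R u)"
  note [measurable] = even_bumpD(1)[OF F]
  have ab: "integrable \<alpha> ?b" by (intro integrable_mult_right integrable_alpha_gauss) simp
  have lb: "integrable lborel ?b" by (intro integrable_mult_right integrable_gauss_scale) simp
  have "(\<lambda>n. \<integral>u. gauss_smooth F (S n) u \<partial>\<alpha>) \<longlonglongrightarrow> (\<integral>u. gauss_mass TYPE('d) * F u \<partial>\<alpha>)"
    by (rule integral_dominated_convergence[OF _ _ ab])
       (use gauss_smooth_bound[OF F S(2,3)] gauss_smooth_tendsto[OF F S(1)] in auto)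
  moreover have "(\<lambda>n. \<integral>u. gauss_smooth F (S n) u \<partial>lborel) \<longlonglongrightarrow> (\<integral>u. gauss_mass TYPE('d) * F u \<partial>lborel)"
    by (rule integral_dominated_convergence[OF _ _ lb])
       (use gauss_smooth_bound[OF F S(2,3)] gauss_smooth_tendsto[OF F S(1)] in auto)
  ultimately have "(\<lambda>n. L (gauss_smooth F (S n))) \<longlonglongrightarrow> L (\<lambda>u. gauss_mass TYPE('d) * F u)"
    unfolding L_def by (intro tendsto_intros)
  then show ?thesis by (simp only: L_cmult)
qed

text \<open>Parseval identity for the covariance measure, obtained by subtracting the multiple of
  \<open>spectral_identity\<close> for Lebesgue measure from that for \<open>\<alpha>\<close>. The
  factor in front of \<open>cos_transform F k\<close> is nonnegative and acts as a spectral
  density.\<close>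

lemma frequency_domain:
  assumes F: "even_bump c R F" and s: "0 < s" "s \<le> 1"
  shows "has_bochner_integral lborel (\<lambda>k. gauss (s *\<^sub>R k) * L (\<lambda>u. cos (k \<bullet> u) * gauss (s *\<^sub>R u)) *
      cos_transform F k)
    (gauss_mass TYPE('d) * L (gauss_smooth F s))"
proof -
  note D = even_bumpD[OF F]
  let ?G = "\<lambda>\<rho> k. gauss (s *\<^sub>R k) * (\<integral>u. cos (k \<bullet> u) * gauss (s *\<^sub>R u) \<partial>\<rho>) * cos_transform F k"
  have gl: "integrable lborel (\<lambda>u :: real ^ 'd. gauss (s *\<^sub>R u))" using s by (intro
      integrable_gauss_scale) simp
  note A = spectral_identity[OF alpha.sigma_finite_measure_axioms sets_alpha
      integrable_alpha_gauss[OF s(1)] s(1) D(7,2), folded cos_transform_def gauss_smooth_def]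
  note B = spectral_identity[OF lborel.sigma_finite_measure_axioms sets_lborel gl s(1) D(7,2),
      folded cos_transform_def gauss_smooth_def]
  have "has_bochner_integral lborel (\<lambda>k. ?G \<alpha> k - \<gamma>\<^sup>2 * ?G lborel k)
      (gauss_mass TYPE('d) * (\<integral>u. gauss_smooth F s u \<partial>\<alpha>) - \<gamma>\<^sup>2 * (gauss_mass TYPE('d) * (\<integral>u.
          gauss_smooth F s u \<partial>lborel)))"
    using A B by (intro has_bochner_integral_diff has_bochner_integral_mult_right) (auto simp:
        has_bochner_integral_iff)
  moreover have "(\<lambda>k. ?G \<alpha> k - \<gamma>\<^sup>2 * ?G lborel k) = (\<lambda>k. gauss (s *\<^sub>R k) * L (\<lambda>u. cos (k \<bullet> u) *
      gauss (s *\<^sub>R u)) * cos_transform F k)"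
    by (auto simp: L_def algebra_simps)
  moreover have "gauss_mass TYPE('d) * (\<integral>u. gauss_smooth F s u \<partial>\<alpha>) - \<gamma>\<^sup>2 * (gauss_mass TYPE('d) *
      (\<integral>u. gauss_smooth F s u \<partial>lborel)) =
     gauss_mass TYPE('d) * L (gauss_smooth F s)"
    by (simp add: L_def algebra_simps)
  ultimately show ?thesis by simp
qed

text \<open>At a fixed level of smoothing the inequality between transforms is integrated against a
  nonnegative weight. One suitable \<open>j\<close> for each \<open>k\<close> is enough, since the
  other terms are nonnegative. The smoothing is removed by Tannery's theorem.\<close>

lemma spectral_domination:
  fixes a c :: "nat \<Rightarrow> real"
  assumes F: "even_bump c0 R F" and G: "\<And>j. even_bump (c j) R (G j)"
    and nnF: "\<And>k. 0 \<le> cos_transform F k" and nnG: "\<And>j k. 0 \<le> cos_transform (G j) k"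
    and a: "\<And>j. 0 \<le> a j" and sum: "summable (\<lambda>j. a j * c j)"
    and dom: "\<And>k. \<exists>j. cos_transform F k \<le> a j * cos_transform (G j) k"
  shows "summable (\<lambda>j. a j * L (G j))" and "L F \<le> (\<Sum>j. a j * L (G j))"
proof -
  define K where "K = smoothing_constant TYPE('d) R * ((\<integral>u. gauss ((1 / 2) *\<^sub>R u) \<partial>\<alpha>) + \<gamma>\<^sup>2 * (\<integral>u.
      gauss ((1 / 2) *\<^sub>R u :: real ^ 'd) \<partial>lborel))"
  define S where "S n = 1 / (real n + 1)" for n
  have S: "S \<longlonglongrightarrow> 0" "\<And>n. 0 < S n" "\<And>n. S n \<le> 1"
    unfolding S_def using LIMSEQ_inverse_real_of_nat by (auto simp: inverse_eq_divide add.commute)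
  let ?c = "gauss_mass TYPE('d)"
  have c: "?c > 0" by (rule gauss_mass_pos)
  note [measurable] = even_bumpD(1)[OF F] even_bumpD(1)[OF G]
  have bound: "norm (a j * L (gauss_smooth (G j) (S n))) \<le> a j * c j * K" for j n
    using mult_left_mono[OF L_gauss_smooth_bound(3)[OF G S(2,3), of j n] a[of j]] a[of j]
    by (simp add: abs_mult K_def mult_ac)
  have sumK: "summable (\<lambda>j. a j * c j * K)" using sum by (rule summable_mult2)
  \<comment> \<open>Tannery's theorem with the majorant \<open>a j * c j * K\<close> exchanges the
    limit in the smoothing with the sum and also gives the summability of the limits.\<close>
  have tan: "summable (\<lambda>j. norm (a j * (?c * L (G j))))"
    "(\<lambda>n. \<Sum>j. a j * L (gauss_smooth (G j) (S n))) \<longlonglongrightarrow> (\<Sum>j. a j * (?c * L (G j)))"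
    using tannerys_theorem[where a = "\<lambda>j n. a j * L (gauss_smooth (G j) (S n))" and b = "\<lambda>j. a j *
        (?c * L (G j))" and F = sequentially and M = "\<lambda>j. a j * c j * K",
        OF tendsto_mult[OF tendsto_const L_gauss_smooth_tendsto[OF G S]] _ sumK] bound
    by (auto intro!: always_eventually)
  have "summable (\<lambda>j. a j * (?c * L (G j)))" using tan(1) by (rule summable_norm_cancel)
  then have "summable (\<lambda>j. (1 / ?c) * (a j * (?c * L (G j))))" by (rule summable_mult)
  then show s: "summable (\<lambda>j. a j * L (G j))" using c by simp
  have le: "L (gauss_smooth F (S n)) \<le> (\<Sum>j. a j * L (gauss_smooth (G j) (S n)))" for n
  proof -
    let ?w = "\<lambda>k. gauss (S n *\<^sub>R k) * L (\<lambda>u. cos (k \<bullet> u) * gauss (S n *\<^sub>R u))"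
    have w: "0 \<le> ?w k" for k by (intro mult_nonneg_nonneg L_cos_gauss_nonneg S(2) gauss_nonneg)
    have hb: "(\<integral>\<^sup>+k. ennreal (?w k * cos_transform H k) \<partial>lborel) = ennreal (?c * L (gauss_smooth H
        (S n)))"
      "0 \<le> ?c * L (gauss_smooth H (S n))"
      if H: "even_bump b R H" and nn: "\<And>k. 0 \<le> cos_transform H k" for H b
    proof -
      note hb = frequency_domain[OF H S(2,3)[of n]]
      have "integrable lborel (\<lambda>k. ?w k * cos_transform H k)" and i: "(\<integral>k. ?w k * cos_transform H k
          \<partial>lborel) = ?c * L (gauss_smooth H (S n))"
        using hb by (auto simp: has_bochner_integral_iff)
      then show "(\<integral>\<^sup>+k. ennreal (?w k * cos_transform H k) \<partial>lborel) = ennreal (?c * L (gauss_smooth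
          H (S n)))"
        by (subst nn_integral_eq_integral) (auto intro!: mult_nonneg_nonneg w nn)
      show "0 \<le> ?c * L (gauss_smooth H (S n))"
        unfolding i[symmetric] by (intro Bochner_Integration.integral_nonneg mult_nonneg_nonneg w nn)
    qed
    have meas: "(\<lambda>k. ennreal (?w k * cos_transform (G j) k)) \<in> borel_measurable lborel" for j
      using frequency_domain[OF G S(2,3)[of n], of j] by (auto simp: has_bochner_integral_iff)
    have "ennreal (?c * L (gauss_smooth F (S n))) \<le> (\<integral>\<^sup>+k. (\<Sum>j. ennreal (a j) * ennreal (?w k *
        cos_transform (G j) k)) \<partial>lborel)"
      unfolding hb(1)[OF F nnF, symmetric]
    proof (rule nn_integral_mono)
      fix k
      obtain j where "cos_transform F k \<le> a j * cos_transform (G j) k" using dom by blast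
      then have "?w k * cos_transform F k \<le> ?w k * (a j * cos_transform (G j) k)" by (rule
          mult_left_mono[OF _ w])
      also have "\<dots> = a j * (?w k * cos_transform (G j) k)" by (rule mult.left_commute)
      finally have "ennreal (?w k * cos_transform F k) \<le> ennreal (a j) * ennreal (?w k *
          cos_transform (G j) k)"
        using a by (subst ennreal_mult'[symmetric]) (auto intro: ennreal_leI)
      also have "\<dots> \<le> (\<Sum>j. ennreal (a j) * ennreal (?w k * cos_transform (G j) k))"
        using sum_le_suminf[of "\<lambda>j. ennreal (a j) * ennreal (?w k * cos_transform (G j) k)" "{j}"]
            by simp
      finally show "ennreal (?w k * cos_transform F k) \<le> (\<Sum>j. ennreal (a j) * ennreal (?w k *
          cos_transform (G j) k))" .
    qed
    also have "\<dots> = (\<Sum>j. ennreal (a j) * ennreal (?c * L (gauss_smooth (G j) (S n))))"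
      using meas by (subst nn_integral_suminf) (auto intro!: suminf_cong simp: nn_integral_cmult
          hb(1)[OF G nnG])
    also have "\<dots> = (\<Sum>j. ennreal (?c * (a j * L (gauss_smooth (G j) (S n)))))"
      using a by (simp add: ennreal_mult'[symmetric] mult.left_commute)
    also have "\<dots> = ennreal (\<Sum>j. ?c * (a j * L (gauss_smooth (G j) (S n))))"
    proof (rule suminf_ennreal2)
      show "0 \<le> ?c * (a j * L (gauss_smooth (G j) (S n)))" for j
        using mult_nonneg_nonneg[OF a[of j] hb(2)[OF G nnG, of j]] by (simp add: mult.left_commute)
      show "summable (\<lambda>j. ?c * (a j * L (gauss_smooth (G j) (S n))))"
        by (rule summable_mult, rule summable_comparison_test'[OF sumK bound])
    qed
    finally have "?c * L (gauss_smooth F (S n)) \<le> (\<Sum>j. ?c * (a j * L (gauss_smooth (G j) (S n))))"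
    proof (subst (asm) ennreal_le_iff)
      show "0 \<le> (\<Sum>j. ?c * (a j * L (gauss_smooth (G j) (S n))))"
      proof (rule suminf_nonneg)
        show "summable (\<lambda>j. ?c * (a j * L (gauss_smooth (G j) (S n))))"
          by (rule summable_mult, rule summable_comparison_test'[OF sumK bound])
        show "0 \<le> ?c * (a j * L (gauss_smooth (G j) (S n)))" for j
          using mult_nonneg_nonneg[OF a[of j] hb(2)[OF G nnG, of j]] by (simp add: mult.left_commute)
      qed
    qed
    also have "\<dots> = ?c * (\<Sum>j. a j * L (gauss_smooth (G j) (S n)))"
      by (rule suminf_mult, rule summable_comparison_test'[OF sumK bound])
    finally show ?thesis using c by simp
  qed
  have "?c * L F \<le> (\<Sum>j. a j * (?c * L (G j)))"
    by (rule LIMSEQ_le[OF L_gauss_smooth_tendsto[OF F S] tan(2)]) (use le in auto)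
  also have "\<dots> = (\<Sum>j. ?c * (a j * L (G j)))" by (simp add: mult.left_commute)
  also have "\<dots> = ?c * (\<Sum>j. a j * L (G j))" by (rule suminf_mult[OF s])
  finally show "L F \<le> (\<Sum>j. a j * L (G j))" using c by simp
qed

end

section \<open>Windows\<close>

lemma autocorrelation_even:
  fixes f :: "real ^ 'd \<Rightarrow> real"
  assumes [measurable]: "f \<in> borel_measurable borel"
  shows "autocorrelation f (- u) = autocorrelation f u"
  using integral_lborel_shift(2)[of "\<lambda>x. f x * f (x - u)" u]
  by (simp add: autocorrelation_def mult.commute)

text \<open>Wiener-Khinchin identity in real form: splitting cos (k \<bullet> (y - x)) factorises
  the double integral into the squares of the cosine and sine integrals, which are up to sign the
  real and imaginary part of the transform.\<close>

lemma cos_transform_autocorrelation: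
  fixes f :: "real ^ 'd \<Rightarrow> real"
  assumes f: "integrable lborel f"
  shows "cos_transform (autocorrelation f) k = (cmod (fourier_transform (\<lambda>x. complex_of_real (f x))
      k))\<^sup>2"
proof -
  have [measurable]: "f \<in> borel_measurable borel" using f by simp
  let ?c = "\<lambda>x. f x * cos (k \<bullet> x)" and ?s = "\<lambda>x. f x * sin (k \<bullet> x)"
  have ic: "integrable lborel ?c" and iS: "integrable lborel ?s"
    by (rule Bochner_Integration.integrable_bound[OF f]; simp add: abs_mult mult_left_le)+
  have eq: "complex_of_real (f x) * exp (- \<i> * complex_of_real (k \<bullet> x)) = complex_of_real (?c x) - \<i>
      * complex_of_real (?s x)" for x
  proof -
    have "exp (- \<i> * complex_of_real (k \<bullet> x)) = cis (- (k \<bullet> x))" by (simp add: cis_conv_exp)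
    then show ?thesis by (simp add: complex_eq_iff)
  qed
  have "fourier_transform (\<lambda>x. complex_of_real (f x)) k = complex_of_real (\<integral>x. ?c x \<partial>lborel) - \<i> *
      complex_of_real (\<integral>x. ?s x \<partial>lborel)"
    unfolding fourier_transform_def eq using ic iS
    by (subst Bochner_Integration.integral_diff) (auto simp del: of_real_mult)
  then have m: "(cmod (fourier_transform (\<lambda>x. complex_of_real (f x)) k))\<^sup>2 = (\<integral>x. ?c x \<partial>lborel)\<^sup>2 +
      (\<integral>x. ?s x \<partial>lborel)\<^sup>2"
    by (simp add: cmod_power2)
  have i: "integrable (lborel \<Otimes>\<^sub>M lborel) (\<lambda>(u, x). f x * f (x + u) * cos (k \<bullet> u))"
    by (rule Bochner_Integration.integrable_bound[OF integrable_translate_product[OF f f]])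
       (auto simp: abs_mult mult_left_le intro!: AE_I2)
  have "cos_transform (autocorrelation f) k = (\<integral>u. \<integral>x. f x * f (x + u) * cos (k \<bullet> u) \<partial>lborel \<partial>lborel)"
    by (simp add: cos_transform_def autocorrelation_def)
  also have "\<dots> = (\<integral>x. \<integral>u. f x * f (x + u) * cos (k \<bullet> u) \<partial>lborel \<partial>lborel)"
    using lborel_pair.Fubini_integral[OF i] by simp
  also have "\<dots> = (\<integral>x. ?c x * (\<integral>y. ?c y \<partial>lborel) + ?s x * (\<integral>y. ?s y \<partial>lborel) \<partial>lborel)"
  proof (intro Bochner_Integration.integral_cong refl)
    fix x
    have "(\<integral>u. f x * f (x + u) * cos (k \<bullet> u) \<partial>lborel) = (\<integral>u. f x * f u * cos (k \<bullet> (u - x)) \<partial>lborel)"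
      using integral_lborel_shift(1)[of "\<lambda>u. f x * f u * cos (k \<bullet> (u - x))" x] by simp
    also have "\<dots> = (\<integral>u. ?c x * ?c u + ?s x * ?s u \<partial>lborel)"
      by (intro Bochner_Integration.integral_cong refl) (simp add: inner_diff_right cos_diff
          algebra_simps)
    also have "\<dots> = (\<integral>u. ?c x * ?c u \<partial>lborel) + (\<integral>u. ?s x * ?s u \<partial>lborel)"
      using ic iS by (intro Bochner_Integration.integral_add integrable_mult_right) auto
    finally show "(\<integral>u. f x * f (x + u) * cos (k \<bullet> u) \<partial>lborel) = ?c x * (\<integral>y. ?c y \<partial>lborel) + ?s x *
        (\<integral>y. ?s y \<partial>lborel)"
      by (simp only: integral_mult_right_zero)
  qed
  also have "\<dots> = (\<integral>x. ?c x \<partial>lborel)\<^sup>2 + (\<integral>x. ?s x \<partial>lborel)\<^sup>2"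
    using ic iS by (subst Bochner_Integration.integral_add) (simp_all only: integrable_mult_left
        integral_mult_left_zero power2_eq_square)
  finally show ?thesis using m by simp
qed

text \<open>Convexity makes the frontier a null set, so for almost every \<open>x\<close> the
  indicator is continuous at \<open>x + u\<close>; dominated convergence does the rest.\<close>

lemma continuous_autocorrelation_convex:
  fixes B :: "(real ^ 'd) set"
  assumes "convex B" "bounded B" and [measurable]: "B \<in> sets borel"
  shows "continuous_on UNIV (autocorrelation (indicator B))"
  unfolding continuous_on_sequentially comp_def
proof (intro ballI allI impI, elim conjE)
  fix u and U :: "nat \<Rightarrow> real ^ 'd" assume U: "U \<longlonglongrightarrow> u"
  have "frontier B \<in> null_sets lborel"
    using negligible_convex_frontier[OF assms(1)]
    by (simp add: negligible_iff_null_sets null_sets_completion_iff frontier_closed borel_closed)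
  moreover have "{x. x \<notin> frontier B} = - frontier B" by auto
  then have fr: "{x. x \<notin> frontier B} \<in> sets borel" by (simp add: frontier_closed borel_open open_Compl)
  ultimately have "AE x in lborel. x \<notin> frontier B" by (intro AE_not_in)
  \<comment> \<open>Translation invariance moves the null set from \<open>x\<close> to
    \<open>x + u\<close>.\<close>
  then have "AE x in distr lborel borel (\<lambda>x. u + 1 *\<^sub>R x). x \<notin> frontier B" by (subst
      distr_lborel_affine) auto
  then have ae: "AE x in lborel. x + u \<notin> frontier B"
    by (subst (asm) AE_distr_iff) (auto simp: fr add.commute)
  have "integrable lborel (indicator B :: _ \<Rightarrow> real)"
    using assms emeasure_bounded_finite[OF assms(2)] by (simp add: integrable_indicator_iff)
  then show "(\<lambda>n. autocorrelation (indicator B) (U n)) \<longlonglongrightarrow> autocorrelation (indicator B) u"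
    unfolding autocorrelation_def
  proof (rule integral_dominated_convergence[rotated 2])
    show "AE x in lborel. (\<lambda>n. indicator B x * indicator B (x + U n)) \<longlonglongrightarrow> indicator B x * (indicator B
        (x + u) :: real)"
      using ae
    proof eventually_elim
      case (elim x)
      have lim: "(\<lambda>n. x + U n) \<longlonglongrightarrow> x + u" by (intro tendsto_intros U)
      have "(\<lambda>n. indicator B (x + U n) :: real) \<longlonglongrightarrow> indicator B (x + u)"
      proof (cases "x + u \<in> interior B")
        case True
        then have "eventually (\<lambda>n. x + U n \<in> interior B) sequentially"
          using lim open_interior topological_tendstoD by blast
        then have "eventually (\<lambda>n. indicator B (x + U n) = (1 :: real)) sequentially"
          by eventually_elim (use interior_subset in \<open>auto simp: indicator_def\<close>)
        moreover have "indicator B (x + u) = (1 :: real)" using True interior_subset by (auto simp: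
            indicator_def)
        ultimately show ?thesis using tendsto_eventually by metis
      next
        case False
        then have "x + u \<in> - closure B" using elim by (auto simp: frontier_def)
        moreover have "open (- closure B)" by auto
        ultimately have "eventually (\<lambda>n. x + U n \<in> - closure B) sequentially"
          using lim topological_tendstoD by blast
        then have "eventually (\<lambda>n. indicator B (x + U n) = (0 :: real)) sequentially"
          by eventually_elim (use closure_subset in \<open>auto simp: indicator_def\<close>)
        moreover have "indicator B (x + u) = (0 :: real)" using \<open>x + u \<in> - closure B\<close> closure_subset
            by (auto simp: indicator_def)
        ultimately show ?thesis using tendsto_eventually by metis
      qed
      then show ?case by (intro tendsto_intros)
    qed
  qed (auto simp: indicator_def)
qed

lemma autocorrelation_indicator_bound:
  fixes B :: "(real ^ 'd) set"
  assumes B: "B \<subseteq> cball 0 R" and [measurable]: "B \<in> sets borel"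
  shows "0 \<le> autocorrelation (indicator B) u" "autocorrelation (indicator B) u \<le> measure lborel B"
    and "\<bar>autocorrelation (indicator B) u\<bar> \<le> measure lborel B * indicator (cball 0 (2 * R)) u"
proof -
  have bd: "bounded B" using B bounded_subset by blast
  have i: "integrable lborel (indicator B :: _ \<Rightarrow> real)"
    using emeasure_bounded_finite[OF bd] by (simp add: integrable_indicator_iff)
  show 0: "0 \<le> autocorrelation (indicator B) u" unfolding autocorrelation_def by simp
  have "autocorrelation (indicator B) u \<le> (\<integral>x. indicator B x \<partial>lborel)"
    unfolding autocorrelation_def
    by (intro integral_mono i Bochner_Integration.integrable_bound[OF i]) (auto simp: indicator_def)
  then show 1: "autocorrelation (indicator B) u \<le> measure lborel B" by simp
  show "\<bar>autocorrelation (indicator B) u\<bar> \<le> measure lborel B * indicator (cball 0 (2 * R)) u"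
  proof (cases "norm u \<le> 2 * R")
    case True then show ?thesis using 0 1 by simp
  next
    case False
    have z: "indicator B x * indicator B (x + u) = (0 :: real)" for x
    proof (rule ccontr)
      assume "indicator B x * indicator B (x + u) \<noteq> (0 :: real)"
      then have "norm x \<le> R" "norm (x + u) \<le> R" using B by (auto simp: indicator_def split: if_splits)
      then have "norm u \<le> 2 * R" using norm_triangle_ineq4[of "x + u" x] by simp
      then show False using False by simp
    qed
    show ?thesis unfolding autocorrelation_def z by simp
  qed
qed

lemma even_bump_indicator:
  fixes B :: "(real ^ 'd) set"
  assumes "convex B" "B \<subseteq> cball 0 R" and [measurable]: "B \<in> sets borel" and "2 * R \<le> R'"
  shows "even_bump (measure lborel B) R' (autocorrelation (indicator B))"
  unfolding even_bump_def
proof (intro conjI allI)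
  show "continuous_on UNIV (autocorrelation (indicator B))"
    by (rule continuous_autocorrelation_convex) (use assms bounded_subset in auto)
  fix v
  show "autocorrelation (indicator B) (- v) = autocorrelation (indicator B) v"
    by (rule autocorrelation_even) measurable
  have "\<bar>autocorrelation (indicator B) v\<bar> \<le> measure lborel B * indicator (cball 0 (2 * R)) v"
    by (rule autocorrelation_indicator_bound) fact+
  also have "\<dots> \<le> measure lborel B * indicator (cball 0 R') v"
    using assms by (intro mult_left_mono) (auto simp: indicator_def)
  finally show "\<bar>autocorrelation (indicator B) v\<bar> \<le> measure lborel B * indicator (cball 0 R') v" .
qed simp

text \<open>The subtracted term is the indicator of \<open>B + z\<close>; averaged over
  displacements, these increments form the error made by smearing a window.\<close>

definition increment :: "(real ^ 'd) set \<Rightarrow> real ^ 'd \<Rightarrow> real ^ 'd \<Rightarrow> real" where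
  "increment B z x = indicator B x - indicator B (x - z)"

text \<open>Expanding the product gives four overlaps, at lags u (twice), u + z and u - z, a second
  difference of the covariogram. Continuity and bounded support are inherited through this
  formula.\<close>

lemma autocorrelation_increment:
  fixes B :: "(real ^ 'd) set"
  assumes bd: "bounded B" and [measurable]: "B \<in> sets borel"
  shows "autocorrelation (increment B z) u = 2 * autocorrelation (indicator B) u - autocorrelation
      (indicator B) (u + z) - autocorrelation (indicator B) (u - z)"
proof -
  have i: "integrable lborel (\<lambda>x. indicator B (x + a) * indicator B (x + b) :: real)" for a b
  proof (rule Bochner_Integration.integrable_bound)
    have "integrable lborel (indicator B :: _ \<Rightarrow> real)"
      using emeasure_bounded_finite[OF bd] by (simp add: integrable_indicator_iff)
    then show "integrable lborel (\<lambda>x. indicator B (x + a) :: real)" by (rule integrable_lborel_shift)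
  qed (auto simp: indicator_def)
  have s: "(\<integral>x. indicator B (x + a) * indicator B (x + b) \<partial>lborel) = autocorrelation (indicator B)
      (b - a)" for a b
    using integral_lborel_shift(2)[of "\<lambda>x. indicator B x * indicator B (x + (b - a))" a]
    by (simp add: autocorrelation_def algebra_simps)
  have "autocorrelation (increment B z) u = (\<integral>x. indicator B (x + 0) * indicator B (x + u) -
      indicator B (x + 0) * indicator B (x + (u - z))
     - indicator B (x + (- z)) * indicator B (x + u) + indicator B (x + (- z)) * indicator B (x + (u
         - z)) \<partial>lborel)"
    unfolding autocorrelation_def increment_def
    by (intro Bochner_Integration.integral_cong refl) (simp add: algebra_simps)
  also have "\<dots> = autocorrelation (indicator B) (u - 0) - autocorrelation (indicator B) (u - z - 0)
      - autocorrelation (indicator B) (u - (- z)) + autocorrelation (indicator B) (u - z - (- z))"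
    unfolding s[symmetric] using i by (simp only: Bochner_Integration.integral_add
        Bochner_Integration.integral_diff Bochner_Integration.integrable_add
        Bochner_Integration.integrable_diff)
  finally show ?thesis by simp
qed

text \<open>The height 4 adds the coefficients 2, 1 and 1 of the second difference, and the radius
  is enlarged by |z| so as to contain all three supports.\<close>

lemma even_bump_increment:
  fixes B :: "(real ^ 'd) set"
  assumes "convex B" "B \<subseteq> cball 0 R" and [measurable]: "B \<in> sets borel" and R': "2 * R + norm z \<le> R'"
  shows "even_bump (4 * measure lborel B) R' (autocorrelation (increment B z))"
  unfolding even_bump_def
proof (intro conjI allI)
  have bd: "bounded B" using assms bounded_subset by blast
  let ?N = "autocorrelation (indicator B)"
  have eq: "autocorrelation (increment B z) = (\<lambda>u. 2 * ?N u - ?N (u + z) - ?N (u - z))"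
    using autocorrelation_increment[OF bd assms(3)] by auto
  have c: "continuous_on UNIV ?N" by (rule continuous_autocorrelation_convex) fact+
  show "continuous_on UNIV (autocorrelation (increment B z))"
    unfolding eq by (intro continuous_intros continuous_on_compose2[OF c]) auto
  fix v
  show "autocorrelation (increment B z) (- v) = autocorrelation (increment B z) v"
    by (rule autocorrelation_even) (simp add: increment_def[abs_def])
  note b = autocorrelation_indicator_bound[OF assms(2,3)]
  show "\<bar>autocorrelation (increment B z) v\<bar> \<le> 4 * measure lborel B * indicator (cball 0 R') v"
  proof (cases "norm v \<le> R'")
    case True
    then show ?thesis unfolding eq using b(1,2)[of v] b(1,2)[of "v + z"] b(1,2)[of "v - z"] by (simp
        add: abs_le_iff)
  next
    case False
    have "norm v \<le> norm (v + z) + norm z" "norm v \<le> norm (v - z) + norm z"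
      using norm_triangle_ineq4[of "v + z" z] norm_triangle_ineq[of "v - z" z] by auto
    then have "norm v > 2 * R" "norm (v + z) > 2 * R" "norm (v - z) > 2 * R"
      using False R' norm_ge_zero[of z] by linarith+
    then have "?N v = 0" "?N (v + z) = 0" "?N (v - z) = 0"
      using b(3)[of v] b(3)[of "v + z"] b(3)[of "v - z"] by auto
    then show ?thesis unfolding eq by simp
  qed
qed simp

section \<open>Scaling of windows\<close>

lemma mem_scaled: "r > 0 \<Longrightarrow> (x :: real ^ 'd) \<in> (*\<^sub>R) r ` W \<longleftrightarrow> (1 / r) *\<^sub>R x \<in> W"
  by (auto simp: image_iff intro!: bexI[of _ "(1 / r) *\<^sub>R x"])

lemma scaled_indicator:
  "r > 0 \<Longrightarrow> indicator ((*\<^sub>R) r ` W) (x :: real ^ 'd) = indicator W ((1 / r) *\<^sub>R x)"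
  by (simp add: indicator_def mem_scaled)

lemma scaled_sets:
  assumes "r > 0" and W [measurable]: "(W :: (real ^ 'd) set) \<in> sets borel"
  shows "(*\<^sub>R) r ` W \<in> sets borel"
proof -
  have "(*\<^sub>R) r ` W = (\<lambda>x. (1 / r) *\<^sub>R x) -` W \<inter> space borel"
    using mem_scaled[OF assms(1), of _ W] by auto
  then show ?thesis using measurable_sets[of "\<lambda>x. (1 / r) *\<^sub>R x" borel borel W] W by simp
qed

lemma scaled_measure:
  assumes r: "r > 0" and [measurable]: "(W :: (real ^ 'd) set) \<in> sets borel"
  shows "measure lborel ((*\<^sub>R) r ` W) = r ^ CARD('d) * measure lborel W"
proof -
  have [measurable]: "(*\<^sub>R) r ` W \<in> sets borel" by (rule scaled_sets) fact+
  have "measure lborel ((*\<^sub>R) r ` W) = (\<integral>x. indicator ((*\<^sub>R) r ` W) x \<partial>lborel)" by simp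
  also have "\<dots> = r ^ CARD('d) * (\<integral>x. indicator ((*\<^sub>R) r ` W) (0 + r *\<^sub>R x) \<partial>lborel)"
    using r by (subst integral_lborel_affine[of r _ 0]) auto
  also have "(\<integral>x. indicator ((*\<^sub>R) r ` W) (0 + r *\<^sub>R x) \<partial>lborel) = measure lborel W"
    using r by (simp add: scaled_indicator)
  finally show ?thesis .
qed

lemma scaled_autocorrelation:
  assumes r: "r > 0" and [measurable]: "(W :: (real ^ 'd) set) \<in> sets borel"
  shows "autocorrelation (indicator ((*\<^sub>R) r ` W)) u = r ^ CARD('d) * autocorrelation (indicator W)
      ((1 / r) *\<^sub>R u)"
proof -
  have "autocorrelation (indicator ((*\<^sub>R) r ` W)) u = (\<integral>x. indicator W ((1 / r) *\<^sub>R x) * indicator W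
      ((1 / r) *\<^sub>R (x + u)) \<partial>lborel)"
    by (simp add: autocorrelation_def scaled_indicator[OF r])
  also have "\<dots> = r ^ CARD('d) * (\<integral>x. indicator W ((1 / r) *\<^sub>R (0 + r *\<^sub>R x)) * indicator W ((1 / r)
      *\<^sub>R (0 + r *\<^sub>R x + u)) \<partial>lborel)"
    using r by (subst integral_lborel_affine[of r _ 0]) auto
  finally show ?thesis using r by (simp add: autocorrelation_def scaleR_add_right)
qed

section \<open>Fourier transforms of scaled convex windows and of their increments\<close>

locale convex_window =
  fixes W :: "(real ^ 'd) set" and \<rho> :: real
  assumes conv: "convex W" and borel_W [measurable]: "W \<in> sets borel" and ball_W: "W \<subseteq> cball 0 \<rho>"
      and rho: "\<rho> > 0"
    and volume: "measure lborel W > 0"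
begin

abbreviation scaled :: "real \<Rightarrow> (real ^ 'd) set" where "scaled r \<equiv> (*\<^sub>R) r ` W"

abbreviation N :: "real \<Rightarrow> real ^ 'd \<Rightarrow> real" where "N r \<equiv> autocorrelation (indicator (scaled r))"

lemma bounded_W: "bounded W"
  using ball_W bounded_subset by blast

lemma scaled_props:
  assumes "r > 0"
  shows "scaled r \<in> sets borel" "convex (scaled r)" "scaled r \<subseteq> cball 0 (r * \<rho>)" "bounded (scaled r)"
    "measure lborel (scaled r) = r ^ CARD('d) * measure lborel W"
proof -
  show "scaled r \<in> sets borel" "measure lborel (scaled r) = r ^ CARD('d) * measure lborel W"
    using assms by (auto intro: scaled_sets simp: scaled_measure)
  show "convex (scaled r)" by (rule convex_scaling[OF conv])
  show s: "scaled r \<subseteq> cball 0 (r * \<rho>)" using assms ball_W by auto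
  show "bounded (scaled r)" using s bounded_subset by blast
qed

lemma fourier_scaled:
  assumes r: "r > 0"
  shows "fourier_transform (\<lambda>x. complex_of_real (indicator (scaled r) x)) k = complex_of_real (r ^
      CARD('d)) * fourier_transform (indicator W) (r *\<^sub>R k)"
proof -
  note e = lborel_affine[OF less_imp_neq[OF r, symmetric], of "0 :: real ^ 'd"]
  have ind: "complex_of_real (indicator A x) = indicator A x" for A and x :: "real ^ 'd"
    by (simp add: indicator_def)
  have "fourier_transform (\<lambda>x. complex_of_real (indicator (scaled r) x)) k =
     (\<integral>x. indicator W ((1 / r) *\<^sub>R x) * exp (- \<i> * complex_of_real (k \<bullet> x)) \<partial>lborel)"
    by (simp add: fourier_transform_def ind scaled_indicator[OF r])
  also have "\<dots> = (r ^ CARD('d)) *\<^sub>R (\<integral>x. indicator W ((1 / r) *\<^sub>R (0 + r *\<^sub>R x)) * exp (- \<i> *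
      complex_of_real (k \<bullet> (0 + r *\<^sub>R x))) \<partial>lborel)"
    using r by (subst e, subst integral_density) (auto simp: integral_distr)
  also have "\<dots> = complex_of_real (r ^ CARD('d)) * fourier_transform (indicator W) (r *\<^sub>R k)"
    using r by (simp add: fourier_transform_def scaleR_conv_of_real[where 'a = complex])
  finally show ?thesis .
qed

text \<open>For such \<open>k\<close> the phase \<open>k \<bullet> x\<close> stays in [-1, 1] on the
  window, where the cosine is at least 1/2, so no cancellation occurs. This is what allows scaled
  windows to dominate in the spectral comparison.\<close>

lemma fourier_lower:
  assumes "norm k * \<rho> \<le> 1"
  shows "measure lborel W / 2 \<le> cmod (fourier_transform (indicator W) k)"
proof -
  have i: "integrable lborel (indicator W :: _ \<Rightarrow> real)"
    using emeasure_bounded_finite[OF bounded_W] by (simp add: integrable_indicator_iff)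
  have ic: "integrable lborel (\<lambda>x. indicator W x * cos (k \<bullet> x))" and iS: "integrable lborel (\<lambda>x.
      indicator W x * exp (- \<i> * complex_of_real (k \<bullet> x)))"
    by (rule Bochner_Integration.integrable_bound[OF i]; simp add: indicator_def norm_mult)+
  have half: "1 / 2 \<le> cos t" if "\<bar>t\<bar> \<le> 1" for t :: real
  proof -
    \<comment> \<open>Here 1 < pi / 3 because pi > 3, and cos (pi / 3) = 1/2.\<close>
    have "cos (pi / 3) \<le> cos \<bar>t\<bar>" using that pi_gt3 by (intro cos_monotone_0_pi_le) auto
    then show ?thesis by (simp add: cos_60)
  qed
  have "measure lborel W / 2 = (\<integral>x. (1 / 2) * indicator W x \<partial>lborel)" by simp
  also have "\<dots> \<le> (\<integral>x. indicator W x * cos (k \<bullet> x) \<partial>lborel)"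
  proof (intro integral_mono ic integrable_mult_right i)
    fix x
    have "\<bar>k \<bullet> x\<bar> \<le> 1" if "x \<in> W"
    proof -
      have "\<bar>k \<bullet> x\<bar> \<le> norm k * norm x" by (rule Cauchy_Schwarz_ineq2)
      also have "\<dots> \<le> norm k * \<rho>" using that ball_W by (intro mult_left_mono) auto
      finally show ?thesis using assms by simp
    qed
    then show "1 / 2 * indicator W x \<le> indicator W x * cos (k \<bullet> x)"
      using half[of "k \<bullet> x"] by (auto simp: indicator_def)
  qed
  also have "\<dots> = (\<integral>x. Re (indicator W x * exp (- \<i> * complex_of_real (k \<bullet> x))) \<partial>lborel)"
  proof (intro Bochner_Integration.integral_cong refl)
    fix x
    have "exp (- \<i> * complex_of_real (k \<bullet> x)) = cis (- (k \<bullet> x))" by (simp add: cis_conv_exp)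
    then show "indicator W x * cos (k \<bullet> x) = Re (indicator W x * exp (- \<i> * complex_of_real (k \<bullet> x)))"
      by (simp add: indicator_def)
  qed
  also have "\<dots> = Re (fourier_transform (indicator W) k)"
    unfolding fourier_transform_def by (rule integral_Re[OF iS])
  also have "\<dots> \<le> cmod (fourier_transform (indicator W) k)" by (rule complex_Re_le_cmod)
  finally show ?thesis .
qed

lemma fourier_increment:
  assumes r: "r > 0"
  shows "fourier_transform (\<lambda>x. complex_of_real (increment (scaled r) z x)) k =
    (1 - iexp (- (k \<bullet> z))) * fourier_transform (\<lambda>x. complex_of_real (indicator (scaled r) x)) k"
proof -
  note P = scaled_props[OF r]
  note [measurable] = P(1)
  let ?e = "\<lambda>x. exp (- \<i> * complex_of_real (k \<bullet> x))"
  have i: "integrable lborel (indicator (scaled r) :: _ \<Rightarrow> real)"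
    using emeasure_bounded_finite[OF P(4)] P(1) by (simp add: integrable_indicator_iff)
  have i1: "integrable lborel (\<lambda>x. complex_of_real (indicator (scaled r) x) * ?e x)"
    by (rule Bochner_Integration.integrable_bound[OF i]) (simp_all add: norm_mult)
  have i2: "integrable lborel (\<lambda>x. complex_of_real (indicator (scaled r) (x - z)) * ?e x)"
    by (rule Bochner_Integration.integrable_bound[OF integrable_lborel_shift(2)[OF i, of z]])
        (simp_all add: norm_mult)
  have sh: "(\<integral>x. complex_of_real (indicator (scaled r) (x - z)) * ?e x \<partial>lborel) = iexp (- (k \<bullet> z)) *
      (\<integral>x. complex_of_real (indicator (scaled r) x) * ?e x \<partial>lborel)"
  proof -
    have "(\<integral>x. complex_of_real (indicator (scaled r) (x - z)) * ?e x \<partial>lborel) = (\<integral>x. complex_of_real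
        (indicator (scaled r) (x - z)) * ?e x \<partial>distr lborel borel (\<lambda>x. z + 1 *\<^sub>R x))"
      by (subst distr_lborel_affine) auto
    also have "\<dots> = (\<integral>x. complex_of_real (indicator (scaled r) (z + 1 *\<^sub>R x - z)) * ?e (z + 1 *\<^sub>R x)
        \<partial>lborel)"
      by (rule integral_distr) measurable
    also have "\<dots> = (\<integral>x. iexp (- (k \<bullet> z)) * (complex_of_real (indicator (scaled r) x) * ?e x) \<partial>lborel)"
    proof (intro Bochner_Integration.integral_cong refl)
      fix x
      have "?e (z + 1 *\<^sub>R x) = iexp (- (k \<bullet> z)) * ?e x"
        unfolding exp_add[symmetric] by (simp add: inner_add_right algebra_simps)
      then show "complex_of_real (indicator (scaled r) (z + 1 *\<^sub>R x - z)) * ?e (z + 1 *\<^sub>R x) = iexp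
          (- (k \<bullet> z)) * (complex_of_real (indicator (scaled r) x) * ?e x)"
        by simp
    qed
    finally show ?thesis by simp
  qed
  have "fourier_transform (\<lambda>x. complex_of_real (increment (scaled r) z x)) k =
    (\<integral>x. complex_of_real (indicator (scaled r) x) * ?e x - complex_of_real (indicator (scaled r) (x
        - z)) * ?e x \<partial>lborel)"
    by (simp add: fourier_transform_def increment_def algebra_simps)
  also have "\<dots> = (\<integral>x. complex_of_real (indicator (scaled r) x) * ?e x \<partial>lborel) - (\<integral>x.
      complex_of_real (indicator (scaled r) (x - z)) * ?e x \<partial>lborel)"
    by (rule Bochner_Integration.integral_diff[OF i1 i2])
  finally show ?thesis unfolding sh by (simp add: fourier_transform_def algebra_simps)
qed

end

section \<open>Increments of Fourier smooth windows\<close>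

locale windowed_random_measure = stationary_random_measure M \<Phi> + convex_window W \<rho>
  for M :: "'w measure" and \<Phi> :: "'w \<Rightarrow> (real ^ 'd) measure" and W :: "(real ^ 'd) set" and \<rho> :: real
begin

lemma admissible_scaled: "r > 0 \<Longrightarrow> admissible (indicator (scaled r))"
  by (intro admissible_indicator scaled_props)

lemma admissible_increment:
  assumes "r > 0" shows "admissible (increment (scaled r) z)"
proof -
  have "admissible (\<lambda>x. indicator (scaled r) x - indicator (scaled r) (x - z))"
    using assms by (intro admissible_diff admissible_shift admissible_scaled)
  then show ?thesis by (simp add: increment_def[abs_def])
qed

lemma L_window_nonneg: "r > 0 \<Longrightarrow> 0 \<le> L (N r)"
  by (intro V_eq(5) admissible_scaled)

text \<open>A priori bound with a constant depending on \<open>T\<close>: the subtracted Lebesgue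
  part is dropped, and \<open>N r\<close> is at most the volume on a fixed ball of finite
  \<open>\<alpha>\<close>-measure and 0 outside. It makes suprema over bounded ranges of scales
  finite.\<close>

lemma L_window_growth:
  obtains C where "\<And>r. 0 < r \<Longrightarrow> r \<le> T \<Longrightarrow> L (N r) \<le> C * r ^ CARD('d)"
proof
  fix r assume r: "0 < r" "r \<le> T"
  note P = scaled_props[OF r(1)]
  let ?B = "cball 0 (2 * (T * \<rho>)) :: (real ^ 'd) set"
  have iB: "integrable \<alpha> (indicator ?B :: _ \<Rightarrow> real)"
    using emeasure_alpha_finite[of ?B] by (simp add: integrable_indicator_iff)
  have "L (N r) \<le> (\<integral>u. N r u \<partial>\<alpha>)"
    unfolding L_def using autocorrelation_indicator_bound(1)[OF P(3,1)] by simp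
  also have "\<dots> \<le> (\<integral>u. measure lborel (scaled r) * indicator ?B u \<partial>\<alpha>)"
  proof (intro integral_mono V_eq(1) admissible_scaled r integrable_mult_right iB)
    fix u
    have "r * \<rho> \<le> T * \<rho>" using r rho by (intro mult_right_mono) auto
    then have ind: "indicator (cball 0 (2 * (r * \<rho>))) u \<le> (indicator ?B u :: real)"
      by (auto simp: indicator_def)
    have "N r u \<le> measure lborel (scaled r) * indicator (cball 0 (2 * (r * \<rho>))) u"
      using autocorrelation_indicator_bound(3)[OF P(3,1), of u] by simp
    also have "\<dots> \<le> measure lborel (scaled r) * indicator ?B u"
      by (intro mult_left_mono ind) auto
    finally show "N r u \<le> measure lborel (scaled r) * indicator ?B u" .
  qed
  also have "\<dots> = (measure lborel W * measure \<alpha> ?B) * r ^ CARD('d)"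
    using P(5) by simp
  finally show "L (N r) \<le> (measure lborel W * measure \<alpha> ?B) * r ^ CARD('d)" .
qed

text \<open>The least \<open>j\<close> that brings the frequency into the range of
  \<open>fourier_lower\<close> after scaling by 2^-j. Minimality gives the reverse bound, with the
  constant 1 covering j = 0 and 2 \<rho> covering j > 0.\<close>

lemma dyadic_scale:
  assumes "0 \<le> x"
  obtains j where "x * \<rho> \<le> 2 ^ j" "2 ^ j \<le> max 1 (2 * \<rho>) * (1 + x)"
proof -
  define j where "j = (LEAST j. x * \<rho> \<le> 2 ^ j)"
  have "(1 :: real) < 2" by simp
  then obtain n where "x * \<rho> < 2 ^ n" using real_arch_pow by blast
  then have "\<exists>n. x * \<rho> \<le> 2 ^ n" using less_imp_le by blast
  then have j: "x * \<rho> \<le> 2 ^ j" unfolding j_def by (rule LeastI_ex)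
  have m: "1 * (1 + x) \<le> max 1 (2 * \<rho>) * (1 + x)" "2 * \<rho> * (1 + x) \<le> max 1 (2 * \<rho>) * (1 + x)"
    using assms by (intro mult_right_mono; simp)+
  have "2 ^ j \<le> max 1 (2 * \<rho>) * (1 + x)"
  proof (cases j)
    case 0
    then have "2 ^ j \<le> 1 * (1 + x)" using assms by simp
    then show ?thesis using m(1) by (rule order_trans)
  next
    case (Suc i)
    then have "\<not> x * \<rho> \<le> 2 ^ i" unfolding j_def using not_less_Least[of i "\<lambda>j. x * \<rho> \<le> 2 ^ j"] by auto
    then have "2 ^ j \<le> 2 * \<rho> * x" using Suc by (simp add: mult_ac)
    also have "\<dots> \<le> 2 * \<rho> * (1 + x)" using rho by (intro mult_left_mono) auto
    finally show ?thesis using m(2) by (rule order_trans)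
  qed
  then show thesis using j that by blast
qed

text \<open>A frequency \<open>k\<close> is charged to a window of scale r / 2^j with 2^j comparable
  to 1 + r |k|. There Fourier smoothness bounds the increment from above and
  \<open>fourier_lower\<close> bounds the window from below, so a weighted sum over \<open>j\<close>
  dominates. \<open>\<Omega>\<close> collects the weights after the growth hypothesis is inserted;
  that hypothesis concerns only scales up to \<open>r\<close>, as a bootstrap over scales
  requires.\<close>

lemma increment_variance_bound:
  assumes "fourier_smooth W"
  obtains \<Omega> :: "real \<Rightarrow> real" and B where "\<Omega> \<in> borel_measurable borel" "\<And>t. 0 \<le> \<Omega> t" "\<And>t. \<Omega> t \<le> B"
    "\<And>t. t \<longlonglongrightarrow> 0 \<Longrightarrow> (\<lambda>n. \<Omega> (t n)) \<longlonglongrightarrow> 0"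
    "\<And>r A z. 0 < r \<Longrightarrow> (\<And>s. 0 < s \<Longrightarrow> s \<le> r \<Longrightarrow> L (N s) \<le> A * s ^ CARD('d)) \<Longrightarrow>
      L (autocorrelation (increment (scaled r) z)) \<le> A * r ^ CARD('d) * \<Omega> (norm z / r)"
proof -
  let ?d = "CARD('d)"
  obtain c \<theta> where c: "c > 0" "\<theta> > 0"
    and smooth: "\<And>k. cmod (fourier_transform (indicator W) k) \<le> c * (1 + norm k) powr (- (real ?d +
        \<theta>) / 2)"
    using assms unfolding fourier_smooth_def by blast
  \<comment> \<open>Exponent of decay of the squared transform.\<close>
  define e where "e = real ?d + \<theta>"
  define v where "v = measure lborel W"
  define p where "p = 2 powr (- e)"
  \<comment> \<open>Ratio of the final geometric series: the decay 2^(-(d + \<theta>)) per dyadic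
    step against the growth 2^d, that is 2^(-\<theta>) < 1.\<close>
  define q where "q = 2 ^ ?d * p"
  define C2 where "C2 = max 1 (2 * \<rho>)"
  \<comment> \<open>The factor c^2 C2^e comes from the upper bound by smoothness and 4 / v^2 from
    the lower bound v / 2 in \<open>fourier_lower\<close>.\<close>
  define C0 where "C0 = 4 * c\<^sup>2 * C2 powr e / v\<^sup>2"
  \<comment> \<open>Bound for the squared modulus of the phase factor 1 - exp (- i (k \<bullet> z)):
    4 always, and (|k| |z|)^2 with |k| \<le> 2^j / (r \<rho>). The second alternative makes
    \<open>\<Omega>\<close> vanish at 0, the first keeps the series convergent.\<close>
  define m where "m j t = min 4 (4 ^ j * t\<^sup>2 / \<rho>\<^sup>2)" for j :: nat and t :: real
  define \<Omega> where "\<Omega> t = (\<Sum>j. C0 * q ^ j * m j t)" for t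
  have v: "v > 0" using volume by (simp add: v_def)
  have p: "p > 0" by (simp add: p_def)
  have "q = 2 powr (- \<theta>)"
    unfolding q_def p_def e_def by (simp add: powr_add[symmetric] flip: powr_realpow)
  then have q: "0 < q" "q < 1" using c powr_less_mono[of "- \<theta>" 0 2] by auto
  have C2: "C2 > 0" by (simp add: C2_def)
  have C0: "C0 > 0" using c v C2 by (simp add: C0_def)
  have m: "0 \<le> m j t" "m j t \<le> 4" for j t by (auto simp: m_def)
  have bd: "norm (C0 * q ^ j * m j t) \<le> C0 * 4 * q ^ j" for j t
    using mult_left_mono[OF m(2), of "C0 * q ^ j" j t] m[of j t] C0 q by (simp add: abs_mult mult_ac)
  have sumb: "summable (\<lambda>j. C0 * 4 * q ^ j)" using q by (intro summable_mult summable_geometric) simp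
  have summ: "summable (\<lambda>j. C0 * q ^ j * m j t)" for t
    by (rule summable_comparison_test'[OF sumb bd])
  show thesis
  proof (rule that[of \<Omega> "\<Sum>j. C0 * 4 * q ^ j"])
    show "\<Omega> \<in> borel_measurable borel" unfolding \<Omega>_def m_def by measurable
    show "0 \<le> \<Omega> t" for t unfolding \<Omega>_def using C0 q m by (intro suminf_nonneg summ) simp
    show "\<Omega> t \<le> (\<Sum>j. C0 * 4 * q ^ j)" for t
      unfolding \<Omega>_def using bd by (intro suminf_le summ sumb) (auto intro: order_trans[OF abs_ge_self])
    show "(\<lambda>n. \<Omega> (t n)) \<longlonglongrightarrow> 0" if t: "t \<longlonglongrightarrow> 0" for t
    proof -
      have l: "(\<lambda>n. C0 * q ^ j * m j (t n)) \<longlonglongrightarrow> C0 * q ^ j * m j 0" for j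
        unfolding m_def using rho by (intro tendsto_intros t) auto
      have "(\<lambda>n. \<Sum>j. C0 * q ^ j * m j (t n)) \<longlonglongrightarrow> (\<Sum>j. C0 * q ^ j * m j 0)"
        using tannerys_theorem[where a = "\<lambda>j n. C0 * q ^ j * m j (t n)" and F = sequentially and M =
            "\<lambda>j. C0 * 4 * q ^ j", OF l _ sumb] bd
        by (auto intro!: always_eventually)
      then show ?thesis by (simp add: \<Omega>_def m_def)
    qed
    fix r A :: real and z :: "real ^ 'd"
    assume r: "0 < r" and A: "\<And>s. 0 < s \<Longrightarrow> s \<le> r \<Longrightarrow> L (N s) \<le> A * s ^ ?d"
    define t where "t = norm z / r"
    \<comment> \<open>Weight of scale \<open>j\<close>; the power (4^d)^j compensates the factor (r
      / 2^j)^(2d) in the squared transform of the smaller window.\<close>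
    define a where "a j = C0 * (4 ^ ?d) ^ j * p ^ j * m j t" for j
    define rr where "rr j = r / 2 ^ j" for j :: nat
    have rr: "0 < rr j" "rr j \<le> r" for j
      using r by (auto simp: rr_def divide_le_eq)
    have rrd: "rr j ^ ?d = r ^ ?d / (2 ^ ?d) ^ j" for j
      by (simp add: rr_def power_divide power_mult[symmetric] mult.commute)
    have a0: "0 \<le> a j" for j using C0 p m by (simp add: a_def)
    \<comment> \<open>The variance bound supplies (r / 2^j)^d, half of the power compensated in
      \<open>a\<close>, which turns 4^d p into q = 2^d p.\<close>
    have ar: "a j * rr j ^ ?d = r ^ ?d * (C0 * q ^ j * m j t)" for j
    proof -
      have "(4 :: real) ^ ?d = 2 ^ ?d * 2 ^ ?d" by (simp flip: power_mult_distrib)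
      then show ?thesis by (simp add: a_def rrd q_def power_mult_distrib)
    qed
    define R' where "R' = 2 * (r * \<rho>) + norm z"
    have G: "even_bump (rr j ^ ?d * v) R' (N (rr j))" for j
    proof -
      have "2 * (rr j * \<rho>) \<le> R'"
        using mult_right_mono[OF rr(2), of \<rho> j] rho norm_ge_zero[of z] unfolding R'_def by linarith
      from even_bump_indicator[OF scaled_props(2,3,1)[OF rr(1)] this] show ?thesis
        by (simp add: scaled_props(5)[OF rr(1)] v_def)
    qed
    have F: "even_bump (4 * measure lborel (scaled r)) R' (autocorrelation (increment (scaled r) z))"
      by (rule even_bump_increment[OF scaled_props(2,3,1)[OF r]]) (simp add: R'_def)
    have intg: "integrable lborel (increment (scaled r) z)" "integrable lborel (indicator (scaled s)
        :: _ \<Rightarrow> real)" if "s > 0" for s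
      using admissible_increment[OF r] admissible_scaled[OF that] by (auto simp: admissible_def)
    have ctF: "cos_transform (autocorrelation (increment (scaled r) z)) k =
        (cmod (1 - iexp (- (k \<bullet> z))))\<^sup>2 * (r ^ ?d)\<^sup>2 * (cmod (fourier_transform (indicator W) (r *\<^sub>R
            k)))\<^sup>2" for k
      unfolding cos_transform_autocorrelation[OF intg(1)[OF r]] fourier_increment[OF r]
          fourier_scaled[OF r]
      using r by (simp add: norm_mult power_mult_distrib norm_power)
    have ctG: "cos_transform (N s) k = (s ^ ?d)\<^sup>2 * (cmod (fourier_transform (indicator W) (s *\<^sub>R
        k)))\<^sup>2" if "s > 0" for s k
      unfolding cos_transform_autocorrelation[OF intg(2)[OF that]] fourier_scaled[OF that]
      using that by (simp add: norm_mult power_mult_distrib norm_power)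
    have "L (autocorrelation (increment (scaled r) z)) \<le> (\<Sum>j. a j * L (N (rr j)))"
    proof (rule spectral_domination(2)[OF F G])
      show "0 \<le> cos_transform (autocorrelation (increment (scaled r) z)) k" for k by (simp add: ctF)
      show "0 \<le> cos_transform (N (rr j)) k" for j k by (simp add: ctG rr)
      have "a j * (rr j ^ ?d * v) = r ^ ?d * v * (C0 * q ^ j * m j t)" for j
      proof -
        have "a j * (rr j ^ ?d * v) = (a j * rr j ^ ?d) * v" by (rule mult.assoc[symmetric])
        then show ?thesis unfolding ar by (simp only: mult_ac)
      qed
      then show "summable (\<lambda>j. a j * (rr j ^ ?d * v))" using summable_mult[OF summ] by (simp only:)
      fix k :: "real ^ 'd"
      obtain j where j: "r * norm k * \<rho> \<le> 2 ^ j" "2 ^ j \<le> C2 * (1 + r * norm k)"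
        using dyadic_scale[of "r * norm k"] r unfolding C2_def by auto
      have up: "(cmod (fourier_transform (indicator W) (r *\<^sub>R k)))\<^sup>2 \<le> c\<^sup>2 * (p ^ j * C2 powr e)"
      proof -
        have "(cmod (fourier_transform (indicator W) (r *\<^sub>R k)))\<^sup>2 \<le> (c * (1 + r * norm k) powr (- e
            / 2))\<^sup>2"
          using smooth[of "r *\<^sub>R k"] r by (intro power_mono) (auto simp: e_def)
        also have "\<dots> = c\<^sup>2 * (1 + r * norm k) powr (- e)"
          by (simp add: power_mult_distrib power2_eq_square powr_add[symmetric])
        also have "(1 + r * norm k) powr (- e) \<le> (2 ^ j / C2) powr (- e)"
          using j(2) C2 c by (intro powr_mono2') (auto simp: e_def divide_le_eq mult.commute)
        also have "(2 ^ j / C2) powr (- e) = (2 ^ j) powr (- e) * C2 powr e"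
          using C2 by (simp add: powr_divide powr_minus_divide)
        also have "(2 ^ j) powr (- e) = p ^ j"
          by (simp add: p_def powr_realpow[symmetric] powr_powr mult.commute)
        finally show ?thesis using c by (simp add: mult_left_mono)
      qed
      have low: "v\<^sup>2 / 4 \<le> (cmod (fourier_transform (indicator W) (rr j *\<^sub>R k)))\<^sup>2"
      proof -
        have "norm (rr j *\<^sub>R k) * \<rho> \<le> 1" using j(1) r by (simp add: rr_def divide_le_eq)
        then have "v / 2 \<le> cmod (fourier_transform (indicator W) (rr j *\<^sub>R k))"
          unfolding v_def by (rule fourier_lower)
        then have "(v / 2)\<^sup>2 \<le> (cmod (fourier_transform (indicator W) (rr j *\<^sub>R k)))\<^sup>2"
          using v by (intro power_mono) auto
        then show ?thesis by (simp add: power_divide)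
      qed
      have ph: "(cmod (1 - iexp (- (k \<bullet> z))))\<^sup>2 \<le> m j t"
      proof -
        let ?x = "- (k \<bullet> z)"
        have "cmod (1 - iexp ?x) \<le> cmod 1 + cmod (iexp ?x)" by (rule norm_triangle_ineq4)
        then have "cmod (1 - iexp ?x) \<le> 2" by simp
        then have 1: "(cmod (1 - iexp ?x))\<^sup>2 \<le> 4" using power_mono[of "cmod (1 - iexp ?x)" 2 2] by simp
        have "cmod (1 - iexp ?x) \<le> \<bar>?x\<bar>"
          using iexp_approx1[of ?x 0] by (simp add: norm_minus_commute)
        also have "\<dots> \<le> norm k * norm z" using Cauchy_Schwarz_ineq2[of k z] by simp
        also have "\<dots> \<le> (2 ^ j / (r * \<rho>)) * norm z"
          using j(1) r rho by (intro mult_right_mono) (auto simp: le_divide_eq mult_ac)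
        finally have "(cmod (1 - iexp ?x))\<^sup>2 \<le> ((2 ^ j / (r * \<rho>)) * norm z)\<^sup>2" by (intro power_mono)
            auto
        also have "\<dots> = 4 ^ j * t\<^sup>2 / \<rho>\<^sup>2"
        proof -
          have "(2 ^ j)\<^sup>2 = (4 :: real) ^ j" by (simp add: power2_eq_square flip: power_mult_distrib)
          then show ?thesis by (simp add: t_def power_mult_distrib power_divide)
        qed
        finally show ?thesis using 1 by (simp add: m_def)
      qed
      have "cos_transform (autocorrelation (increment (scaled r) z)) k \<le> m j t * (r ^ ?d)\<^sup>2 * (c\<^sup>2 *
          (p ^ j * C2 powr e))"
        unfolding ctF using m[of j t] by (intro mult_mono up ph) auto
      \<comment> \<open>The constants \<open>C0\<close> and \<open>a\<close> were defined so as to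
        make this an equality.\<close>
      also have "\<dots> = a j * ((rr j ^ ?d)\<^sup>2 * (v\<^sup>2 / 4))"
      proof -
        have "((4 :: real) ^ ?d) ^ j = ((2 ^ ?d) ^ j)\<^sup>2" for j :: nat
        proof -
          have "(4 :: real) ^ ?d = (2 ^ ?d)\<^sup>2" by (simp add: power2_eq_square flip: power_mult_distrib)
          then have "((4 :: real) ^ ?d) ^ j = ((2 ^ ?d)\<^sup>2) ^ j" by (simp only:)
          then show ?thesis by (simp only: power_mult[symmetric] mult_ac)
        qed
        then show ?thesis using v by (simp add: a_def C0_def rrd power_divide field_simps)
      qed
      also have "\<dots> \<le> a j * cos_transform (N (rr j)) k"
        unfolding ctG[OF rr(1)] using a0 low by (intro mult_left_mono) auto
      finally show "\<exists>j. cos_transform (autocorrelation (increment (scaled r) z)) k \<le> a j *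
          cos_transform (N (rr j)) k" ..
    qed (use a0 in auto)
    also have "\<dots> \<le> (\<Sum>j. A * r ^ ?d * (C0 * q ^ j * m j t))"
    proof (rule suminf_le)
      show le: "a j * L (N (rr j)) \<le> A * r ^ ?d * (C0 * q ^ j * m j t)" for j
      proof -
        have "a j * L (N (rr j)) \<le> a j * (A * rr j ^ ?d)" by (intro mult_left_mono A rr a0)
        also have "\<dots> = A * (a j * rr j ^ ?d)" by (rule mult.left_commute)
        also have "\<dots> = A * r ^ ?d * (C0 * q ^ j * m j t)" unfolding ar by (rule mult.assoc[symmetric])
        finally show ?thesis .
      qed
      show s: "summable (\<lambda>j. A * r ^ ?d * (C0 * q ^ j * m j t))" by (intro summable_mult summ)
      show "summable (\<lambda>j. a j * L (N (rr j)))"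
        by (rule summable_comparison_test'[OF s]) (use le a0 L_window_nonneg rr in \<open>auto simp:
            abs_mult\<close>)
    qed
    also have "\<dots> = A * r ^ ?d * \<Omega> (norm z / r)"
      unfolding \<Omega>_def t_def by (rule suminf_mult[OF summ])
    finally show "L (autocorrelation (increment (scaled r) z)) \<le> A * r ^ ?d * \<Omega> (norm z / r)" .
  qed
qed

end

section \<open>Displacement by an independent stationary field\<close>

lemma space_skorohod_algebra: "space skorohod_algebra = skorohod_space"
  by (simp add: skorohod_algebra_def space_restrict_space space_PiM)

lemma skorohod_component:
  "(\<lambda>w :: real ^ 'd \<Rightarrow> real ^ 'd. w x) \<in> measurable skorohod_algebra borel"
  unfolding skorohod_algebra_def
  by (intro measurable_restrict_space1 measurable_component_singleton) simp

text \<open>Upper corner of the cell with index \<open>f\<close> in the grid of mesh 1 / (n + 1). It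
  exceeds the points of the half-open cell strictly in every coordinate, so evaluations at it
  approximate from the quadrant in which elements of the Skorohod space are continuous.\<close>

definition grid_above :: "nat \<Rightarrow> ('d \<Rightarrow> int) \<Rightarrow> real ^ 'd" where
  "grid_above n f = (\<chi> i. (real_of_int (f i) + 1) / real (Suc n))"

definition grid_index :: "nat \<Rightarrow> real ^ 'd \<Rightarrow> 'd \<Rightarrow> int" where
  "grid_index n x i = \<lfloor>real (Suc n) * x $ i\<rfloor>"

lemma grid_index_measurable [measurable]:
  "grid_index n \<in> measurable borel (count_space (UNIV :: ('d :: finite \<Rightarrow> int) set))"
proof -
  have "(grid_index n :: real ^ 'd \<Rightarrow> _) -` {f} \<inter> space borel \<in> sets borel" for f
  proof -
    have "(grid_index n :: real ^ 'd \<Rightarrow> _) -` {f} \<inter> space borel = (\<Inter>i\<in>UNIV. {x. real_of_int (f i) \<le>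
        real (Suc n) * x $ i \<and> real (Suc n) * x $ i < real_of_int (f i) + 1})"
      by (auto simp: grid_index_def fun_eq_iff floor_eq_iff)
    also have "\<dots> \<in> sets borel"
      by (intro sets.finite_INT) auto
    finally show ?thesis .
  qed
  then show ?thesis by (subst measurable_count_space_eq2_countable) auto
qed

lemma grid_above_bounds:
  "x $ i < grid_above n (grid_index n x) $ i" "grid_above n (grid_index n x) $ i \<le> x $ i + 1 / real
      (Suc n)"
proof -
  have p: "real (Suc n) > 0" by simp
  show "x $ i < grid_above n (grid_index n x) $ i"
    unfolding grid_above_def grid_index_def using p by (simp add: less_divide_eq mult.commute)
  have "(real_of_int \<lfloor>real (Suc n) * x $ i\<rfloor> + 1) / real (Suc n) \<le> (real (Suc n) * x $ i + 1) / real
      (Suc n)"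
    by (intro divide_right_mono) auto
  also have "\<dots> = x $ i + 1 / real (Suc n)" using p by (simp add: add_divide_distrib del: of_nat_Suc)
  finally show "grid_above n (grid_index n x) $ i \<le> x $ i + 1 / real (Suc n)"
    by (simp add: grid_above_def grid_index_def)
qed

text \<open>The grid points converge to \<open>x\<close> from within \<open>quadrant x UNIV\<close>,
  where right-continuity provides the limit \<open>w x\<close>.\<close>

lemma skorohod_grid_limit:
  fixes w :: "real ^ 'd \<Rightarrow> real ^ 'd"
  assumes w: "w \<in> skorohod_space"
  shows "(\<lambda>n. w (grid_above n (grid_index n x))) \<longlonglongrightarrow> w x"
proof -
  let ?g = "\<lambda>n. grid_above n (grid_index n x)"
  have "?g \<longlonglongrightarrow> x"
  proof (rule vec_tendstoI)
    fix i
    have "(\<lambda>n. x $ i + 1 / real (Suc n)) \<longlonglongrightarrow> x $ i + 0"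
      by (intro tendsto_add tendsto_const LIMSEQ_Suc[OF lim_1_over_n])
    then have u: "(\<lambda>n. x $ i + 1 / real (Suc n)) \<longlonglongrightarrow> x $ i" by simp
    show "(\<lambda>n. ?g n $ i) \<longlonglongrightarrow> x $ i"
    proof (rule tendsto_sandwich[OF _ _ tendsto_const u])
      show "eventually (\<lambda>n. x $ i \<le> ?g n $ i) sequentially" "eventually (\<lambda>n. ?g n $ i \<le> x $ i + 1 /
          real (Suc n)) sequentially"
        by (intro always_eventually allI less_imp_le[OF grid_above_bounds(1)] grid_above_bounds(2))+
    qed
  qed
  moreover have "?g n \<in> quadrant x UNIV" for n
    unfolding quadrant_def using less_imp_le[OF grid_above_bounds(1)[of x _ n]] by simp
  \<comment> \<open>The filter \<open>at x within\<close> leaves out \<open>x\<close> itself;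
    strictness of the grid bound is used here.\<close>
  moreover have "?g n \<noteq> x" for n
    by (metis less_irrefl grid_above_bounds(1))
  ultimately have "filterlim ?g (at x within quadrant x UNIV) sequentially"
    by (simp add: filterlim_at)
  moreover have "(w \<longlongrightarrow> w x) (at x within quadrant x UNIV)" using w by (simp add: skorohod_space_def)
  ultimately show ?thesis by (rule filterlim_compose[rotated])
qed

text \<open>For arbitrary functions with the product sigma-field the evaluation is not jointly
  measurable. On the Skorohod space it is a limit of maps that, cell by cell of a countable grid,
  evaluate at a fixed point.\<close>

lemma skorohod_eval_measurable:
  "(\<lambda>p. fst p (snd p)) \<in> measurable (skorohod_algebra \<Otimes>\<^sub>M borel) (borel :: (real ^ 'd) measure)"
proof (rule borel_measurable_LIMSEQ_metric[where f = "\<lambda>n p. fst p (grid_above n (grid_index n (snd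
    p)))"])
  fix n
  have 1: "(\<lambda>p. fst p (grid_above n f)) \<in> borel_measurable ((skorohod_algebra :: (real ^ 'd \<Rightarrow> real ^
      'd) measure) \<Otimes>\<^sub>M borel)" for f
    by (rule measurable_compose[OF measurable_fst skorohod_component])
  have 2: "(\<lambda>p. grid_index n (snd p)) \<in> measurable ((skorohod_algebra :: (real ^ 'd \<Rightarrow> real ^ 'd)
      measure) \<Otimes>\<^sub>M borel) (count_space UNIV)"
    by (rule measurable_compose[OF measurable_snd grid_index_measurable])
  show "(\<lambda>p. fst p (grid_above n (grid_index n (snd p)))) \<in> borel_measurable ((skorohod_algebra ::
      (real ^ 'd \<Rightarrow> real ^ 'd) measure) \<Otimes>\<^sub>M borel)"
    by (rule measurable_compose_countable[where f = "\<lambda>f p. fst p (grid_above n f)", OF 1 2])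
next
  fix p :: "(real ^ 'd \<Rightarrow> real ^ 'd) \<times> (real ^ 'd)"
  assume "p \<in> space (skorohod_algebra \<Otimes>\<^sub>M borel)"
  then have "fst p \<in> skorohod_space" by (auto simp: space_pair_measure space_skorohod_algebra)
  then show "(\<lambda>n. fst p (grid_above n (grid_index n (snd p)))) \<longlonglongrightarrow> fst p (snd p)"
    by (rule skorohod_grid_limit)
qed

lemma skorohod_space_shift:
  fixes w :: "real ^ 'd \<Rightarrow> real ^ 'd"
  assumes w: "w \<in> skorohod_space"
  shows "(\<lambda>y. w (y + x)) \<in> skorohod_space"
proof -
  have f: "filterlim (\<lambda>y. y + x) (at (p + x) within quadrant (p + x) I) (at p within quadrant p I)"
      for p I
  proof -
    have "((\<lambda>y. y + x) \<longlongrightarrow> p + x) (at p within quadrant p I)" by (intro tendsto_intros)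
    moreover have "eventually (\<lambda>y. y + x \<in> quadrant (p + x) I \<and> y + x \<noteq> p + x) (at p within quadrant
        p I)"
      by (auto simp: eventually_at_filter quadrant_def)
    ultimately show ?thesis by (simp add: filterlim_at)
  qed
  show ?thesis
    unfolding skorohod_space_def
  proof (intro CollectI allI conjI)
    fix p I
    obtain l where "(w \<longlongrightarrow> l) (at (p + x) within quadrant (p + x) I)" using w by (auto simp:
        skorohod_space_def)
    from filterlim_compose[OF this f] show "\<exists>l. ((\<lambda>y. w (y + x)) \<longlongrightarrow> l) (at p within quadrant p I)" by
        blast
    have "(w \<longlongrightarrow> w (p + x)) (at (p + x) within quadrant (p + x) UNIV)" using w by (auto simp:
        skorohod_space_def)
    from filterlim_compose[OF this f] show "((\<lambda>y. w (y + x)) \<longlongrightarrow> w (p + x)) (at p within quadrant p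
        UNIV)" .
  qed
qed

section \<open>Independence, stationarity of the field and smeared windows\<close>

locale displaced_random_measure = stationary_random_measure M \<Phi>
  for M :: "'w measure" and \<Phi> :: "'w \<Rightarrow> (real ^ 'd) measure" +
  fixes Z :: "'w \<Rightarrow> real ^ 'd \<Rightarrow> real ^ 'd"
  assumes Z [measurable]: "Z \<in> measurable M skorohod_algebra"
    and stationary_Z: "stationary_field M Z"
    and indep: "independent_elements M skorohod_algebra Z locally_finite_algebra \<Phi>"
begin

lemma Z_eval_measurable [measurable (raw)]:
  assumes "f \<in> measurable A M" "g \<in> measurable A borel"
  shows "(\<lambda>a. Z (f a) (g a)) \<in> measurable A borel"
proof -
  have "(\<lambda>a. (Z (f a), g a)) \<in> measurable A (skorohod_algebra \<Otimes>\<^sub>M borel)"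
    using measurable_compose[OF assms(1) Z] assms(2) by simp
  from measurable_compose[OF this skorohod_eval_measurable] show ?thesis by simp
qed

text \<open>Independence is given for the generated sigma-fields; evaluated on rectangles it
  identifies the joint law as a product.\<close>

lemma joint_distribution:
  "distr M (skorohod_algebra \<Otimes>\<^sub>M locally_finite_algebra) (\<lambda>\<omega>. (Z \<omega>, \<Phi> \<omega>)) =
   distr M skorohod_algebra Z \<Otimes>\<^sub>M distr M locally_finite_algebra \<Phi>"
proof (rule pair_measure_eqI[symmetric])
  show "sigma_finite_measure (distr M skorohod_algebra Z)" "sigma_finite_measure (distr M
      locally_finite_algebra \<Phi>)"
    by (simp_all add: prob_space_distr prob_space_imp_sigma_finite)
  show "sets (distr M skorohod_algebra Z \<Otimes>\<^sub>M distr M locally_finite_algebra \<Phi>) =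
      sets (distr M (skorohod_algebra \<Otimes>\<^sub>M locally_finite_algebra) (\<lambda>\<omega>. (Z \<omega>, \<Phi> \<omega>)))"
    by (simp cong: sets_pair_measure_cong)
  fix A B assume "A \<in> sets (distr M skorohod_algebra Z)" "B \<in> sets (distr M locally_finite_algebra \<Phi>)"
  then have A [measurable]: "A \<in> sets skorohod_algebra" and B [measurable]: "B \<in> sets
      locally_finite_algebra" by auto
  have "prob ((Z -` A \<inter> space M) \<inter> (\<Phi> -` B \<inter> space M)) = prob (Z -` A \<inter> space M) * prob (\<Phi> -` B \<inter>
      space M)"
    using indep unfolding independent_elements_def
    by (rule indep_setD) (auto intro: in_vimage_algebra)
  moreover have "(\<lambda>\<omega>. (Z \<omega>, \<Phi> \<omega>)) -` (A \<times> B) \<inter> space M = (Z -` A \<inter> space M) \<inter> (\<Phi> -` B \<inter> space M)" by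
      auto
  ultimately show "emeasure (distr M skorohod_algebra Z) A * emeasure (distr M
      locally_finite_algebra \<Phi>) B =
       emeasure (distr M (skorohod_algebra \<Otimes>\<^sub>M locally_finite_algebra) (\<lambda>\<omega>. (Z \<omega>, \<Phi> \<omega>))) (A \<times> B)"
    by (simp add: emeasure_distr emeasure_eq_measure ennreal_mult)
qed

text \<open>Conditioning on \<open>\<Phi>\<close> written without conditional expectations: the
  measure is frozen at one sample point while the field runs over an independent one.\<close>

lemma nn_integral_independent:
  assumes G [measurable]: "G \<in> borel_measurable (skorohod_algebra \<Otimes>\<^sub>M locally_finite_algebra)"
  shows "(\<integral>\<^sup>+\<omega>. G (Z \<omega>, \<Phi> \<omega>) \<partial>M) = (\<integral>\<^sup>+\<omega>. \<integral>\<^sup>+\<omega>'. G (Z \<omega>', \<Phi> \<omega>) \<partial>M \<partial>M)"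
proof -
  interpret PZ: prob_space "distr M skorohod_algebra Z" by (rule prob_space_distr) measurable
  interpret PP: prob_space "distr M locally_finite_algebra \<Phi>" by (rule prob_space_distr) measurable
  interpret P: pair_sigma_finite "distr M skorohod_algebra Z" "distr M locally_finite_algebra \<Phi>" ..
  have "(\<integral>\<^sup>+\<omega>. G (Z \<omega>, \<Phi> \<omega>) \<partial>M) = (\<integral>\<^sup>+p. G p \<partial>(distr M skorohod_algebra Z \<Otimes>\<^sub>M distr M
      locally_finite_algebra \<Phi>))"
    unfolding joint_distribution[symmetric] by (subst nn_integral_distr) auto
  also have "\<dots> = (\<integral>\<^sup>+N. \<integral>\<^sup>+w. G (w, N) \<partial>distr M skorohod_algebra Z \<partial>distr M locally_finite_algebra \<Phi>)"
    by (rule P.nn_integral_snd[symmetric]) (simp cong: measurable_cong_sets sets_pair_measure_cong)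
  also have "\<dots> = (\<integral>\<^sup>+\<omega>. \<integral>\<^sup>+w. G (w, \<Phi> \<omega>) \<partial>distr M skorohod_algebra Z \<partial>M)"
    by (rule nn_integral_distr) measurable
  also have "\<dots> = (\<integral>\<^sup>+\<omega>. \<integral>\<^sup>+\<omega>'. G (Z \<omega>', \<Phi> \<omega>) \<partial>M \<partial>M)"
  proof (rule nn_integral_cong)
    fix \<omega> assume "\<omega> \<in> space M"
    then have "\<Phi> \<omega> \<in> space locally_finite_algebra" by (rule measurable_space[OF random])
    then show "(\<integral>\<^sup>+w. G (w, \<Phi> \<omega>) \<partial>distr M skorohod_algebra Z) = (\<integral>\<^sup>+\<omega>'. G (Z \<omega>', \<Phi> \<omega>) \<partial>M)"
      by (intro nn_integral_distr) measurable
  qed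
  finally show ?thesis .
qed

lemma shift_Z_measurable [measurable]: "(\<lambda>\<omega> y. Z \<omega> (y + x)) \<in> measurable M skorohod_algebra"
  unfolding skorohod_algebra_def
proof (rule measurable_restrict_space2)
  show "(\<lambda>\<omega> y. Z \<omega> (y + x)) \<in> space M \<rightarrow> skorohod_space"
    using measurable_space[OF Z] by (auto simp: space_skorohod_algebra intro: skorohod_space_shift)
  show "(\<lambda>\<omega> y. Z \<omega> (y + x)) \<in> M \<rightarrow>\<^sub>M Pi\<^sub>M UNIV (\<lambda>x. borel)"
    by (rule measurable_PiM_single') (auto simp: space_PiM)
qed

lemma stationary_Z_nn:
  assumes [measurable]: "g \<in> borel_measurable (borel \<Otimes>\<^sub>M borel)"
  shows "(\<integral>\<^sup>+\<omega>. g (Z \<omega> x, Z \<omega> y) \<partial>M) = (\<integral>\<^sup>+\<omega>. g (Z \<omega> 0, Z \<omega> (y - x)) \<partial>M)"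
proof -
  note skorohod_component [measurable]
  have "(\<integral>\<^sup>+\<omega>. g (Z \<omega> 0, Z \<omega> (y - x)) \<partial>M) = (\<integral>\<^sup>+w. g (w 0, w (y - x)) \<partial>distr M skorohod_algebra Z)"
    by (subst nn_integral_distr) auto
  also have "\<dots> = (\<integral>\<^sup>+w. g (w 0, w (y - x)) \<partial>distr M skorohod_algebra (\<lambda>\<omega> y. Z \<omega> (y + x)))"
    using stationary_Z by (simp add: stationary_field_def)
  also have "\<dots> = (\<integral>\<^sup>+\<omega>. g (Z \<omega> x, Z \<omega> y) \<partial>M)"
    by (subst nn_integral_distr) auto
  finally show ?thesis by simp
qed

abbreviation \<Gamma> :: "'w \<Rightarrow> (real ^ 'd) measure" where "\<Gamma> \<equiv> displaced_measure \<Phi> Z"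

lemma emeasure_displaced:
  assumes w: "\<omega> \<in> space M" and [measurable]: "B \<in> sets borel"
  shows "emeasure (\<Gamma> \<omega>) B = (\<integral>\<^sup>+x. indicator B (x + Z \<omega> x) \<partial>\<Phi> \<omega>)"
proof -
  note [measurable_cong] = sets_Phi[OF w]
  have [measurable]: "Z \<omega> \<in> measurable borel borel"
    using Z_eval_measurable[of "\<lambda>_. \<omega>" borel "\<lambda>x. x"] w by simp
  have "emeasure (\<Gamma> \<omega>) B = (\<integral>\<^sup>+y. indicator B y \<partial>\<Gamma> \<omega>)"
    by (simp add: displaced_measure_def)
  also have "\<dots> = (\<integral>\<^sup>+x. indicator B (x + Z \<omega> x) \<partial>\<Phi> \<omega>)"
    unfolding displaced_measure_def by (rule nn_integral_distr) measurable
  finally show ?thesis .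
qed

lemma emeasure_displaced_measurable [measurable]:
  assumes [measurable]: "B \<in> sets borel"
  shows "(\<lambda>\<omega>. emeasure (\<Gamma> \<omega>) B) \<in> borel_measurable M"
proof -
  have "(\<lambda>\<omega>. \<integral>\<^sup>+x. indicator B (x + Z \<omega> x) \<partial>\<Phi> \<omega>) \<in> borel_measurable M" by measurable
  then show ?thesis
    by (rule measurable_cong[THEN iffD1, rotated]) (rule emeasure_displaced[symmetric, OF _ assms])
qed

definition Q :: "(real ^ 'd) measure" where "Q = distr M borel (\<lambda>\<omega>. Z \<omega> 0)"

lemma prob_space_Q: "prob_space Q"
  unfolding Q_def by (rule prob_space_distr) measurable

lemma sets_Q [simp, measurable_cong]: "sets Q = sets borel" and space_Q [simp]: "space Q = UNIV"
  by (simp_all add: Q_def)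

sublocale Q: prob_space Q by (rule prob_space_Q)

definition smear :: "(real ^ 'd) set \<Rightarrow> real ^ 'd \<Rightarrow> real" where
  "smear B x = (\<integral>z. indicator B (x + z) \<partial>Q)"

lemma smear_measurable [measurable]:
  assumes [measurable]: "B \<in> sets borel"
  shows "smear B \<in> borel_measurable borel"
  unfolding smear_def by measurable

lemma smear_nonneg: "0 \<le> smear B x"
  by (simp add: smear_def)

lemma ennreal_smear:
  assumes [measurable]: "B \<in> sets borel"
  shows "ennreal (smear B x) = (\<integral>\<^sup>+z. indicator B (x + z) \<partial>Q)"
    and "ennreal (smear B x) = (\<integral>\<^sup>+\<omega>. indicator B (x + Z \<omega> 0) \<partial>M)"
proof -
  have i: "integrable Q (\<lambda>z. indicator B (x + z) :: real)"
  proof (rule Q.integrable_const_bound[of _ 1])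
    show "(\<lambda>z. indicator B (x + z) :: real) \<in> borel_measurable Q" by measurable
  qed simp
  show 1: "ennreal (smear B x) = (\<integral>\<^sup>+z. indicator B (x + z) \<partial>Q)"
    unfolding smear_def by (subst nn_integral_eq_integral[OF i, symmetric]) (auto simp:
        ennreal_indicator)
  show "ennreal (smear B x) = (\<integral>\<^sup>+\<omega>. indicator B (x + Z \<omega> 0) \<partial>M)"
    unfolding 1 Q_def by (rule nn_integral_distr) measurable
qed

lemma nn_integral_smear:
  assumes [measurable]: "B \<in> sets borel"
  shows "(\<integral>\<^sup>+x. ennreal (smear B x) \<partial>lborel) = emeasure lborel B"
proof -
  interpret QL: pair_sigma_finite Q "lborel :: (real ^ 'd) measure" ..
  have "(\<integral>\<^sup>+x. ennreal (smear B x) \<partial>lborel) = (\<integral>\<^sup>+x. \<integral>\<^sup>+z. indicator B (x + z) \<partial>Q \<partial>lborel)"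
    by (simp add: ennreal_smear(1))
  also have "\<dots> = (\<integral>\<^sup>+z. \<integral>\<^sup>+x. indicator B (x + z) \<partial>lborel \<partial>Q)"
    by (rule QL.Fubini') measurable
  also have "\<dots> = emeasure lborel B"
    using nn_integral_lborel_shift(2)[of "indicator B"] by (simp add: Q.emeasure_space_1[simplified])
  finally show ?thesis .
qed

text \<open>\<open>smear B\<close> may have unbounded support. Its integral is an average over the
  displacement of masses of translates of \<open>B\<close>; Cauchy-Schwarz for the average and
  stationarity reduce the claim to the second moment of \<Phi>(B).\<close>

lemma admissible_smear:
  assumes B: "bounded B" and [measurable]: "B \<in> sets borel"
  shows "admissible (smear B)"
  unfolding admissible_def
proof (intro conjI)
  show "integrable lborel (smear B)"
    using emeasure_bounded_finite[OF B] by (intro integrableI_nonneg) (auto simp: nn_integral_smear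
        smear_nonneg)
  interpret QM: pair_sigma_finite Q M ..
  have "(\<integral>\<^sup>+\<omega>. (\<integral>\<^sup>+x. ennreal \<bar>smear B x\<bar> \<partial>\<Phi> \<omega>)\<^sup>2 \<partial>M) \<le> (\<integral>\<^sup>+\<omega>. \<integral>\<^sup>+z. (\<integral>\<^sup>+x. indicator B (x + z) \<partial>\<Phi>
      \<omega>)\<^sup>2 \<partial>Q \<partial>M)"
  proof (rule nn_integral_mono)
    fix \<omega> assume w: "\<omega> \<in> space M"
    note [measurable_cong] = sets_Phi[OF w]
    interpret PQ: pair_sigma_finite "\<Phi> \<omega>" Q by (rule pair_sigma_finite_Phi[OF w
        Q.sigma_finite_measure_axioms])
    have [measurable]: "(\<lambda>z. \<integral>\<^sup>+x. indicator B (x + z) \<partial>\<Phi> \<omega>) \<in> borel_measurable borel"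
      using w by measurable
    have "(\<integral>\<^sup>+x. ennreal \<bar>smear B x\<bar> \<partial>\<Phi> \<omega>) = (\<integral>\<^sup>+x. \<integral>\<^sup>+z. indicator B (x + z) \<partial>Q \<partial>\<Phi> \<omega>)"
      by (simp add: smear_nonneg ennreal_smear(1))
    also have "\<dots> = (\<integral>\<^sup>+z. 1 * (\<integral>\<^sup>+x. indicator B (x + z) \<partial>\<Phi> \<omega>) \<partial>Q)"
      unfolding mult_1 by (rule PQ.Fubini'[symmetric]) measurable
    also have "\<dots>\<^sup>2 \<le> (\<integral>\<^sup>+z. 1\<^sup>2 \<partial>Q) * (\<integral>\<^sup>+z. (\<integral>\<^sup>+x. indicator B (x + z) \<partial>\<Phi> \<omega>)\<^sup>2 \<partial>Q)"
      by (rule Cauchy_Schwarz_nn_integral) measurable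
    finally show "(\<integral>\<^sup>+x. ennreal \<bar>smear B x\<bar> \<partial>\<Phi> \<omega>)\<^sup>2 \<le> (\<integral>\<^sup>+z. (\<integral>\<^sup>+x. indicator B (x + z) \<partial>\<Phi> \<omega>)\<^sup>2 \<partial>Q)"
      by (simp add: Q.emeasure_space_1[simplified])
  qed
  also have "\<dots> = (\<integral>\<^sup>+z. \<integral>\<^sup>+\<omega>. (\<integral>\<^sup>+x. indicator B (x + z) \<partial>\<Phi> \<omega>)\<^sup>2 \<partial>M \<partial>Q)"
    by (rule QM.Fubini') measurable
  also have "\<dots> = (\<integral>\<^sup>+z. (\<integral>\<^sup>+\<omega>. (emeasure (\<Phi> \<omega>) B)\<^sup>2 \<partial>M) \<partial>Q)"
  proof (rule nn_integral_cong)
    fix z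
    have "(\<lambda>N. (\<integral>\<^sup>+x. indicator B x \<partial>N)\<^sup>2) \<in> borel_measurable (locally_finite_algebra :: (real ^ 'd)
        measure measure)"
      unfolding power2_eq_square by (intro borel_measurable_times_ennreal
          nn_integral_kernel_measurable) measurable
    from stationary_nn_integral[OF this, of "- z"]
    show "(\<integral>\<^sup>+\<omega>. (\<integral>\<^sup>+x. indicator B (x + z) \<partial>\<Phi> \<omega>)\<^sup>2 \<partial>M) = (\<integral>\<^sup>+\<omega>. (emeasure (\<Phi> \<omega>) B)\<^sup>2 \<partial>M)"
      by (simp add: nn_integral_shift_measure sets_Phi cong: nn_integral_cong)
  qed
  also have "\<dots> < \<infinity>" using finite_second_moment[OF assms] by (simp add: Q.emeasure_space_1[simplified])
  finally show "(\<integral>\<^sup>+\<omega>. (\<integral>\<^sup>+x. ennreal \<bar>smear B x\<bar> \<partial>\<Phi> \<omega>)\<^sup>2 \<partial>M) < \<infinity>" .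
qed measurable

lemma integral_smear:
  assumes B: "bounded B" and [measurable]: "B \<in> sets borel"
  shows "(\<integral>x. smear B x \<partial>lborel) = measure lborel B"
  using nn_integral_smear[OF assms(2)]
  by (subst integral_eq_nn_integral) (auto simp: smear_nonneg measure_def)

text \<open>An instance of \<open>V_mixture\<close> over the law of the displacement; every
  translate has the same \<open>V\<close> by \<open>V_shift\<close>.\<close>

lemma V_smear_le:
  assumes B: "bounded B" and [measurable]: "B \<in> sets borel"
  shows "V (smear B) \<le> V (indicator B)"
proof -
  have "V (\<lambda>x. \<integral>z. indicator B (x + z) \<partial>Q) \<le> (\<integral>\<^sup>+z. V (\<lambda>x. indicator B (x + z)) \<partial>Q)"
  proof (rule V_mixture[OF prob_space_Q])
    have "(\<integral>\<^sup>+z. \<integral>\<^sup>+x. ennreal \<bar>indicator B (x + z)\<bar> \<partial>lborel \<partial>Q) = emeasure lborel B"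
      using nn_integral_lborel_shift(2)[of "indicator B"] by (simp add: ennreal_indicator
          Q.emeasure_space_1[simplified])
    then show "(\<integral>\<^sup>+z. \<integral>\<^sup>+x. ennreal \<bar>indicator B (x + z)\<bar> \<partial>lborel \<partial>Q) < \<infinity>"
      using emeasure_bounded_finite[OF B] by simp
  qed measurable
  also have "\<dots> = (\<integral>\<^sup>+z. V (indicator B) \<partial>Q)"
    using V_shift[of "indicator B" "- z" for z] by (simp cong: nn_integral_cong)
  finally show ?thesis by (simp add: smear_def[abs_def] Q.emeasure_space_1[simplified])
qed

text \<open>Since \<open>Q\<close> has mass 1, the indicator minus its smearing is the average of
  \<open>increment B (- z)\<close>, and \<open>V_mixture\<close> applies. The sign comes from
  writing \<open>x + z\<close> as \<open>x - (- z)\<close>.\<close>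

lemma V_indicator_diff_smear:
  assumes B: "bounded B" and [measurable]: "B \<in> sets borel"
  shows "V (\<lambda>x. indicator B x - smear B x) \<le> (\<integral>\<^sup>+z. V (increment B (- z)) \<partial>Q)"
proof -
  have i: "integrable Q (\<lambda>z. indicator B (x + z) :: real)" for x
  proof (rule Q.integrable_const_bound[of _ 1])
    show "(\<lambda>z. indicator B (x + z) :: real) \<in> borel_measurable Q" by measurable
  qed simp
  have "(\<lambda>x. indicator B x - smear B x) = (\<lambda>x. \<integral>z. increment B (- z) x \<partial>Q)"
    using i by (auto simp: smear_def increment_def Q.prob_space[simplified])
  moreover have "V (\<lambda>x. \<integral>z. increment B (- z) x \<partial>Q) \<le> (\<integral>\<^sup>+z. V (increment B (- z)) \<partial>Q)"
  proof (rule V_mixture[OF prob_space_Q])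
    show "(\<lambda>(z, x). increment B (- z) x) \<in> borel_measurable (Q \<Otimes>\<^sub>M borel)"
      unfolding increment_def by measurable
    have "(\<integral>\<^sup>+z. \<integral>\<^sup>+x. ennreal \<bar>increment B (- z) x\<bar> \<partial>lborel \<partial>Q) \<le> (\<integral>\<^sup>+z. \<integral>\<^sup>+x. indicator B x +
        indicator B (x + z) \<partial>lborel \<partial>Q)"
      by (intro nn_integral_mono) (auto simp: increment_def indicator_def)
    also have "\<dots> = emeasure lborel B + emeasure lborel B"
      using nn_integral_lborel_shift(2)[of "indicator B"] by (simp add: nn_integral_add
          Q.emeasure_space_1[simplified])
    also have "\<dots> < \<infinity>" using emeasure_bounded_finite[OF B] by simp
    finally show "(\<integral>\<^sup>+z. \<integral>\<^sup>+x. ennreal \<bar>increment B (- z) x\<bar> \<partial>lborel \<partial>Q) < \<infinity>" .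
  qed
  ultimately show ?thesis by simp
qed

end

section \<open>First and second moments of the displaced measure\<close>

context displaced_random_measure
begin

text \<open>Regards the displaced mass as a functional of field and measure jointly, the form
  required by \<open>nn_integral_independent\<close>.\<close>

lemma displaced_functional_measurable:
  assumes [measurable]: "B \<in> sets borel"
  shows "(\<lambda>p. \<integral>\<^sup>+x. indicator B (x + fst p x) \<partial>snd p) \<in> borel_measurable (skorohod_algebra \<Otimes>\<^sub>M
      (locally_finite_algebra :: (real ^ 'd) measure measure))"
proof (rule nn_integral_kernel_measurable)
  have "(\<lambda>q. (fst (fst q), snd q)) \<in> measurable ((skorohod_algebra \<Otimes>\<^sub>M (locally_finite_algebra ::
      (real ^ 'd) measure measure)) \<Otimes>\<^sub>M borel) (skorohod_algebra \<Otimes>\<^sub>M (borel :: (real ^ 'd) measure))"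
    by measurable
  from measurable_compose[OF this skorohod_eval_measurable]
  have [measurable]: "(\<lambda>q. fst (fst q) (snd q)) \<in> measurable ((skorohod_algebra \<Otimes>\<^sub>M
      (locally_finite_algebra :: (real ^ 'd) measure measure)) \<Otimes>\<^sub>M borel) (borel :: (real ^ 'd)
      measure)"
    by simp
  have "(\<lambda>q. indicator B (snd q + fst (fst q) (snd q)) :: ennreal) \<in> borel_measurable
      ((skorohod_algebra \<Otimes>\<^sub>M (locally_finite_algebra :: (real ^ 'd) measure measure)) \<Otimes>\<^sub>M borel)"
    by measurable
  then show "(\<lambda>(p, x). indicator B (x + fst p x) :: ennreal) \<in> borel_measurable ((skorohod_algebra
      \<Otimes>\<^sub>M (locally_finite_algebra :: (real ^ 'd) measure measure)) \<Otimes>\<^sub>M borel)"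
    by (simp add: split_beta')
qed (rule measurable_snd)

text \<open>Averaged over the field, the indicator at \<open>x + Z x\<close> becomes
  \<open>smear B x\<close>, because \<open>Z x\<close> has the law of \<open>Z 0\<close>; smearing
  preserves volume, so displacement preserves the intensity.\<close>

lemma first_moment_displaced:
  assumes [measurable]: "B \<in> sets borel"
  shows "(\<integral>\<^sup>+\<omega>. emeasure (\<Gamma> \<omega>) B \<partial>M) = ennreal \<gamma> * emeasure lborel B"
proof -
  have "(\<integral>\<^sup>+\<omega>. emeasure (\<Gamma> \<omega>) B \<partial>M) = (\<integral>\<^sup>+\<omega>. \<integral>\<^sup>+x. indicator B (x + Z \<omega> x) \<partial>\<Phi> \<omega> \<partial>M)"
    by (simp add: emeasure_displaced cong: nn_integral_cong)
  also have "\<dots> = (\<integral>\<^sup>+\<omega>. \<integral>\<^sup>+\<omega>'. \<integral>\<^sup>+x. indicator B (x + Z \<omega>' x) \<partial>\<Phi> \<omega> \<partial>M \<partial>M)"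
    using nn_integral_independent[OF displaced_functional_measurable[OF assms]] by simp
  also have "\<dots> = (\<integral>\<^sup>+\<omega>. \<integral>\<^sup>+x. ennreal (smear B x) \<partial>\<Phi> \<omega> \<partial>M)"
  proof (rule nn_integral_cong)
    fix \<omega> assume w: "\<omega> \<in> space M"
    note [measurable_cong] = sets_Phi[OF w]
    interpret PM: pair_sigma_finite "\<Phi> \<omega>" M by (rule pair_sigma_finite_Phi[OF w
        sigma_finite_measure_axioms])
    have "(\<integral>\<^sup>+\<omega>'. \<integral>\<^sup>+x. indicator B (x + Z \<omega>' x) \<partial>\<Phi> \<omega> \<partial>M) = (\<integral>\<^sup>+x. \<integral>\<^sup>+\<omega>'. indicator B (x + Z \<omega>' x)
        \<partial>M \<partial>\<Phi> \<omega>)"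
      by (rule PM.Fubini') measurable
    also have "\<dots> = (\<integral>\<^sup>+x. ennreal (smear B x) \<partial>\<Phi> \<omega>)"
      using stationary_Z_nn[of "\<lambda>p. indicator B (x + fst p)" x x for x] by (simp add: ennreal_smear(2))
    finally show "(\<integral>\<^sup>+\<omega>'. \<integral>\<^sup>+x. indicator B (x + Z \<omega>' x) \<partial>\<Phi> \<omega> \<partial>M) = (\<integral>\<^sup>+x. ennreal (smear B x) \<partial>\<Phi> \<omega>)" .
  qed
  also have "\<dots> = ennreal \<gamma> * (\<integral>\<^sup>+x. ennreal (smear B x) \<partial>lborel)"
    by (rule campbell_first) measurable
  finally show ?thesis by (simp add: nn_integral_smear)
qed

lemma overlap:
  assumes B: "bounded B" and [measurable]: "B \<in> sets borel"
  shows "(\<integral>\<^sup>+x. indicator B (x + a) * indicator B (x + b) \<partial>lborel) = ennreal (autocorrelation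
      (indicator B) (b - a))"
proof -
  have i: "integrable lborel (\<lambda>x. indicator B x * indicator B (x + (b - a)) :: real)"
    by (rule Bochner_Integration.integrable_bound[of _ "indicator B :: _ \<Rightarrow> real"])
       (use emeasure_bounded_finite[OF B] in \<open>auto simp: integrable_indicator_iff indicator_def\<close>)
  have "(\<integral>\<^sup>+x. indicator B (x + a) * indicator B (x + b) \<partial>lborel) = (\<integral>\<^sup>+x. indicator B x * indicator
      B (x + (b - a)) \<partial>lborel)"
    using nn_integral_lborel_shift(2)[of "\<lambda>x. indicator B x * indicator B (x + (b - a))" a] by (simp
        add: algebra_simps)
  also have "\<dots> = (\<integral>\<^sup>+x. ennreal (indicator B x * indicator B (x + (b - a))) \<partial>lborel)"
    by (intro nn_integral_cong) (simp add: indicator_def)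
  also have "\<dots> = ennreal (autocorrelation (indicator B) (b - a))"
    unfolding autocorrelation_def by (rule nn_integral_eq_integral[OF i]) simp
  finally show ?thesis .
qed

text \<open>Expected overlap seen by two points at lag \<open>u\<close> displaced by the same field.
  The counterpart with independent displacements is
  \<open>autocorrelation (smear B)\<close>.\<close>

definition paired_overlap :: "(real ^ 'd) set \<Rightarrow> real ^ 'd \<Rightarrow> real" where
  "paired_overlap B u = (\<integral>\<omega>. autocorrelation (indicator B) (u + Z \<omega> u - Z \<omega> 0) \<partial>M)"

lemma paired_overlap_measurable [measurable]:
  assumes [measurable]: "B \<in> sets borel"
  shows "paired_overlap B \<in> borel_measurable borel"
  unfolding paired_overlap_def by measurable

lemma overlap_bounds:
  assumes B: "bounded B" and "B \<in> sets borel"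
  shows "0 \<le> autocorrelation (indicator B) v" "autocorrelation (indicator B) v \<le> measure lborel B"
proof -
  obtain R where "B \<subseteq> cball 0 R" using B by (auto simp: bounded_iff subset_eq)
  from autocorrelation_indicator_bound[OF this assms(2)]
  show "0 \<le> autocorrelation (indicator B) v" "autocorrelation (indicator B) v \<le> measure lborel B" by
      auto
qed

lemma ennreal_paired_overlap:
  assumes B: "bounded B" and [measurable]: "B \<in> sets borel"
  shows "ennreal (paired_overlap B u) = (\<integral>\<^sup>+\<omega>. ennreal (autocorrelation (indicator B) (u + Z \<omega> u - Z
      \<omega> 0)) \<partial>M)"
proof -
  have "integrable M (\<lambda>\<omega>. autocorrelation (indicator B) (u + Z \<omega> u - Z \<omega> 0))"
  proof (rule integrable_const_bound[of _ "measure lborel B"])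
    show "AE \<omega> in M. norm (autocorrelation (indicator B) (u + Z \<omega> u - Z \<omega> 0)) \<le> measure lborel B"
      using overlap_bounds[OF assms] by simp
  qed measurable
  then show ?thesis
    unfolding paired_overlap_def using overlap_bounds[OF assms] by (subst nn_integral_eq_integral) auto
qed

text \<open>With \<open>\<Phi>\<close> frozen the square is a double integral over pairs of points.
  Stationarity of the field reduces \<open>(Z x, Z y)\<close> to the lag \<open>y - x\<close>, and
  integrating over the position in the second Campbell formula produces the overlap.\<close>

lemma second_moment_displaced:
  assumes B: "bounded B" and [measurable]: "B \<in> sets borel"
  shows "(\<integral>\<^sup>+\<omega>. (emeasure (\<Gamma> \<omega>) B)\<^sup>2 \<partial>M) = (\<integral>\<^sup>+u. ennreal (paired_overlap B u) \<partial>\<alpha>)"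
proof -
  let ?F = "\<lambda>\<omega>' x y. indicator B (x + Z \<omega>' x) * indicator B (y + Z \<omega>' y) :: ennreal"
  have "(\<lambda>p. (\<integral>\<^sup>+x. indicator B (x + fst p x) \<partial>snd p)\<^sup>2) \<in> borel_measurable (skorohod_algebra \<Otimes>\<^sub>M
      (locally_finite_algebra :: (real ^ 'd) measure measure))"
    unfolding power2_eq_square by (intro borel_measurable_times_ennreal
        displaced_functional_measurable) measurable
  note ind = nn_integral_independent[OF this]
  have "(\<integral>\<^sup>+\<omega>. (emeasure (\<Gamma> \<omega>) B)\<^sup>2 \<partial>M) = (\<integral>\<^sup>+\<omega>. (\<integral>\<^sup>+x. indicator B (x + Z \<omega> x) \<partial>\<Phi> \<omega>)\<^sup>2 \<partial>M)"
    by (simp add: emeasure_displaced cong: nn_integral_cong)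
  also have "\<dots> = (\<integral>\<^sup>+\<omega>. \<integral>\<^sup>+\<omega>'. (\<integral>\<^sup>+x. indicator B (x + Z \<omega>' x) \<partial>\<Phi> \<omega>)\<^sup>2 \<partial>M \<partial>M)"
    using ind by simp
  also have "\<dots> = (\<integral>\<^sup>+\<omega>. \<integral>\<^sup>+x. \<integral>\<^sup>+y. (\<integral>\<^sup>+\<omega>'. indicator B (x + Z \<omega>' 0) * indicator B (y + Z \<omega>' (y -
      x)) \<partial>M) \<partial>\<Phi> \<omega> \<partial>\<Phi> \<omega> \<partial>M)"
  proof (rule nn_integral_cong)
    fix \<omega> assume w: "\<omega> \<in> space M"
    note [measurable_cong] = sets_Phi[OF w]
    interpret PM: pair_sigma_finite "\<Phi> \<omega>" M by (rule pair_sigma_finite_Phi[OF w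
        sigma_finite_measure_axioms])
    have "(\<integral>\<^sup>+\<omega>'. (\<integral>\<^sup>+x. indicator B (x + Z \<omega>' x) \<partial>\<Phi> \<omega>)\<^sup>2 \<partial>M) = (\<integral>\<^sup>+\<omega>'. \<integral>\<^sup>+x. \<integral>\<^sup>+y. ?F \<omega>' x y \<partial>\<Phi> \<omega>
        \<partial>\<Phi> \<omega> \<partial>M)"
    proof (rule nn_integral_cong)
      fix \<omega>' assume w': "\<omega>' \<in> space M"
      have [measurable]: "Z \<omega>' \<in> measurable borel borel"
        using Z_eval_measurable[of "\<lambda>_. \<omega>'" borel "\<lambda>x. x"] w' by simp
      show "(\<integral>\<^sup>+x. indicator B (x + Z \<omega>' x) \<partial>\<Phi> \<omega>)\<^sup>2 = (\<integral>\<^sup>+x. \<integral>\<^sup>+y. ?F \<omega>' x y \<partial>\<Phi> \<omega> \<partial>\<Phi> \<omega>)"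
        by (simp add: nn_integral_cmult nn_integral_multc power2_eq_square)
    qed
    also have "\<dots> = (\<integral>\<^sup>+x. \<integral>\<^sup>+\<omega>'. \<integral>\<^sup>+y. ?F \<omega>' x y \<partial>\<Phi> \<omega> \<partial>M \<partial>\<Phi> \<omega>)"
      using w by (intro PM.Fubini') measurable
    also have "\<dots> = (\<integral>\<^sup>+x. \<integral>\<^sup>+y. \<integral>\<^sup>+\<omega>'. ?F \<omega>' x y \<partial>M \<partial>\<Phi> \<omega> \<partial>\<Phi> \<omega>)"
      by (intro nn_integral_cong PM.Fubini') measurable
    also have "\<dots> = (\<integral>\<^sup>+x. \<integral>\<^sup>+y. (\<integral>\<^sup>+\<omega>'. indicator B (x + Z \<omega>' 0) * indicator B (y + Z \<omega>' (y - x))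
        \<partial>M) \<partial>\<Phi> \<omega> \<partial>\<Phi> \<omega>)"
      using stationary_Z_nn[of "\<lambda>p. indicator B (x + fst p) * indicator B (y + snd p)" x y for x y]
          by simp
    finally show "(\<integral>\<^sup>+\<omega>'. (\<integral>\<^sup>+x. indicator B (x + Z \<omega>' x) \<partial>\<Phi> \<omega>)\<^sup>2 \<partial>M) =
       (\<integral>\<^sup>+x. \<integral>\<^sup>+y. (\<integral>\<^sup>+\<omega>'. indicator B (x + Z \<omega>' 0) * indicator B (y + Z \<omega>' (y - x)) \<partial>M) \<partial>\<Phi> \<omega> \<partial>\<Phi> \<omega>)" .
  qed
  also have "\<dots> = (\<integral>\<^sup>+u. \<integral>\<^sup>+x. (\<integral>\<^sup>+\<omega>'. indicator B (x + Z \<omega>' 0) * indicator B (x + u + Z \<omega>' u) \<partial>M)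
      \<partial>lborel \<partial>\<alpha>)"
    using campbell_second[of "\<lambda>p. \<integral>\<^sup>+\<omega>'. indicator B (fst p + Z \<omega>' 0) * indicator B (snd p + Z \<omega>'
        (snd p - fst p)) \<partial>M"] by simp
  also have "\<dots> = (\<integral>\<^sup>+u. ennreal (paired_overlap B u) \<partial>\<alpha>)"
  proof (rule nn_integral_cong)
    fix u
    interpret Mlam: pair_sigma_finite M "lborel :: (real ^ 'd) measure" ..
    have "(\<integral>\<^sup>+x. (\<integral>\<^sup>+\<omega>'. indicator B (x + Z \<omega>' 0) * indicator B (x + u + Z \<omega>' u) \<partial>M) \<partial>lborel) =
       (\<integral>\<^sup>+\<omega>'. \<integral>\<^sup>+x. indicator B (x + Z \<omega>' 0) * indicator B (x + u + Z \<omega>' u) \<partial>lborel \<partial>M)"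
      by (rule Mlam.Fubini') measurable
    also have "\<dots> = ennreal (paired_overlap B u)"
      unfolding ennreal_paired_overlap[OF assms]
      using overlap[OF assms, of "Z \<omega>' 0" "u + Z \<omega>' u" for \<omega>'] by (simp add: add.assoc)
    finally show "(\<integral>\<^sup>+x. (\<integral>\<^sup>+\<omega>'. indicator B (x + Z \<omega>' 0) * indicator B (x + u + Z \<omega>' u) \<partial>M)
        \<partial>lborel) = ennreal (paired_overlap B u)" .
  qed
  finally show ?thesis .
qed

text \<open>Expanding both factors as averages over \<open>Q\<close> and integrating over the
  position inside gives the overlap for two independent displacements. The interchange is done with
  nonnegative integrals, where Tonelli needs no integrability.\<close>

lemma autocorrelation_smear:
  assumes B: "bounded B" and [measurable]: "B \<in> sets borel"
  shows "autocorrelation (smear B) u = (\<integral>p. autocorrelation (indicator B) (u + fst p - snd p) \<partial>(Q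
      \<Otimes>\<^sub>M Q))"
proof -
  interpret QQ: pair_prob_space Q Q ..
  interpret QL: pair_sigma_finite Q "lborel :: (real ^ 'd) measure" ..
  have adm: "integrable lborel (smear B)" using admissible_smear[OF assms] by (simp add: admissible_def)
  have le1: "smear B x \<le> 1" for x
    unfolding smear_def by (rule Q.integral_le_const) (auto simp: indicator_def intro!:
        Q.integrable_const_bound[of _ 1])
  have i1: "integrable lborel (\<lambda>x. smear B x * smear B (x + u))"
    by (rule Bochner_Integration.integrable_bound[OF adm])
       (use le1 smear_nonneg in \<open>auto simp: abs_mult intro!: mult_left_le\<close>)
  have i2: "integrable (Q \<Otimes>\<^sub>M Q) (\<lambda>p. autocorrelation (indicator B) (u + fst p - snd p))"
  proof (rule QQ.P.integrable_const_bound[of _ "measure lborel B"])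
    show "AE p in Q \<Otimes>\<^sub>M Q. norm (autocorrelation (indicator B) (u + fst p - snd p)) \<le> measure lborel B"
      using overlap_bounds[OF assms] by simp
  qed measurable
  have "ennreal (autocorrelation (smear B) u) = (\<integral>\<^sup>+x. ennreal (smear B x * smear B (x + u)) \<partial>lborel)"
    unfolding autocorrelation_def by (subst nn_integral_eq_integral[OF i1]) (auto simp: smear_nonneg)
  also have "\<dots> = (\<integral>\<^sup>+x. \<integral>\<^sup>+b. \<integral>\<^sup>+a. indicator B (x + a) * indicator B (x + u + b) \<partial>Q \<partial>Q \<partial>lborel)"
    by (simp add: ennreal_mult smear_nonneg ennreal_smear(1) nn_integral_cmult nn_integral_multc)
  also have "\<dots> = (\<integral>\<^sup>+b. \<integral>\<^sup>+x. \<integral>\<^sup>+a. indicator B (x + a) * indicator B (x + u + b) \<partial>Q \<partial>lborel \<partial>Q)"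
    by (rule QL.Fubini') measurable
  also have "\<dots> = (\<integral>\<^sup>+b. \<integral>\<^sup>+a. \<integral>\<^sup>+x. indicator B (x + a) * indicator B (x + u + b) \<partial>lborel \<partial>Q \<partial>Q)"
    by (intro nn_integral_cong QL.Fubini') measurable
  also have "\<dots> = (\<integral>\<^sup>+b. \<integral>\<^sup>+a. ennreal (autocorrelation (indicator B) (u + fst (b, a) - snd (b, a)))
      \<partial>Q \<partial>Q)"
    using overlap[OF assms, of a "u + b" for a b] by (simp add: add.assoc)
  also have "\<dots> = (\<integral>\<^sup>+p. ennreal (autocorrelation (indicator B) (u + fst p - snd p)) \<partial>(Q \<Otimes>\<^sub>M Q))"
    by (rule Q.nn_integral_fst) measurable
  also have "\<dots> = ennreal (\<integral>p. autocorrelation (indicator B) (u + fst p - snd p) \<partial>(Q \<Otimes>\<^sub>M Q))"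
    using overlap_bounds[OF assms] by (subst nn_integral_eq_integral[OF i2]) auto
  finally show ?thesis
    by (rule ennreal_inj[THEN iffD1, rotated 2])
       (auto simp: autocorrelation_def smear_nonneg intro!: Bochner_Integration.integral_nonneg)
qed

text \<open>The overlap divided by the volume of \<open>B\<close> is a test function with values in
  [0, 1], evaluated on the true and on the decoupled pair of displacements. The bound does not
  depend on \<open>B\<close>, which makes it a majorant for all windows at once.\<close>

lemma overlap_difference_bound:
  assumes B: "bounded B" and [measurable]: "B \<in> sets borel" and pos: "measure lborel B > 0"
  shows "ennreal (\<bar>paired_overlap B u - autocorrelation (smear B) u\<bar> / measure lborel B) \<le>
    norm_difference (distr M (borel \<Otimes>\<^sub>M borel) (\<lambda>\<omega>. (Z \<omega> u, Z \<omega> 0))) (Q \<Otimes>\<^sub>M Q)"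
proof -
  let ?f = "\<lambda>p. autocorrelation (indicator B) (u + fst p - snd p) / measure lborel B"
  have 1: "(\<integral>p. ?f p \<partial>distr M (borel \<Otimes>\<^sub>M borel) (\<lambda>\<omega>. (Z \<omega> u, Z \<omega> 0))) = paired_overlap B u / measure
      lborel B"
    by (subst integral_distr) (auto simp: paired_overlap_def)
  have 2: "(\<integral>p. ?f p \<partial>(Q \<Otimes>\<^sub>M Q)) = autocorrelation (smear B) u / measure lborel B"
    by (simp add: autocorrelation_smear[OF assms(1,2)])
  have "range ?f \<subseteq> {-1..1}"
  proof clarify
    fix a b
    show "?f (a, b) \<in> {-1..1}"
      using overlap_bounds[OF assms(1,2), of "u + fst (a, b) - snd (a, b)"] pos
      by (auto simp: divide_le_eq intro: order_trans[of _ 0])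
  qed
  moreover have "?f \<in> borel_measurable (distr M (borel \<Otimes>\<^sub>M borel) (\<lambda>\<omega>. (Z \<omega> u, Z \<omega> 0)))" by measurable
  ultimately have "ennreal \<bar>(\<integral>p. ?f p \<partial>distr M (borel \<Otimes>\<^sub>M borel) (\<lambda>\<omega>. (Z \<omega> u, Z \<omega> 0))) - (\<integral>p. ?f p
      \<partial>(Q \<Otimes>\<^sub>M Q))\<bar> \<le>
     norm_difference (distr M (borel \<Otimes>\<^sub>M borel) (\<lambda>\<omega>. (Z \<omega> u, Z \<omega> 0))) (Q \<Otimes>\<^sub>M Q)"
    unfolding norm_difference_def by (intro SUP_upper) auto
  then show ?thesis unfolding 1 2 using pos by (simp add: diff_divide_distrib[symmetric])
qed

end

section \<open>Consequences of the mixing condition for the variance of the displaced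
  measure\<close>

locale mixing_displacement = displaced_random_measure M \<Phi> Z
  for M :: "'w measure" and \<Phi> :: "'w \<Rightarrow> (real ^ 'd) measure" and Z +
  assumes mixing: "(\<integral>\<^sup>+y. norm_difference (distr M (borel \<Otimes>\<^sub>M borel) (\<lambda>\<omega>. (Z \<omega> y, Z \<omega> 0))) (Q \<Otimes>\<^sub>M Q)
      \<partial>\<alpha>) < \<infinity>"
begin

text \<open>The difference is dominated by a multiple of the mixing integrand; the paired overlap is
  then integrable because the autocorrelation of the admissible smeared window is.\<close>

lemma integrable_overlap_difference:
  assumes B: "bounded B" and [measurable]: "B \<in> sets borel" and pos: "measure lborel B > 0"
  shows "integrable \<alpha> (\<lambda>u. paired_overlap B u - autocorrelation (smear B) u)" (is ?A)
    and "integrable \<alpha> (paired_overlap B)" (is ?B)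
proof -
  have "(\<integral>\<^sup>+u. ennreal (\<bar>paired_overlap B u - autocorrelation (smear B) u\<bar> / measure lborel B) \<partial>\<alpha>) < \<infinity>"
    by (rule le_less_trans[OF nn_integral_mono mixing]) (rule overlap_difference_bound[OF assms])
  then have "integrable \<alpha> (\<lambda>u. (paired_overlap B u - autocorrelation (smear B) u) / measure lborel B)"
    using pos by (intro integrableI_bounded) (auto simp: abs_divide)
  then have "integrable \<alpha> (\<lambda>u. measure lborel B * ((paired_overlap B u - autocorrelation (smear B)
      u) / measure lborel B))"
    by (rule integrable_mult_right)
  then show A: ?A using pos by simp
  have "integrable \<alpha> (\<lambda>u. (paired_overlap B u - autocorrelation (smear B) u) + autocorrelation
      (smear B) u)"
    by (intro Bochner_Integration.integrable_add A V_eq(1) admissible_smear assms)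
  then show ?B by simp
qed

text \<open>\<Gamma>(B) and the smeared functional have the same mean, \<gamma> times the volume of
  \<open>B\<close>, so the difference of variances is the difference of second moments.\<close>

lemma displaced_variance:
  assumes B: "bounded B" and [measurable]: "B \<in> sets borel" and pos: "measure lborel B > 0"
  shows "(\<integral>\<^sup>+\<omega>. (emeasure (\<Gamma> \<omega>) B)\<^sup>2 \<partial>M) < \<infinity>" (is ?A)
    and "variance (\<lambda>\<omega>. measure (\<Gamma> \<omega>) B) - L (autocorrelation (smear B)) =
      (\<integral>u. paired_overlap B u - autocorrelation (smear B) u \<partial>\<alpha>)" (is ?B)
proof -
  note D = integrable_overlap_difference[OF assms]
  note S = admissible_smear[OF assms(1,2)]
  have nn: "0 \<le> paired_overlap B u" for u
    unfolding paired_overlap_def using overlap_bounds[OF assms(1,2)] by simp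
  have sq: "(\<integral>\<^sup>+\<omega>. (emeasure (\<Gamma> \<omega>) B)\<^sup>2 \<partial>M) = ennreal (\<integral>u. paired_overlap B u \<partial>\<alpha>)"
    unfolding second_moment_displaced[OF assms(1,2)] by (rule nn_integral_eq_integral[OF D(2)])
        (simp add: nn)
  then show ?A by simp
  \<comment> \<open>\<open>measure\<close> would be 0 where \<Gamma>(B) is infinite; the finite
    second moment excludes this almost surely.\<close>
  have "AE \<omega> in M. (emeasure (\<Gamma> \<omega>) B)\<^sup>2 \<noteq> \<infinity>"
    by (rule nn_integral_PInf_AE) (use sq in \<open>auto simp: power2_eq_square\<close>)
  then have fin: "AE \<omega> in M. emeasure (\<Gamma> \<omega>) B = ennreal (measure (\<Gamma> \<omega>) B)"
    by eventually_elim (auto simp: power2_eq_square intro!: emeasure_eq_ennreal_measure)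
  have [measurable]: "(\<lambda>\<omega>. measure (\<Gamma> \<omega>) B) \<in> borel_measurable M" unfolding measure_def by measurable
  have "(\<integral>\<^sup>+\<omega>. ennreal ((measure (\<Gamma> \<omega>) B)\<^sup>2) \<partial>M) = (\<integral>\<^sup>+\<omega>. (emeasure (\<Gamma> \<omega>) B)\<^sup>2 \<partial>M)"
    by (rule nn_integral_cong_AE) (use fin in \<open>auto elim!: eventually_mono simp: ennreal_power\<close>)
  then have h2: "has_bochner_integral M (\<lambda>\<omega>. (measure (\<Gamma> \<omega>) B)\<^sup>2) (\<integral>u. paired_overlap B u \<partial>\<alpha>)"
    unfolding sq by (intro has_bochner_integral_nn_integral) (auto intro!:
        Bochner_Integration.integral_nonneg nn)
  have "(\<integral>\<^sup>+\<omega>. ennreal (measure (\<Gamma> \<omega>) B) \<partial>M) = (\<integral>\<^sup>+\<omega>. emeasure (\<Gamma> \<omega>) B \<partial>M)"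
    by (rule nn_integral_cong_AE) (use fin in \<open>auto elim!: eventually_mono\<close>)
  also have "\<dots> = ennreal (\<gamma> * measure lborel B)"
    using emeasure_bounded_finite[OF B] unfolding first_moment_displaced[OF assms(2)]
    by (subst emeasure_eq_ennreal_measure) (auto simp: ennreal_mult intensity_nonneg)
  finally have h1: "has_bochner_integral M (\<lambda>\<omega>. measure (\<Gamma> \<omega>) B) (\<gamma> * measure lborel B)"
    by (intro has_bochner_integral_nn_integral) (auto simp: intensity_nonneg)
  have "variance (\<lambda>\<omega>. measure (\<Gamma> \<omega>) B) = (\<integral>u. paired_overlap B u \<partial>\<alpha>) - (\<gamma> * measure lborel B)\<^sup>2"
    using h1 h2 by (subst variance_eq) (auto simp: has_bochner_integral_iff)
  moreover have "L (autocorrelation (smear B)) = (\<integral>u. autocorrelation (smear B) u \<partial>\<alpha>) - (\<gamma> * measure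
      lborel B)\<^sup>2"
    using autocorrelation_lborel(2)[of "smear B"] S integral_smear[OF assms(1,2)]
    by (simp add: L_def admissible_def power_mult_distrib)
  ultimately show ?B
    by (subst Bochner_Integration.integral_diff[OF D(2) V_eq(1)[OF S]]) simp
qed

end

text \<open>By scaling, the ratio is the normalised covariogram of \<open>W\<close> at v / X n, and
  the covariogram is continuous with the volume of \<open>W\<close> as its value at 0.\<close>

lemma (in convex_window) overlap_ratio_tendsto:
  assumes X: "filterlim X at_top sequentially" "\<And>n. X n > 0"
  shows "(\<lambda>n. N (X n) v / measure lborel (scaled (X n))) \<longlonglongrightarrow> 1"
proof -
  have "N (X n) v / measure lborel (scaled (X n)) = autocorrelation (indicator W) ((1 / X n) *\<^sub>R v)
      / measure lborel W" for n
    using X(2)[of n] by (simp add: scaled_autocorrelation[OF X(2) borel_W] scaled_measure[OF X(2)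
        borel_W])
  moreover have "(\<lambda>n. autocorrelation (indicator W) ((1 / X n) *\<^sub>R v) / measure lborel W) \<longlonglongrightarrow>
      autocorrelation (indicator W) (0 *\<^sub>R v) / measure lborel W"
  proof (intro tendsto_divide tendsto_const)
    have "(\<lambda>n. 1 / X n) \<longlonglongrightarrow> 0"
      using tendsto_inverse_0_at_top[OF X(1)] by (simp add: inverse_eq_divide)
    then have l: "(\<lambda>n. (1 / X n) *\<^sub>R v) \<longlonglongrightarrow> 0 *\<^sub>R v" by (intro tendsto_intros)
    have "isCont (autocorrelation (indicator W)) u" for u
      using continuous_autocorrelation_convex[OF conv bounded_W borel_W] by (simp add:
          continuous_on_eq_continuous_at)
    from isCont_tendsto_compose[OF this l] show "(\<lambda>n. autocorrelation (indicator W) ((1 / X n) *\<^sub>R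
        v)) \<longlonglongrightarrow> autocorrelation (indicator W) (0 *\<^sub>R v)" .
  qed (use volume in simp)
  moreover have "autocorrelation (indicator W) (0 *\<^sub>R v) = measure lborel W"
  proof -
    have e: "indicator W x * indicator W (x + 0 *\<^sub>R v) = (indicator W x :: real)" for x by (simp
        add: indicator_def)
    show ?thesis unfolding autocorrelation_def e by simp
  qed
  ultimately show ?thesis using volume by simp
qed

locale windowed_displacement = windowed_random_measure M \<Phi> W \<rho> + mixing_displacement M \<Phi> Z
  for M :: "'w measure" and \<Phi> :: "'w \<Rightarrow> (real ^ 'd) measure" and Z and W :: "(real ^ 'd) set" and \<rho>
      :: real
begin

lemma scaled_volume_pos: "r > 0 \<Longrightarrow> measure lborel (scaled r) > 0"
  using volume by (simp add: scaled_props(5))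

lemma overlap_ratio_bound:
  assumes "r > 0" shows "\<bar>N r v / measure lborel (scaled r)\<bar> \<le> 1"
  using overlap_bounds[OF scaled_props(4,1)[OF assms], of v] scaled_volume_pos[OF assms] by (simp
      add: divide_le_eq)

lemma smear_ratio_tendsto:
  assumes X: "filterlim X at_top sequentially" "\<And>n. X n > 0"
  shows "(\<lambda>n. autocorrelation (smear (scaled (X n))) u / measure lborel (scaled (X n))) \<longlonglongrightarrow> 1"
proof -
  interpret QQ: pair_prob_space Q Q ..
  note P = scaled_props[OF X(2)]
  note [measurable] = P(1)
  have "(\<lambda>n. \<integral>p. N (X n) (u + fst p - snd p) / measure lborel (scaled (X n)) \<partial>(Q \<Otimes>\<^sub>M Q)) \<longlonglongrightarrow> (\<integral>p. 1
      \<partial>(Q \<Otimes>\<^sub>M Q))"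
  proof (rule integral_dominated_convergence[where w = "\<lambda>_. 1"])
    show "AE p in Q \<Otimes>\<^sub>M Q. (\<lambda>n. N (X n) (u + fst p - snd p) / measure lborel (scaled (X n))) \<longlonglongrightarrow> 1"
      by (intro AE_I2 overlap_ratio_tendsto X)
    show "AE p in Q \<Otimes>\<^sub>M Q. norm (N (X n) (u + fst p - snd p) / measure lborel (scaled (X n))) \<le> 1" for n
      unfolding real_norm_def by (intro AE_I2 overlap_ratio_bound X)
  qed (auto simp: QQ.P.integrable_const)
  then show ?thesis by (simp add: autocorrelation_smear[OF P(4,1)] QQ.P.prob_space[simplified])
qed

lemma paired_ratio_tendsto:
  assumes X: "filterlim X at_top sequentially" "\<And>n. X n > 0"
  shows "(\<lambda>n. paired_overlap (scaled (X n)) u / measure lborel (scaled (X n))) \<longlonglongrightarrow> 1"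
proof -
  note P = scaled_props[OF X(2)]
  note [measurable] = P(1)
  have "(\<lambda>n. \<integral>\<omega>. N (X n) (u + Z \<omega> u - Z \<omega> 0) / measure lborel (scaled (X n)) \<partial>M) \<longlonglongrightarrow> (\<integral>\<omega>. 1 \<partial>M)"
  proof (rule integral_dominated_convergence[where w = "\<lambda>_. 1"])
    show "AE \<omega> in M. (\<lambda>n. N (X n) (u + Z \<omega> u - Z \<omega> 0) / measure lborel (scaled (X n))) \<longlonglongrightarrow> 1"
      by (intro AE_I2 overlap_ratio_tendsto X)
    show "AE \<omega> in M. norm (N (X n) (u + Z \<omega> u - Z \<omega> 0) / measure lborel (scaled (X n))) \<le> 1" for n
      unfolding real_norm_def by (intro AE_I2 overlap_ratio_bound X)
  qed auto
  then show ?thesis by (simp add: paired_overlap_def prob_space)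
qed

lemma variance_smear_tendsto:
  assumes X: "filterlim X at_top sequentially" "\<And>n. X n > 0"
  shows "(\<lambda>n. (variance (\<lambda>\<omega>. measure (\<Gamma> \<omega>) (scaled (X n))) - L (autocorrelation (smear (scaled (X
      n))))) / measure lborel (scaled (X n))) \<longlonglongrightarrow> 0"
proof -
  note P = scaled_props[OF X(2)] and vp = scaled_volume_pos[OF X(2)]
  note [measurable] = P(1)
  let ?h = "\<lambda>n u. (paired_overlap (scaled (X n)) u - autocorrelation (smear (scaled (X n))) u) /
      measure lborel (scaled (X n))"
  have ih: "integrable \<alpha> (?h n)" for n
    by (intro integrable_divide integrable_overlap_difference P vp)
  have hm [measurable]: "?h n \<in> borel_measurable \<alpha>" for n using ih by (rule borel_measurable_integrable)
  have abs_h: "\<bar>?h n u\<bar> = \<bar>paired_overlap (scaled (X n)) u - autocorrelation (smear (scaled (X n)))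
      u\<bar> / measure lborel (scaled (X n))" for n u
    using vp[of n] by (simp add: abs_divide)
  have "(\<lambda>n. \<integral>\<^sup>+u. ennreal \<bar>?h n u\<bar> \<partial>\<alpha>) \<longlonglongrightarrow> (\<integral>\<^sup>+u. 0 \<partial>\<alpha>)"
  \<comment> \<open>\<open>norm_difference\<close> is a supremum over an uncountable family, so its
    measurability in \<open>u\<close> is not evident. The countable supremum along the sequence is
    measurable, lies below it, and inherits a finite integral by monotonicity.\<close>
  proof (rule nn_integral_dominated_convergence[where w = "\<lambda>u. SUP n. ennreal \<bar>?h n u\<bar>"])
    show "AE u in \<alpha>. ennreal \<bar>?h n u\<bar> \<le> (SUP n. ennreal \<bar>?h n u\<bar>)" for n
      by (intro AE_I2 SUP_upper) simp
    have "(\<integral>\<^sup>+u. (SUP n. ennreal \<bar>?h n u\<bar>) \<partial>\<alpha>) \<le> (\<integral>\<^sup>+y. norm_difference (distr M (borel \<Otimes>\<^sub>M borel)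
        (\<lambda>\<omega>. (Z \<omega> y, Z \<omega> 0))) (Q \<Otimes>\<^sub>M Q) \<partial>\<alpha>)"
      unfolding abs_h by (intro nn_integral_mono SUP_least overlap_difference_bound P vp)
    then show "(\<integral>\<^sup>+u. (SUP n. ennreal \<bar>?h n u\<bar>) \<partial>\<alpha>) < \<infinity>" using mixing by (rule le_less_trans)
    show "AE u in \<alpha>. (\<lambda>n. ennreal \<bar>?h n u\<bar>) \<longlonglongrightarrow> 0"
    proof (rule AE_I2)
      fix u
      have "(\<lambda>n. ?h n u) \<longlonglongrightarrow> 1 - 1"
        unfolding diff_divide_distrib by (intro tendsto_diff smear_ratio_tendsto paired_ratio_tendsto X)
      then have "(\<lambda>n. ?h n u) \<longlonglongrightarrow> 0" by (simp only: diff_self)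
      then have "(\<lambda>n. \<bar>?h n u\<bar>) \<longlonglongrightarrow> 0" by (rule tendsto_rabs_zero)
      from tendsto_ennrealI[OF this] show "(\<lambda>n. ennreal \<bar>?h n u\<bar>) \<longlonglongrightarrow> 0" by (simp only: ennreal_0)
    qed
  qed auto
  then have lim: "(\<lambda>n. \<integral>\<^sup>+u. ennreal \<bar>?h n u\<bar> \<partial>\<alpha>) \<longlonglongrightarrow> 0" by simp
  have "(\<lambda>n. ennreal \<bar>\<integral>u. ?h n u \<partial>\<alpha>\<bar>) \<longlonglongrightarrow> 0"
  proof (rule tendsto_sandwich[OF _ _ tendsto_const lim])
    show "eventually (\<lambda>n. ennreal \<bar>\<integral>u. ?h n u \<partial>\<alpha>\<bar> \<le> (\<integral>\<^sup>+u. ennreal \<bar>?h n u\<bar> \<partial>\<alpha>)) sequentially"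
      using integral_norm_bound_ennreal[OF ih] by (auto intro!: always_eventually)
  qed simp
  then have "(\<lambda>n. \<bar>\<integral>u. ?h n u \<partial>\<alpha>\<bar>) \<longlonglongrightarrow> 0" by (subst (asm) ennreal_tendsto_0_iff) auto
  then have "(\<lambda>n. \<integral>u. ?h n u \<partial>\<alpha>) \<longlonglongrightarrow> 0" by (simp only: tendsto_rabs_zero_iff)
  moreover have "(\<integral>u. ?h n u \<partial>\<alpha>) = (variance (\<lambda>\<omega>. measure (\<Gamma> \<omega>) (scaled (X n))) - L (autocorrelation
      (smear (scaled (X n))))) / measure lborel (scaled (X n))" for n
    using displaced_variance(2)[OF P(4,1) vp, of n] by simp
  ultimately show ?thesis by (simp only:)
qed

end

section \<open>Comparison of the asymptotic variances\<close>

text \<open>Dominated convergence is sequential and the window estimates need a positive scale;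
  replacing \<open>X n\<close> by \<open>max 1 (X n)\<close> changes only finitely many
  terms.\<close>

lemma tendsto_at_top_sequentially_pos:
  fixes f :: "real \<Rightarrow> real"
  assumes "\<And>X. filterlim X at_top sequentially \<Longrightarrow> (\<And>n. X n > 0) \<Longrightarrow> (\<lambda>n. f (X n)) \<longlonglongrightarrow> y"
  shows "(f \<longlongrightarrow> y) at_top"
proof (rule tendsto_at_topI_sequentially)
  fix X :: "nat \<Rightarrow> real" assume X: "filterlim X at_top sequentially"
  define X' where "X' n = max 1 (X n)" for n
  have "eventually (\<lambda>n. 1 \<le> X n) sequentially" using X by (simp add: filterlim_at_top)
  then have ev: "eventually (\<lambda>n. X' n = X n) sequentially" by eventually_elim (simp add: X'_def)
  then have "filterlim X' at_top sequentially" using X filterlim_cong[OF refl refl ev] by simp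
  then have "(\<lambda>n. f (X' n)) \<longlonglongrightarrow> y" by (rule assms) (simp add: X'_def)
  moreover have "eventually (\<lambda>n. f (X' n) = f (X n)) sequentially" using ev by eventually_elim simp
  ultimately show "(\<lambda>n. f (X n)) \<longlonglongrightarrow> y" by (rule Lim_transform_eventually)
qed

section \<open>Covariance measures of finite total variation\<close>

context stationary_random_measure
begin

text \<open>The Hahn decomposition of the covariance measure is taken with respect to densities of
  \<open>\<alpha>\<close> and \<open>\<gamma>\<^sup>2 \<lambda>\<close> relative to their sum.\<close>

lemma covariance_density:
  assumes tv: "total_variation (covariance_measure M \<Phi>) UNIV < \<infinity>"
  obtains m and p q :: "real ^ 'd \<Rightarrow> real"
  where "sets m = sets borel" "p \<in> borel_measurable borel" "q \<in> borel_measurable borel"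
    "\<And>x. 0 \<le> p x" "\<And>x. 0 \<le> q x" "\<alpha> = density m (\<lambda>x. ennreal (p x))"
    "density lborel (\<lambda>_. ennreal (\<gamma>\<^sup>2)) = density m (\<lambda>x. ennreal (q x))" "integrable m (\<lambda>x. p x - q x)"
proof -
  define l where "l = density lborel (\<lambda>_ :: real ^ 'd. ennreal (\<gamma>\<^sup>2))"
  define m where "m = measure_of UNIV (sets (borel :: (real ^ 'd) measure)) (\<lambda>A. emeasure \<alpha> A +
      emeasure l A)"
  have sets_l [simp, measurable_cong]: "sets l = sets borel" by (simp add: l_def)
  have sets_m [simp, measurable_cong]: "sets m = sets borel"
    using sets.sigma_sets_eq[of "borel :: (real ^ 'd) measure"] by (simp add: m_def)
  have space_m [simp]: "space m = UNIV" using sets_eq_imp_space_eq[OF sets_m] by simp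
  have em: "emeasure m A = emeasure \<alpha> A + emeasure l A" if "A \<in> sets borel" for A
  proof (rule emeasure_measure_of[OF m_def])
    show "countably_additive (sets m) (\<lambda>A. emeasure \<alpha> A + emeasure l A)"
    proof (rule countably_additiveI)
      fix F :: "nat \<Rightarrow> (real ^ 'd) set"
      assume F: "range F \<subseteq> sets m" "disjoint_family F" "\<Union> (range F) \<in> sets m"
      have "(\<Sum>i. emeasure \<alpha> (F i) + emeasure l (F i)) = (\<Sum>i. emeasure \<alpha> (F i)) + (\<Sum>i. emeasure l (F i))"
        by (rule suminf_add[symmetric]) auto
      then show "(\<Sum>i. emeasure \<alpha> (F i) + emeasure l (F i)) = emeasure \<alpha> (\<Union> (range F)) + emeasure l
          (\<Union> (range F))"
        using F by (simp add: suminf_emeasure)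
    qed
  qed (use that in \<open>auto simp: positive_def\<close>)
  have l_lf: "l \<in> locally_finite_measures"
    unfolding locally_finite_measures_def
  proof (intro CollectI conjI ballI impI)
    fix B :: "(real ^ 'd) set" assume "B \<in> sets borel" "bounded B"
    then show "emeasure l B < \<infinity>" using emeasure_bounded_finite[of B]
      by (simp add: l_def emeasure_density nn_integral_cmult_indicator ennreal_mult_less_top)
  qed simp
  have m_lf: "m \<in> locally_finite_measures"
    unfolding locally_finite_measures_def using locally_finite_measuresD(3)[OF l_lf]
        locally_finite_measuresD(3)[OF alpha_lf]
    by (auto simp: em)
  interpret sm: sigma_finite_measure m by (rule sigma_finite_locally_finite[OF m_lf])
  have ac: "absolutely_continuous m \<alpha>" "absolutely_continuous m l"
    unfolding absolutely_continuous_def by (auto simp: null_sets_def em)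
  have dens: "\<exists>p. p \<in> borel_measurable borel \<and> (\<forall>x. 0 \<le> p x) \<and> \<nu> = density m (\<lambda>x. ennreal (p x))"
    if "absolutely_continuous m \<nu>" "\<nu> \<in> locally_finite_measures" for \<nu>
  proof -
    have s: "sets \<nu> = sets m" using locally_finite_measuresD(1)[OF that(2)] by simp
    have fin: "AE x in m. RN_deriv m \<nu> x \<noteq> \<infinity>"
      by (rule sm.RN_deriv_finite[OF sigma_finite_locally_finite[OF that(2)] that(1) s])
    have "\<nu> = density m (RN_deriv m \<nu>)" by (rule sm.density_RN_deriv[OF that(1) s, symmetric])
    also have "\<dots> = density m (\<lambda>x. ennreal (enn2real (RN_deriv m \<nu> x)))"
      by (rule density_cong) (use fin in \<open>auto elim!: eventually_mono simp: less_top\<close>)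
    finally show ?thesis
      using borel_measurable_RN_deriv[of m \<nu>] by (intro exI[of _ "\<lambda>x. enn2real (RN_deriv m \<nu> x)"])
          (auto cong: measurable_cong_sets)
  qed
  obtain p where p [measurable]: "p \<in> borel_measurable borel" and p0: "\<And>x. 0 \<le> p x" and pa: "\<alpha> =
      density m (\<lambda>x. ennreal (p x))"
    using dens[OF ac(1) alpha_lf] by auto
  obtain q where q [measurable]: "q \<in> borel_measurable borel" and q0: "\<And>x. 0 \<le> q x" and ql: "l =
      density m (\<lambda>x. ennreal (q x))"
    using dens[OF ac(2) l_lf] by auto
  have set_int: "integrable m (\<lambda>x. p x * indicator A x)" "measure \<alpha> A = (\<integral>x. p x * indicator A x \<partial>m)"
     "integrable m (\<lambda>x. q x * indicator A x)" "measure l A = (\<integral>x. q x * indicator A x \<partial>m)"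
    if A: "A \<in> sets borel" "bounded A" for A
  proof -
    note [measurable] = A(1)
    have i: "integrable \<alpha> (indicator A :: _ \<Rightarrow> real)" "integrable l (indicator A :: _ \<Rightarrow> real)"
      using locally_finite_measuresD(3)[OF alpha_lf A(2,1)] locally_finite_measuresD(3)[OF l_lf
          A(2,1)] A(1) by (simp_all add: integrable_indicator_iff)
    show "integrable m (\<lambda>x. p x * indicator A x)" using i(1) unfolding pa by (subst (asm)
        integrable_density) (auto simp: p0)
    show "integrable m (\<lambda>x. q x * indicator A x)" using i(2) unfolding ql by (subst (asm)
        integrable_density) (auto simp: q0)
    have "measure \<alpha> A = (\<integral>x. indicator A x \<partial>\<alpha>)" by simp
    also have "\<dots> = (\<integral>x. p x * indicator A x \<partial>m)" unfolding pa by (subst integral_density) (auto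
        simp: p0)
    finally show "measure \<alpha> A = (\<integral>x. p x * indicator A x \<partial>m)" .
    have "measure l A = (\<integral>x. indicator A x \<partial>l)" using locally_finite_measuresD(2)[OF l_lf] by simp
    also have "\<dots> = (\<integral>x. q x * indicator A x \<partial>m)" unfolding ql by (subst integral_density) (auto
        simp: q0)
    finally show "measure l A = (\<integral>x. q x * indicator A x \<partial>m)" .
  qed
  have lA: "measure l A = \<gamma>\<^sup>2 * measure lborel A" if [measurable]: "A \<in> sets borel" for A
    by (simp add: measure_def l_def emeasure_density nn_integral_cmult_indicator enn2real_mult)
  have cov: "covariance_measure M \<Phi> A = (\<integral>x. (p x - q x) * indicator A x \<partial>m)" if A: "A \<in> sets borel"
      "bounded A" for A
  proof -
    have "covariance_measure M \<Phi> A = measure \<alpha> A - measure l A" by (simp add: covariance_measure_def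
        lA[OF A(1)])
    also have "\<dots> = (\<integral>x. p x * indicator A x - q x * indicator A x \<partial>m)"
      unfolding set_int(2,4)[OF A] by (rule Bochner_Integration.integral_diff[symmetric, OF
          set_int(1,3)[OF A]])
    finally show ?thesis by (simp add: left_diff_distrib)
  qed
  \<comment> \<open>\<open>total_variation\<close> is tested on bounded sets only. Inside a ball the
    sets where the density p - q is nonnegative and negative form a test family; the balls are
    exhausted afterwards.\<close>
  have bound: "(\<integral>\<^sup>+x. ennreal \<bar>p x - q x\<bar> * indicator (cball 0 (real n)) x \<partial>m) \<le> total_variation
      (covariance_measure M \<Phi>) UNIV" for n
  proof -
    let ?A = "{x. 0 \<le> p x - q x} \<inter> cball 0 (real n)" and ?B = "{x. p x - q x < 0} \<inter> cball 0 (real n)"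
    have A: "?A \<in> sets borel" "bounded ?A" and B: "?B \<in> sets borel" "bounded ?B" by (auto intro:
        bounded_Int)
    let ?\<beta> = "covariance_measure M \<Phi>"
    have iA: "integrable m (\<lambda>x. (p x - q x) * indicator ?A x)" and iB: "integrable m (\<lambda>x. (p x - q
        x) * indicator ?B x)"
      using set_int(1,3)[OF A] set_int(1,3)[OF B] by (simp_all add: left_diff_distrib)
    have "(\<integral>\<^sup>+x. ennreal \<bar>p x - q x\<bar> * indicator (cball 0 (real n)) x \<partial>m) = (\<integral>\<^sup>+x. ennreal ((p x - q
        x) * indicator ?A x - (p x - q x) * indicator ?B x) \<partial>m)"
      by (intro nn_integral_cong) (auto simp: indicator_def)
    also have "\<dots> = ennreal (\<integral>x. (p x - q x) * indicator ?A x - (p x - q x) * indicator ?B x \<partial>m)"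
      by (rule nn_integral_eq_integral[OF Bochner_Integration.integrable_diff[OF iA iB]]) (auto
          simp: indicator_def)
    also have "(\<integral>x. (p x - q x) * indicator ?A x - (p x - q x) * indicator ?B x \<partial>m) = ?\<beta> ?A - ?\<beta> ?B"
      unfolding cov[OF A] cov[OF B] by (rule Bochner_Integration.integral_diff[OF iA iB])
    also have "ennreal (?\<beta> ?A - ?\<beta> ?B) \<le> (\<Sum>C\<in>{?A, ?B}. ennreal \<bar>?\<beta> C\<bar>)"
    proof (cases "?A = ?B")
      \<comment> \<open>If the two sets coincide, \<open>{?A, ?B}\<close> has one element and the
        left side is 0.\<close>
      case True then show ?thesis by simp
    next
      case False
      have "ennreal (?\<beta> ?A - ?\<beta> ?B) \<le> ennreal (\<bar>?\<beta> ?A\<bar> + \<bar>?\<beta> ?B\<bar>)" by (intro ennreal_leI) simp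
      then show ?thesis using False by simp
    qed
    also have "\<dots> \<le> total_variation ?\<beta> UNIV"
      unfolding total_variation_def
    proof (rule SUP_upper, intro CollectI conjI ballI)
      show "disjoint {?A, ?B}" by (auto simp: disjoint_def)
    qed (use A B in auto)
    finally show ?thesis .
  qed
  have "(\<integral>\<^sup>+x. ennreal \<bar>p x - q x\<bar> \<partial>m) = (\<integral>\<^sup>+x. (SUP n. ennreal \<bar>p x - q x\<bar> * indicator (cball 0
      (real n)) x) \<partial>m)"
  proof (rule nn_integral_cong)
    fix x :: "real ^ 'd"
    obtain n where "norm x \<le> real n" using real_arch_simple by blast
    then have "ennreal \<bar>p x - q x\<bar> \<le> (SUP n. ennreal \<bar>p x - q x\<bar> * indicator (cball 0 (real n)) x)"
      by (intro SUP_upper2[of n]) auto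
    moreover have "(SUP n. ennreal \<bar>p x - q x\<bar> * indicator (cball 0 (real n)) x) \<le> ennreal \<bar>p x - q x\<bar>"
      by (intro SUP_least) (auto simp: indicator_def)
    ultimately show "ennreal \<bar>p x - q x\<bar> = (SUP n. ennreal \<bar>p x - q x\<bar> * indicator (cball 0 (real
        n)) x)" by (rule antisym)
  qed
  also have "\<dots> = (SUP n. \<integral>\<^sup>+x. ennreal \<bar>p x - q x\<bar> * indicator (cball 0 (real n)) x \<partial>m)"
    by (rule nn_integral_monotone_convergence_SUP) (auto simp: incseq_def le_fun_def indicator_def)
  also have "\<dots> \<le> total_variation (covariance_measure M \<Phi>) UNIV" by (rule SUP_least) (rule bound)
  finally have "(\<integral>\<^sup>+x. ennreal \<bar>p x - q x\<bar> \<partial>m) < \<infinity>" using tv by (rule le_less_trans)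
  then have "integrable m (\<lambda>x. p x - q x)" by (intro integrableI_bounded) auto
  then show thesis using that[OF sets_m p q p0 q0 pa ql[unfolded l_def]] by blast
qed

text \<open>A constant majorant is in general not integrable for \<open>\<alpha>\<close> and
  Lebesgue measure separately, so the two integrals are merged into one with density p - q, whose
  absolute value is integrable and serves as majorant.\<close>

lemma L_dominated_tendsto:
  assumes tv: "total_variation (covariance_measure M \<Phi>) UNIV < \<infinity>"
    and int: "\<And>n. integrable \<alpha> (F n)" "\<And>n. integrable lborel (F n)"
    and bd: "\<And>n u. \<bar>F n u\<bar> \<le> 1" and lim: "\<And>u. (\<lambda>n. F n u) \<longlonglongrightarrow> 0"
  shows "(\<lambda>n. L (F n)) \<longlonglongrightarrow> 0"
proof -
  obtain m and p q :: "real ^ 'd \<Rightarrow> real"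
    where [measurable_cong]: "sets m = sets borel" and [measurable]: "p \<in> borel_measurable borel" "q
        \<in> borel_measurable borel"
    and p0: "\<And>x. 0 \<le> p x" and q0: "\<And>x. 0 \<le> q x" and pa: "\<alpha> = density m (\<lambda>x. ennreal (p x))"
    and ql: "density lborel (\<lambda>_. ennreal (\<gamma>\<^sup>2)) = density m (\<lambda>x. ennreal (q x))" and i: "integrable
        m (\<lambda>x. p x - q x)"
    using covariance_density[OF tv] by blast
  have [measurable]: "F n \<in> borel_measurable borel" for n using int(2)[of n] by simp
  have eq: "L (F n) = (\<integral>x. (p x - q x) * F n x \<partial>m)" for n
  proof -
    have "integrable (density m (\<lambda>x. ennreal (p x))) (F n)" using int(1)[of n] pa by simp
    then have ip: "integrable m (\<lambda>x. p x * F n x)" by (subst (asm) integrable_density) (auto simp: p0)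
    have "integrable (density lborel (\<lambda>_. ennreal (\<gamma>\<^sup>2))) (F n)" using int(2)[of n] by (subst
        integrable_density) auto
    then have iq: "integrable m (\<lambda>x. q x * F n x)" unfolding ql by (subst (asm) integrable_density)
        (auto simp: q0)
    have 1: "(\<integral>u. F n u \<partial>\<alpha>) = (\<integral>x. p x * F n x \<partial>m)"
      unfolding pa by (subst integral_density) (auto simp: p0)
    have "\<gamma>\<^sup>2 * (\<integral>u. F n u \<partial>lborel) = (\<integral>u. F n u \<partial>density lborel (\<lambda>_. ennreal (\<gamma>\<^sup>2)))"
      by (subst integral_density) auto
    also have "\<dots> = (\<integral>x. q x * F n x \<partial>m)" unfolding ql by (subst integral_density) (auto simp: q0)
    finally have 2: "\<gamma>\<^sup>2 * (\<integral>u. F n u \<partial>lborel) = (\<integral>x. q x * F n x \<partial>m)" .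
    have "L (F n) = (\<integral>x. p x * F n x - q x * F n x \<partial>m)"
      unfolding L_def 1 2 by (rule Bochner_Integration.integral_diff[symmetric, OF ip iq])
    then show ?thesis by (simp add: left_diff_distrib)
  qed
  have "(\<lambda>n. \<integral>x. (p x - q x) * F n x \<partial>m) \<longlonglongrightarrow> (\<integral>x. 0 \<partial>m)"
  proof (rule integral_dominated_convergence[where w = "\<lambda>x. \<bar>p x - q x\<bar>"])
    show "integrable m (\<lambda>x. \<bar>p x - q x\<bar>)" by (rule integrable_abs[OF i])
    show "AE x in m. (\<lambda>n. (p x - q x) * F n x) \<longlonglongrightarrow> 0"
      by (intro AE_I2 tendsto_mult_right_zero lim)
    show "AE x in m. norm ((p x - q x) * F n x) \<le> \<bar>p x - q x\<bar>" for n
      using bd by (intro AE_I2) (simp add: abs_mult mult_left_le)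
  qed measurable
  then show ?thesis by (simp add: eq)
qed

end

section \<open>Sharp and smeared windows compared as the scale grows\<close>

context windowed_displacement
begin

text \<open>For r > 0, \<open>Vw r\<close> is the variance of \<Phi>(rW) and \<open>Uw r\<close>
  that of the smeared window; under mixing the latter stands in for the variance of
  \<Gamma>(rW).\<close>

abbreviation Vw :: "real \<Rightarrow> real" where "Vw r \<equiv> L (N r)"

abbreviation Uw :: "real \<Rightarrow> real" where "Uw r \<equiv> L (autocorrelation (smear (scaled r)))"

lemma Uw_bounds: assumes "r > 0" shows "0 \<le> Uw r" "Uw r \<le> Vw r"
proof -
  note P = scaled_props[OF assms]
  note S = V_eq[OF admissible_smear[OF P(4,1)]] and I = V_eq[OF admissible_scaled[OF assms]]
  show "0 \<le> Uw r" by (rule S(5))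
  show "Uw r \<le> Vw r" using V_smear_le[OF P(4,1)] unfolding S(4) I(4) using I(5) by (simp add:
      ennreal_le_iff)
qed

lemma asymptotic_variance_iff:
  "has_asymptotic_variance M \<Phi> W s \<longleftrightarrow> ((\<lambda>r. Vw r / measure lborel (scaled r)) \<longlongrightarrow> s) at_top"
proof -
  have ev: "eventually (\<lambda>r. variance (\<lambda>\<omega>. measure (\<Phi> \<omega>) (scaled r)) / measure lborel (scaled r) = Vw
      r / measure lborel (scaled r)) at_top"
    using eventually_gt_at_top[of "0 :: real"]
  proof eventually_elim
    case (elim r)
    then show ?case
      using V_eq(4,5)[OF admissible_scaled[OF elim]] by (simp add: variance_indicator[OF
          scaled_props(4,1)[OF elim]])
  qed
  have m: "(\<lambda>\<omega>. emeasure (\<Phi> \<omega>) (scaled r)) \<in> borel_measurable M" if "r > 0" for r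
    using measurable_compose[OF random measurable_emeasure_locally_finite_algebra[OF
        scaled_props(1)[OF that]]] .
  show ?thesis
    unfolding has_asymptotic_variance_def using m finite_second_moment scaled_props(1,4)
    by (simp add: filterlim_cong[OF refl refl ev])
qed

lemma displaced_asymptotic_variance_iff:
  "has_asymptotic_variance M \<Gamma> W s \<longleftrightarrow> ((\<lambda>r. Uw r / measure lborel (scaled r)) \<longlongrightarrow> s) at_top"
proof -
  let ?v = "\<lambda>r. variance (\<lambda>\<omega>. measure (\<Gamma> \<omega>) (scaled r)) / measure lborel (scaled r)"
  let ?u = "\<lambda>r. Uw r / measure lborel (scaled r)"
  have d: "((\<lambda>r. ?v r - ?u r) \<longlongrightarrow> 0) at_top"
    using variance_smear_tendsto by (intro tendsto_at_top_sequentially_pos) (simp add: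
        diff_divide_distrib)
  have "(?v \<longlongrightarrow> s) at_top \<longleftrightarrow> (?u \<longlongrightarrow> s) at_top"
  proof
    assume "(?v \<longlongrightarrow> s) at_top"
    from tendsto_diff[OF this d] show "(?u \<longlongrightarrow> s) at_top" by simp
  next
    assume "(?u \<longlongrightarrow> s) at_top"
    from tendsto_add[OF this d] show "(?v \<longlongrightarrow> s) at_top" by simp
  qed
  then show ?thesis
    unfolding has_asymptotic_variance_def
    using displaced_variance(1)[OF scaled_props(4,1) scaled_volume_pos]
        emeasure_displaced_measurable[OF scaled_props(1)] by blast
qed

lemma hyperuniform_displaced:
  assumes "hyperuniform M \<Phi> W" shows "hyperuniform M \<Gamma> W"
proof -
  have V: "((\<lambda>r. Vw r / measure lborel (scaled r)) \<longlongrightarrow> 0) at_top"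
    using assms by (simp add: hyperuniform_def asymptotic_variance_iff)
  have "((\<lambda>r. Uw r / measure lborel (scaled r)) \<longlongrightarrow> 0) at_top"
  proof (rule tendsto_sandwich[OF _ _ tendsto_const V])
    show "eventually (\<lambda>r. 0 \<le> Uw r / measure lborel (scaled r)) at_top"
      using eventually_gt_at_top[of "0 :: real"] by eventually_elim (simp add: Uw_bounds)
    show "eventually (\<lambda>r. Uw r / measure lborel (scaled r) \<le> Vw r / measure lborel (scaled r)) at_top"
      using eventually_gt_at_top[of "0 :: real"] by eventually_elim (intro divide_right_mono
          Uw_bounds, auto)
  qed
  then show ?thesis by (simp add: hyperuniform_def displaced_asymptotic_variance_iff)
qed

text \<open>The normalised overlaps of the sharp and of the smeared window both lie in [0, 1] and
  tend to 1 at each lag, so their difference satisfies the hypotheses of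
  \<open>L_dominated_tendsto\<close>.\<close>

lemma difference_tendsto_total_variation:
  assumes tv: "total_variation (covariance_measure M \<Phi>) UNIV < \<infinity>"
  shows "((\<lambda>r. (Vw r - Uw r) / measure lborel (scaled r)) \<longlongrightarrow> 0) at_top"
proof (rule tendsto_at_top_sequentially_pos)
  fix X :: "nat \<Rightarrow> real" assume X: "filterlim X at_top sequentially" "\<And>n. X n > 0"
  note P = scaled_props[OF X(2)] and vp = scaled_volume_pos[OF X(2)]
  note admN = admissible_scaled[OF X(2)] and admS = admissible_smear[OF P(4,1)]
  let ?v = "\<lambda>n. measure lborel (scaled (X n))"
  let ?F = "\<lambda>n u. N (X n) u / ?v n - autocorrelation (smear (scaled (X n))) u / ?v n"
  have iN: "integrable \<alpha> (N (X n))" "integrable lborel (N (X n))" for n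
    using V_eq(1)[OF admN] autocorrelation_lborel(1) admN by (auto simp: admissible_def)
  have iS: "integrable \<alpha> (autocorrelation (smear (scaled (X n))))" "integrable lborel
      (autocorrelation (smear (scaled (X n))))" for n
    using V_eq(1)[OF admS] autocorrelation_lborel(1) admS by (auto simp: admissible_def)
  have sb: "0 \<le> autocorrelation (smear (scaled (X n))) u" "autocorrelation (smear (scaled (X n))) u
      \<le> ?v n" for n u
  proof -
    show "0 \<le> autocorrelation (smear (scaled (X n))) u"
      unfolding autocorrelation_def by (intro Bochner_Integration.integral_nonneg) (simp add:
          smear_nonneg)
    interpret QQ: pair_prob_space Q Q ..
    note [measurable] = P(1)
    have "integrable (Q \<Otimes>\<^sub>M Q) (\<lambda>p. N (X n) (u + fst p - snd p))"
    proof (rule QQ.P.integrable_const_bound[of _ "?v n"])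
      show "AE p in Q \<Otimes>\<^sub>M Q. norm (N (X n) (u + fst p - snd p)) \<le> ?v n"
        using overlap_bounds[OF P(4,1)] by simp
    qed measurable
    then show "autocorrelation (smear (scaled (X n))) u \<le> ?v n"
      unfolding autocorrelation_smear[OF P(4,1)]
      by (rule QQ.P.integral_le_const) (use overlap_bounds[OF P(4,1)] in simp)
  qed
  have "(\<lambda>n. L (?F n)) \<longlonglongrightarrow> 0"
  proof (rule L_dominated_tendsto[OF tv])
    show "integrable \<alpha> (?F n)" "integrable lborel (?F n)" for n using iN iS by auto
    show "\<bar>?F n u\<bar> \<le> 1" for n u
    proof -
      have "0 \<le> N (X n) u / ?v n" "N (X n) u / ?v n \<le> 1" "0 \<le> autocorrelation (smear (scaled (X n)))
          u / ?v n" "autocorrelation (smear (scaled (X n))) u / ?v n \<le> 1"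
        using overlap_bounds[OF P(4,1), of n u] sb[of n u] vp[of n] by (auto simp: divide_le_eq)
      then show ?thesis by linarith
    qed
    show "(\<lambda>n. ?F n u) \<longlonglongrightarrow> 0" for u
      using tendsto_diff[OF overlap_ratio_tendsto[OF X] smear_ratio_tendsto[OF X]] by simp
  qed
  moreover have "L (?F n) = (Vw (X n) - Uw (X n)) / ?v n" for n
    using iN iS by (simp add: L_def diff_divide_distrib right_diff_distrib)
  ultimately show "(\<lambda>n. (Vw (X n) - Uw (X n)) / ?v n) \<longlonglongrightarrow> 0" by simp
qed

text \<open>The sharp window is split into the smeared window and an average of increments. Young's
  inequality with a free \<open>e\<close> handles the cross term: the factor of \<open>Uw r\<close>
  can be brought close to 1 at the price of 1 / e on the increments.\<close>

lemma smoothing_inequality: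
  assumes r: "r > 0" and e: "e > 0" and A: "\<And>z. L (autocorrelation (increment (scaled r) z)) \<le> A * \<Omega> z"
    and \<Omega>: "integrable Q (\<lambda>z. \<Omega> (- z))" and A\<Omega>: "\<And>z. 0 \<le> A * \<Omega> z"
  shows "Vw r \<le> (1 + e) * Uw r + (1 + 1 / e) * (A * (\<integral>z. \<Omega> (- z) \<partial>Q))"
proof -
  note P = scaled_props[OF r]
  note admN = admissible_scaled[OF r] and admS = admissible_smear[OF P(4,1)]
  have "V (\<lambda>x. indicator (scaled r) x - smear (scaled r) x) \<le> (\<integral>\<^sup>+z. V (increment (scaled r) (- z)) \<partial>Q)"
    by (rule V_indicator_diff_smear[OF P(4,1)])
  also have "\<dots> \<le> (\<integral>\<^sup>+z. ennreal (A * \<Omega> (- z)) \<partial>Q)"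
    by (intro nn_integral_mono) (simp add: V_eq(4)[OF admissible_increment[OF r]] A ennreal_leI)
  also have "\<dots> = ennreal (\<integral>z. A * \<Omega> (- z) \<partial>Q)"
    by (rule nn_integral_eq_integral) (use \<Omega> A\<Omega> in auto)
  finally have D: "V (\<lambda>x. indicator (scaled r) x - smear (scaled r) x) \<le> ennreal (A * (\<integral>z. \<Omega> (- z)
      \<partial>Q))" by simp
  have nn: "0 \<le> A * (\<integral>z. \<Omega> (- z) \<partial>Q)"
  proof -
    have "0 \<le> (\<integral>z. A * \<Omega> (- z) \<partial>Q)" by (intro Bochner_Integration.integral_nonneg A\<Omega>)
    then show ?thesis by simp
  qed
  have "ennreal (Vw r) = V (indicator (scaled r))" by (rule V_eq(4)[OF admN, symmetric])
  also have "\<dots> \<le> ennreal (1 + e) * V (smear (scaled r)) + ennreal (1 + 1 / e) * V (\<lambda>x. indicator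
      (scaled r) x - smear (scaled r) x)"
    using admN admS e by (intro V_le_add) (auto simp: admissible_def)
  also have "\<dots> \<le> ennreal (1 + e) * ennreal (Uw r) + ennreal (1 + 1 / e) * ennreal (A * (\<integral>z. \<Omega> (- z)
      \<partial>Q))"
    unfolding V_eq(4)[OF admS] by (intro add_mono mult_left_mono D) auto
  also have "\<dots> = ennreal ((1 + e) * Uw r + (1 + 1 / e) * (A * (\<integral>z. \<Omega> (- z) \<partial>Q)))"
    by (subst ennreal_plus) (use e nn Uw_bounds(1)[OF r] in \<open>auto simp: ennreal_mult\<close>)
  finally have *: "ennreal (Vw r) \<le> ennreal ((1 + e) * Uw r + (1 + 1 / e) * (A * (\<integral>z. \<Omega> (- z) \<partial>Q)))" .
  have "0 \<le> (1 + e) * Uw r + (1 + 1 / e) * (A * (\<integral>z. \<Omega> (- z) \<partial>Q))"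
    using e by (intro add_nonneg_nonneg mult_nonneg_nonneg[OF _ nn] mult_nonneg_nonneg[OF _
        Uw_bounds(1)[OF r]]) auto
  then show ?thesis using * by (simp only: ennreal_le_iff)
qed

text \<open>The estimate for increments of \<open>scaled r\<close> needs bounds on \<open>Vw\<close>
  at all scales up to \<open>r\<close>, while the hypothesis only bounds \<open>Uw\<close>, the
  smaller of the two. A bound of \<open>Vw r\<close> by a multiple of r^d at all scales is therefore
  obtained by a bootstrap, after which \<open>e\<close> is fixed before \<open>r\<close>
  grows.\<close>

lemma difference_tendsto_fourier_smooth:
  assumes smooth: "fourier_smooth W" and bounded: "eventually (\<lambda>r. Uw r \<le> C * r ^ CARD('d)) at_top"
  shows "((\<lambda>r. (Vw r - Uw r) / measure lborel (scaled r)) \<longlongrightarrow> 0) at_top"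
proof -
  let ?d = "CARD('d)"
  obtain \<Omega> B where \<Omega>m [measurable]: "\<Omega> \<in> borel_measurable borel" and \<Omega>0: "\<And>t. 0 \<le> \<Omega> t" and \<Omega>B: "\<And>t.
      \<Omega> t \<le> B"
    and \<Omega>lim: "\<And>t. t \<longlonglongrightarrow> 0 \<Longrightarrow> (\<lambda>n. \<Omega> (t n)) \<longlonglongrightarrow> 0"
    and inc: "\<And>r A z. 0 < r \<Longrightarrow> (\<And>s. 0 < s \<Longrightarrow> s \<le> r \<Longrightarrow> Vw s \<le> A * s ^ ?d) \<Longrightarrow>
      L (autocorrelation (increment (scaled r) z)) \<le> A * r ^ ?d * \<Omega> (norm z / r)"
    using increment_variance_bound[OF smooth] by blast
  \<comment> \<open>Average of the increment factor over the displacement. It tends to 0 by bounded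
    convergence, because |z| / r tends to 0 for each z.\<close>
  define \<omega> where "\<omega> r = (\<integral>z. \<Omega> (norm (- z) / r) \<partial>Q)" for r
  have i\<Omega>: "integrable Q (\<lambda>z. \<Omega> (norm (- z) / r))" for r
  proof (rule Q.integrable_const_bound[of _ B])
    show "AE z in Q. norm (\<Omega> (norm (- z) / r)) \<le> B" using \<Omega>0 \<Omega>B by simp
  qed measurable
  have \<omega>0: "0 \<le> \<omega> r" for r unfolding \<omega>_def by (intro Bochner_Integration.integral_nonneg \<Omega>0)
  have \<omega>lim: "(\<omega> \<longlongrightarrow> 0) at_top"
  proof (rule tendsto_at_top_sequentially_pos)
    fix X :: "nat \<Rightarrow> real" assume X: "filterlim X at_top sequentially"
    have "(\<lambda>n. \<integral>z. \<Omega> (norm (- z) / X n) \<partial>Q) \<longlonglongrightarrow> (\<integral>z. 0 \<partial>Q)"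
    proof (rule integral_dominated_convergence[where w = "\<lambda>_. B"])
      show "AE z in Q. (\<lambda>n. \<Omega> (norm (- z) / X n)) \<longlonglongrightarrow> 0"
        by (intro AE_I2 \<Omega>lim tendsto_divide_0[OF tendsto_const] filterlim_at_top_imp_at_infinity X)
      show "AE z in Q. norm (\<Omega> (norm (- z) / X n)) \<le> B" for n using \<Omega>0 \<Omega>B by simp
    qed (auto, measurable)
    then show "(\<lambda>n. \<omega> (X n)) \<longlonglongrightarrow> 0" by (simp add: \<omega>_def)
  qed
  have step: "Vw r \<le> (1 + e) * Uw r + (1 + 1 / e) * (A * r ^ ?d * \<omega> r)"
    if r: "r > 0" and e: "e > 0" and A: "\<And>s. 0 < s \<Longrightarrow> s \<le> r \<Longrightarrow> Vw s \<le> A * s ^ ?d" for r e A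
  proof -
    have "0 \<le> A * r ^ ?d" using A[OF r order_refl] L_window_nonneg[OF r] by linarith
    then have "0 \<le> A * r ^ ?d * \<Omega> (norm z / r)" for z :: "real ^ 'd" using \<Omega>0 by simp
    from smoothing_inequality[OF r e inc[OF r A] i\<Omega> this] show ?thesis by (simp add: \<omega>_def)
  qed
  obtain A where A: "\<And>r. 0 < r \<Longrightarrow> Vw r \<le> A * r ^ ?d"
  proof -
    obtain T0 where T0: "\<And>r. r \<ge> T0 \<Longrightarrow> Uw r \<le> C * r ^ ?d" using bounded by (auto simp:
        eventually_at_top_linorder)
    \<comment> \<open>With e = 1 the increment term carries the factor 2, so 1/4 leaves s / 2, which
      can be absorbed into s.\<close>
    have "eventually (\<lambda>r. \<omega> r < 1 / 4) at_top" using \<omega>lim by (rule order_tendstoD) simp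
    then obtain T1 where T1: "\<And>r. r \<ge> T1 \<Longrightarrow> \<omega> r < 1 / 4" by (auto simp: eventually_at_top_linorder)
    define T where "T = max 1 (max T0 T1)"
    obtain C1 where C1: "\<And>r. 0 < r \<Longrightarrow> r \<le> T \<Longrightarrow> Vw r \<le> C1 * r ^ ?d"
      using L_window_growth[of T] by blast
    \<comment> \<open>The bound on the increments involves the supremum over all smaller windows with a factor
      below 1, hence can be absorbed.\<close>
    have "Vw R \<le> max C1 (4 * C) * R ^ ?d" if R: "R > 0" for R
    proof -
      \<comment> \<open>The supremum over scales up to \<open>R\<close> is finite by
        \<open>L_window_growth\<close>, with a bound depending on \<open>R\<close>; absorption
        replaces it by one that does not.\<close>
      let ?S = "(\<lambda>r. Vw r / r ^ ?d) ` {0<..R}"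
      obtain C2 where C2: "\<And>r. 0 < r \<Longrightarrow> r \<le> R \<Longrightarrow> Vw r \<le> C2 * r ^ ?d" using L_window_growth[of R] by blast
      have bdd: "bdd_above ?S" by (rule bdd_aboveI[of _ C2]) (use C2 in \<open>auto simp: divide_le_eq\<close>)
      define s where "s = Sup ?S"
      have s: "Vw r \<le> s * r ^ ?d" if "0 < r" "r \<le> R" for r
      proof -
        have "Vw r / r ^ ?d \<le> s" unfolding s_def by (rule cSup_upper[OF _ bdd]) (use that in auto)
        then show ?thesis using that by (simp add: divide_le_eq)
      qed
      have s0: "0 \<le> s"
      proof -
        have "0 \<le> s * R ^ ?d" using s[OF R order_refl] L_window_nonneg[OF R] by linarith
        moreover have "R ^ ?d > 0" using R by simp
        ultimately show ?thesis by (meson mult_neg_pos not_le)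
      qed
      have "s \<le> max C1 (2 * C + s / 2)"
        unfolding s_def
      proof (rule cSup_least)
        show "?S \<noteq> {}" using R by auto
        fix y assume "y \<in> ?S"
        then obtain r where y: "y = Vw r / r ^ ?d" and r: "0 < r" "r \<le> R" by auto
        have "Vw r \<le> max C1 (2 * C + s / 2) * r ^ ?d"
        proof (cases "r \<le> T")
          case True
          have "Vw r \<le> C1 * r ^ ?d" by (rule C1[OF r(1) True])
          also have "\<dots> \<le> max C1 (2 * C + s / 2) * r ^ ?d" using r by (intro mult_right_mono) auto
          finally show ?thesis .
        next
          case False
          then have ge: "r \<ge> T0" "r \<ge> T1" by (auto simp: T_def)
          have "Vw r \<le> (1 + 1) * Uw r + (1 + 1 / 1) * (s * r ^ ?d * \<omega> r)"
            using s r by (intro step) auto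
          also have "\<dots> \<le> (1 + 1) * (C * r ^ ?d) + (1 + 1 / 1) * (s * r ^ ?d * (1 / 4))"
            using T0[OF ge(1)] T1[OF ge(2)] s0 r by (intro add_mono mult_left_mono) auto
          also have "\<dots> = (2 * C + s / 2) * r ^ ?d" by (simp add: algebra_simps)
          also have "\<dots> \<le> max C1 (2 * C + s / 2) * r ^ ?d" using r by (intro mult_right_mono) auto
          finally show ?thesis .
        qed
        then show "y \<le> max C1 (2 * C + Sup ?S / 2)" unfolding y s_def[symmetric] using r by (simp
            add: divide_le_eq)
      qed
      \<comment> \<open>Either s \<le> C1, or s \<le> 2 C + s / 2, which means s \<le> 4 C; the
        subtraction is legitimate because s is finite.\<close>
      then have "s \<le> max C1 (4 * C)" by (auto simp: max_def split: if_splits)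
      then have "s * R ^ ?d \<le> max C1 (4 * C) * R ^ ?d" using R by (intro mult_right_mono) auto
      then show ?thesis using s[OF R order_refl] by linarith
    qed
    then show thesis by (rule that)
  qed
  have A0: "0 \<le> A" using A[of 1] L_window_nonneg[of 1] by simp
  define v where "v = measure lborel W"
  have v: "v > 0" using volume by (simp add: v_def)
  show ?thesis
  proof (rule tendstoI)
    fix \<epsilon> :: real assume \<epsilon>: "\<epsilon> > 0"
    \<comment> \<open>Makes e A / v at most \<epsilon> / 2; the summand 1 keeps the denominator
      positive when A = 0.\<close>
    define e where "e = \<epsilon> * v / (2 * (A + 1))"
    have e: "e > 0" using \<epsilon> v A0 by (simp add: e_def)
    have eA: "e * A / v \<le> \<epsilon> / 2"
    proof -
      have k: "x * v / (2 * b) * A / v = x / 2 * (A / b)" if "b > 0" for x b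
        using v that by (simp add: field_simps)
      have "e * A / v = \<epsilon> / 2 * (A / (A + 1))"
        unfolding e_def by (rule k) (use A0 in simp)
      also have "\<dots> \<le> \<epsilon> / 2 * 1" using \<epsilon> A0 by (intro mult_left_mono) (auto simp: divide_le_eq)
      finally show ?thesis by simp
    qed
    have "((\<lambda>r. (1 + 1 / e) * A * \<omega> r / v) \<longlongrightarrow> (1 + 1 / e) * A * 0 / v) at_top"
      using v by (intro tendsto_intros \<omega>lim) auto
    then have "((\<lambda>r. (1 + 1 / e) * A * \<omega> r / v) \<longlongrightarrow> 0) at_top" by simp
    then have "eventually (\<lambda>r. (1 + 1 / e) * A * \<omega> r / v < \<epsilon> / 2) at_top"
      by (rule order_tendstoD) (use \<epsilon> in simp)
    with eventually_gt_at_top[of "0 :: real"]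
    show "eventually (\<lambda>r. dist ((Vw r - Uw r) / measure lborel (scaled r)) 0 < \<epsilon>) at_top"
    proof eventually_elim
      case (elim r)
      have rd: "r ^ ?d > 0" using elim(1) by simp
      have "Vw r - Uw r \<le> e * Uw r + (1 + 1 / e) * (A * r ^ ?d * \<omega> r)"
        using step[OF elim(1) e A] by (simp add: algebra_simps)
      also have "e * Uw r \<le> e * (A * r ^ ?d)"
        using Uw_bounds(2)[OF elim(1)] A[OF elim(1)] e by (intro mult_left_mono) auto
      finally have "Vw r - Uw r \<le> e * (A * r ^ ?d) + (1 + 1 / e) * (A * r ^ ?d * \<omega> r)" by simp
      also have "\<dots> = (e * A) * r ^ ?d + ((1 + 1 / e) * A * \<omega> r) * r ^ ?d"
        by (simp only: mult_ac)
      also have "\<dots> = (e * A / v + (1 + 1 / e) * A * \<omega> r / v) * (r ^ ?d * v)"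
      proof -
        have "a * x + b * x = (a / v + b / v) * (x * v)" for a b x using v by (simp add: field_simps)
        then show ?thesis .
      qed
      finally have "Vw r - Uw r \<le> (e * A / v + (1 + 1 / e) * A * \<omega> r / v) * (r ^ ?d * v)" .
      then have "(Vw r - Uw r) / (r ^ ?d * v) \<le> e * A / v + (1 + 1 / e) * A * \<omega> r / v"
        using rd v by (simp add: pos_divide_le_eq)
      also have "\<dots> < \<epsilon>" using eA elim(2) by linarith
      finally have "(Vw r - Uw r) / measure lborel (scaled r) < \<epsilon>"
        by (simp add: scaled_props(5)[OF elim(1)] v_def)
      moreover have "0 \<le> (Vw r - Uw r) / measure lborel (scaled r)"
        using Uw_bounds(2)[OF elim(1)] by simp
      ultimately show ?case by (simp add: dist_real_def)
    qed
  qed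
qed

text \<open>Whichever limit exists, \<open>Uw r \<le> Vw r\<close> bounds \<open>Uw r\<close> by a
  multiple of r^d for large \<open>r\<close>, as the Fourier smooth case requires; once the
  normalised difference tends to 0, the limit is transferred in either direction.\<close>

lemma asymptotic_variances_agree:
  assumes alt: "fourier_smooth W \<or> total_variation (covariance_measure M \<Phi>) UNIV < \<infinity>"
    and ex: "(\<exists>s. has_asymptotic_variance M \<Phi> W s) \<or> (\<exists>s. has_asymptotic_variance M \<Gamma> W s)"
  shows "\<exists>s. has_asymptotic_variance M \<Phi> W s \<and> has_asymptotic_variance M \<Gamma> W s"
proof -
  let ?v = "\<lambda>r. measure lborel (scaled r)"
  obtain s where s: "((\<lambda>r. Vw r / ?v r) \<longlongrightarrow> s) at_top \<or> ((\<lambda>r. Uw r / ?v r) \<longlongrightarrow> s) at_top"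
    using ex unfolding asymptotic_variance_iff displaced_asymptotic_variance_iff by blast
  have "eventually (\<lambda>r. Vw r / ?v r < s + 1) at_top \<or> eventually (\<lambda>r. Uw r / ?v r < s + 1) at_top"
    using s by (auto dest: order_tendstoD(2)[of _ s at_top "s + 1"])
  then have "eventually (\<lambda>r. Uw r / ?v r < s + 1) at_top"
  proof
    assume "eventually (\<lambda>r. Vw r / ?v r < s + 1) at_top"
    with eventually_gt_at_top[of "0 :: real"] show ?thesis
    proof eventually_elim
      case (elim r)
      have "Uw r / ?v r \<le> Vw r / ?v r" by (intro divide_right_mono Uw_bounds elim) simp
      then show ?case using elim by linarith
    qed
  qed
  with eventually_gt_at_top[of "0 :: real"]
  have bounded: "eventually (\<lambda>r. Uw r \<le> ((s + 1) * measure lborel W) * r ^ CARD('d)) at_top"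
  proof eventually_elim
    case (elim r)
    then have "Uw r < (s + 1) * ?v r" using scaled_volume_pos[OF elim(1)] by (simp add:
        pos_divide_less_eq)
    then show ?case by (simp add: scaled_props(5)[OF elim(1)] mult_ac)
  qed
  have d: "((\<lambda>r. (Vw r - Uw r) / ?v r) \<longlongrightarrow> 0) at_top"
    using alt difference_tendsto_fourier_smooth[OF _ bounded] difference_tendsto_total_variation by
        blast
  then have d: "((\<lambda>r. Vw r / ?v r - Uw r / ?v r) \<longlongrightarrow> 0) at_top" by (simp only: diff_divide_distrib)
  have "((\<lambda>r. Vw r / ?v r) \<longlongrightarrow> s) at_top \<and> ((\<lambda>r. Uw r / ?v r) \<longlongrightarrow> s) at_top"
    using s
  proof
    assume V: "((\<lambda>r. Vw r / ?v r) \<longlongrightarrow> s) at_top"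
    from tendsto_diff[OF V d] show ?thesis using V by simp
  next
    assume U: "((\<lambda>r. Uw r / ?v r) \<longlongrightarrow> s) at_top"
    from tendsto_add[OF U d] show ?thesis using U by simp
  qed
  then show ?thesis unfolding asymptotic_variance_iff displaced_asymptotic_variance_iff by blast
qed

end

section \<open>From the hypotheses of the theorem to the locales\<close>

lemma convex_windows_imp_convex_window:
  fixes W :: "(real ^ 'd) set"
  assumes "W \<in> convex_windows"
  obtains \<rho> where "convex_window W \<rho>"
proof -
  have W: "convex W" "bounded W" "0 \<in> interior W" "W \<in> sets borel"
    using assms by (auto simp: convex_windows_def)
  obtain b where b: "\<And>x. x \<in> W \<Longrightarrow> norm x \<le> b" using W(2) by (auto simp: bounded_iff)
  obtain e where e: "e > 0" "ball 0 e \<subseteq> W" using W(3) by (auto simp: mem_interior)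
  have "0 < measure lborel (ball (0 :: real ^ 'd) e)" using content_ball_pos[OF e(1)] by simp
  also have "\<dots> \<le> measure lborel W"
    using e(2) W(4) emeasure_bounded_finite[OF W(2)]
    by (intro measure_mono_fmeasurable) (auto simp: fmeasurable_def)
  \<comment> \<open>The radius is taken as |b| + 1 so as to be strictly positive whatever
    \<open>b\<close> is.\<close>
  finally have "convex_window W (\<bar>b\<bar> + 1)"
    using W b by unfold_locales (fastforce)+
  then show thesis by (rule that)
qed

theorem theorem5p1:
  fixes M :: "'w measure"
    and \<Phi> :: "'w \<Rightarrow> (real ^ 'd) measure"
    and Z :: "'w \<Rightarrow> real ^ 'd \<Rightarrow> real ^ 'd"
    and W :: "(real ^ 'd) set"
  assumes "prob_space M"
    and "random_measure M \<Phi>"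
    and "stationary_measure M \<Phi>"
    and "locally_square_integrable M \<Phi>"
    and "intensity M \<Phi> > 0"
    and "Z \<in> measurable M skorohod_algebra"
    and "stationary_field M Z"
    and "independent_elements M skorohod_algebra Z locally_finite_algebra \<Phi>"
    and "(\<integral>\<^sup>+y. norm_difference (distr M (borel \<Otimes>\<^sub>M borel) (\<lambda>\<omega>. (Z \<omega> y, Z \<omega> 0)))
                             (distr M borel (\<lambda>\<omega>. Z \<omega> 0) \<Otimes>\<^sub>M distr M borel (\<lambda>\<omega>. Z \<omega> 0))
            \<partial>(reduced_second_moment_measure M \<Phi>)) < \<infinity>"
    and "W \<in> convex_windows"
  shows "(hyperuniform M \<Phi> W \<longrightarrow> hyperuniform M (displaced_measure \<Phi> Z) W) \<and>
         (fourier_smooth W \<or> total_variation (covariance_measure M \<Phi>) UNIV < \<infinity> \<longrightarrow>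
           (\<exists>s. has_asymptotic_variance M \<Phi> W s) \<or>
           (\<exists>s. has_asymptotic_variance M (displaced_measure \<Phi> Z) W s) \<longrightarrow>
           (\<exists>s. has_asymptotic_variance M \<Phi> W s \<and>
                has_asymptotic_variance M (displaced_measure \<Phi> Z) W s))"
proof -
  obtain \<rho> where "convex_window W \<rho>"
    using convex_windows_imp_convex_window assms(10) by blast
  then interpret w: convex_window W \<rho> .
  interpret d: displaced_random_measure M \<Phi> Z
    using assms(1-4,6-8)
    by (intro displaced_random_measure.intro stationary_random_measure.intro
        displaced_random_measure_axioms.intro stationary_random_measure_axioms.intro)
       (auto simp: random_measure_def)
  interpret windowed_displacement M \<Phi> Z W \<rho>
    by unfold_locales (use assms(9) in \<open>simp add: d.Q_def\<close>)
  show ?thesis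
    using hyperuniform_displaced asymptotic_variances_agree by blast
qed

end
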